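(* Let $d\ge1$, $s\in(0,1)$, and $$\alpha=\frac{d}{d+2(1+s)},\qquad \beta=\frac1{d+2(1+s)} .$$ Given $M>0$, let $v_C$ be the obstacle solution described in the context, with the constant $C>0$ determined by the mass law $M=M_1C^{1+d/2+s}$. Then the self-similar function $$u_C(x,t):=\frac1{(1+t)^\alpha}\,v_C\!\left(\frac{x}{(1+t)^\beta}\right)$$ is a weak solution (in the sense defined in the context, for $t\ge0$, with initial datum $u_C(\cdot,0)=v_C$) of $$\partial_tu-\mathrm{div}(u\nabla p)=0,\qquad p=(-\Delta)^su\quad\text{in }\mathbb{R}^d\times(0,+\infty),$$ with mass $M$, and it satisfies (the formula for $u_C$ being used for all $t>-1$) $$\lim_{t\to-1^+}u_C(\cdot,t)=M\delta\quad\text{in }\mathscr{D}'(\mathbb{R}^d),$$ where $\delta$ is the Dirac mass at the origin.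
   Context: $(-\Delta)^s$ is the fractional Laplacian on $\mathbb{R}^d$ (Fourier multiplier $|\xi|^{2s}$). Obstacle solutions: let $\kappa_{s,d}=2^{2s}\Gamma(s+2)\Gamma(s+\frac d2)\Gamma(\frac d2)^{-1}$, $\gamma_{s,d}=1+\frac{2s}{d}$, $\lambda=\sqrt{\beta/(2\gamma_{s,d})}$, $R_D=1/\lambda$. For $C>0$, $v_C\in C^{1,\alpha'}(\mathbb{R}^d)$ ($\alpha'\in(0,s)$) is the unique solution of $v_C\ge0$ and $(-\Delta)^sv_C\ge C-\frac\beta2|y|^2$ a.e. in $\mathbb{R}^d$; $v_C=0$ in $\mathbb{R}^d\setminus B_{R_C}(0)$; $v_C>0$ and $(-\Delta)^sv_C=C-\frac\beta2|y|^2$ a.e. in $B_{R_C}(0)$, with $R_C=C^{1/2}R_D$. Explicitly, $$v_C(y)=\frac{1}{\lambda^{2s}\kappa_{s,d}}\left(C-\lambda^2|y|^2\right)_+^{1+s}.$$ $M_1:=\int_{\mathbb{R}^d}v_1(y)\,dy$ is the mass of the solution with $C=1$. Weak solution: given a nonnegative $u_0\in L^1_{loc}(\mathbb{R}^d)$, a function $u$ is a weak solution with initial datum $u_0$ if (i) $u\ge0$ a.e. in $\mathbb{R}^d\times(0,+\infty)$; (ii) $u\in L^\infty(0,+\infty;H^s(\mathbb{R}^d))\cap L^2(0,+\infty;H^{1+s}(\mathbb{R}^d))$; (iii) $p:=(-\Delta)^su\in L^2(0,+\infty;H^{1-s}(\mathbb{R}^d))$; (iv) for every $\varphi\in C_c^\infty(\mathbb{R}^d\times[0,+\infty))$,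 with $Q=\mathbb{R}^d\times(0,+\infty)$, $$-\iint_Q u\,\partial_t\varphi\,dx\,dt-\iint_Q p\,u\,\Delta\varphi\,dx\,dt-\iint_Q p\,\nabla u\cdot\nabla\varphi\,dx\,dt=\int_{\mathbb{R}^d}u_0\,\varphi(x,0)\,dx .$$
   Formalization: In (ii) and (iii), L²(0,+∞;H^{1+s}) and L²(0,+∞;H^{1-s}) are replaced by L²(0,T;·) for every T>0, because ‖u_C(t)‖²_{L²}=c(1+t)^{-α} with α<1 (and likewise for p) is not integrable on (0,+∞). *)

theory Defs
  imports "HOL-Analysis.Analysis"
begin

section \<open>Test functions\<close>

primrec iter_dir_deriv :: "'a::euclidean_space list \<Rightarrow> ('a \<Rightarrow> real) \<Rightarrow> 'a \<Rightarrow> real" where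
  "iter_dir_deriv [] f = f"
| "iter_dir_deriv (h # hs) f = (\<lambda>x. frechet_derivative (iter_dir_deriv hs f) (at x) h)"

text \<open>All iterated directional derivatives exist and are Frechet differentiable, hence
  continuous; this is the class of infinitely differentiable functions.\<close>

definition smooth :: "('a::euclidean_space \<Rightarrow> real) \<Rightarrow> bool" where
  "smooth f \<longleftrightarrow> (\<forall>hs x. iter_dir_deriv hs f differentiable (at x))"

definition test_function :: "('a::euclidean_space \<Rightarrow> real) \<Rightarrow> bool" where
  "test_function f \<longleftrightarrow> smooth f \<and> compact (closure {x. f x \<noteq> 0})"


section \<open>Fourier transform, fractional Laplacian and Sobolev spaces\<close>

definition square_integrable :: "('a::euclidean_space \<Rightarrow> complex) \<Rightarrow> bool" where
  "square_integrable f \<longleftrightarrow>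
     f \<in> borel_measurable lebesgue \<and> integrable lebesgue (\<lambda>x. (cmod (f x))\<^sup>2)"

definition fourier_L1 :: "('a::euclidean_space \<Rightarrow> complex) \<Rightarrow> 'a \<Rightarrow> complex" where
  "fourier_L1 f \<xi> = (LINT x|lebesgue. cis (- (x \<bullet> \<xi>)) * f x)"

text \<open>Fourier transform on square integrable functions (Plancherel): \<open>F\<close> is the limit in the
  mean of the transforms of the truncations of \<open>f\<close> to balls.  It is a relation because \<open>F\<close>
  is determined only up to null sets.\<close>

definition is_fourier_L2 ::
    "('a::euclidean_space \<Rightarrow> complex) \<Rightarrow> ('a \<Rightarrow> complex) \<Rightarrow> bool" where
  "is_fourier_L2 f F \<longleftrightarrow> square_integrable f \<and> square_integrable F \<and>
     ((\<lambda>R::real. \<integral>\<^sup>+ \<xi>. ennreal ((cmod (F \<xi> -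
          fourier_L1 (\<lambda>x. indicator (cball 0 R) x * f x) \<xi>))\<^sup>2) \<partial>lebesgue)
        \<longlongrightarrow> 0) at_top"

text \<open>\<open>g\<close> is the fractional Laplacian of order \<open>s\<close> of \<open>f\<close>, both being square integrable.\<close>

definition is_frac_laplacian ::
    "real \<Rightarrow> ('a::euclidean_space \<Rightarrow> real) \<Rightarrow> ('a \<Rightarrow> real) \<Rightarrow> bool" where
  "is_frac_laplacian s f g \<longleftrightarrow>
     (\<exists>F. is_fourier_L2 (\<lambda>x. complex_of_real (f x)) F \<and>
          is_fourier_L2 (\<lambda>x. complex_of_real (g x))
            (\<lambda>\<xi>. complex_of_real (norm \<xi> powr (2 * s)) * F \<xi>))"

text \<open>The spaces \<open>H\<^sup>r\<close> are only needed for \<open>r \<ge> 0\<close>, where they consist of square integrable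
  functions.\<close>

definition in_sobolev :: "real \<Rightarrow> ('a::euclidean_space \<Rightarrow> real) \<Rightarrow> bool" where
  "in_sobolev r f \<longleftrightarrow>
     (\<exists>F. is_fourier_L2 (\<lambda>x. complex_of_real (f x)) F \<and>
          integrable lebesgue (\<lambda>\<xi>. (1 + (norm \<xi>)\<^sup>2) powr r * (cmod (F \<xi>))\<^sup>2))"

text \<open>The value does not depend on the chosen representative of the Fourier transform.\<close>

definition sobolev_norm :: "real \<Rightarrow> ('a::euclidean_space \<Rightarrow> real) \<Rightarrow> real" where
  "sobolev_norm r f =
     (let F = (SOME F. is_fourier_L2 (\<lambda>x. complex_of_real (f x)) F)
      in sqrt (LINT \<xi>|lebesgue. (1 + (norm \<xi>)\<^sup>2) powr r * (cmod (F \<xi>))\<^sup>2))"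

definition locally_integrable :: "('a::euclidean_space \<Rightarrow> 'b::euclidean_space) \<Rightarrow> bool" where
  "locally_integrable f \<longleftrightarrow> (\<forall>K. compact K \<longrightarrow> set_integrable lebesgue K f)"

definition is_weak_gradient ::
    "('a::euclidean_space \<Rightarrow> real) \<Rightarrow> ('a \<Rightarrow> 'a) \<Rightarrow> bool" where
  "is_weak_gradient f G \<longleftrightarrow> locally_integrable f \<and> locally_integrable G \<and>
     (\<forall>\<psi>. test_function \<psi> \<longrightarrow> (\<forall>b\<in>Basis.
        (LINT x|lebesgue. f x * frechet_derivative \<psi> (at x) b)
          = - (LINT x|lebesgue. (G x \<bullet> b) * \<psi> x)))"


section \<open>Function spaces on space-time\<close>

definition space_time :: "('a::euclidean_space \<times> real) set" where
  "space_time = UNIV \<times> {0<..}"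

definition measurable_space_time ::
    "('a::euclidean_space \<Rightarrow> real \<Rightarrow> 'b::euclidean_space) \<Rightarrow> bool" where
  "measurable_space_time u \<longleftrightarrow>
     (\<lambda>z. u (fst z) (snd z)) \<in> borel_measurable (lebesgue_on space_time)"

text \<open>Bochner spaces of functions of time with values in \<open>H\<^sup>r\<close>, for functions given pointwise on
  space-time.  As \<open>H\<^sup>r\<close> is a separable Hilbert space contained in the space of square integrable
  functions, joint measurability amounts to strong measurability in time.\<close>

definition Linf_sobolev :: "real \<Rightarrow> ('a::euclidean_space \<Rightarrow> real \<Rightarrow> real) \<Rightarrow> bool" where
  "Linf_sobolev r u \<longleftrightarrow> measurable_space_time u \<and>
     (\<exists>K. AE t in lebesgue_on {0<..}.
        in_sobolev r (\<lambda>x. u x t) \<and> sobolev_norm r (\<lambda>x. u x t) \<le> K)"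

text \<open>Square integrability in time on every bounded interval \<open>(0,T)\<close>.  For the self-similar
  solutions considered here, the \<open>L\<^sup>2\<close> norm in space decays like \<open>(1+t) powr (-\<alpha>/2)\<close> with
  \<open>\<alpha> < 1\<close>, which is not square integrable on \<open>(0,\<infinity>)\<close>.\<close>

definition L2loc_sobolev :: "real \<Rightarrow> ('a::euclidean_space \<Rightarrow> real \<Rightarrow> real) \<Rightarrow> bool" where
  "L2loc_sobolev r u \<longleftrightarrow> measurable_space_time u \<and>
     (AE t in lebesgue_on {0<..}. in_sobolev r (\<lambda>x. u x t)) \<and>
     (\<forall>T>0. set_integrable lebesgue {0<..<T} (\<lambda>t. (sobolev_norm r (\<lambda>x. u x t))\<^sup>2))"


section \<open>Weak solutions\<close>

definition time_deriv :: "('a::euclidean_space \<times> real \<Rightarrow> real) \<Rightarrow> 'a \<times> real \<Rightarrow> real" where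
  "time_deriv \<phi> z = frechet_derivative \<phi> (at z) (0, 1)"

definition space_grad :: "('a::euclidean_space \<times> real \<Rightarrow> real) \<Rightarrow> 'a \<times> real \<Rightarrow> 'a" where
  "space_grad \<phi> z = (\<Sum>b\<in>Basis. frechet_derivative \<phi> (at z) (b, 0) *\<^sub>R b)"

definition space_laplacian :: "('a::euclidean_space \<times> real \<Rightarrow> real) \<Rightarrow> 'a \<times> real \<Rightarrow> real" where
  "space_laplacian \<phi> z = (\<Sum>b\<in>Basis. iter_dir_deriv [(b, 0), (b, 0)] \<phi> z)"

text \<open>Smooth compactly supported functions on \<open>\<real>\<^sup>d \<times> [0,\<infinity>)\<close> are the restrictions of test functions
  on \<open>\<real>\<^sup>d \<times> \<real>\<close>.  The pressure \<open>p\<close> and the spatial gradient \<open>G\<close> are determined almost everywhere by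
  \<open>u\<close>, and the regularity conditions make all integrands below integrable.\<close>

definition is_weak_solution ::
    "real \<Rightarrow> ('a::euclidean_space \<Rightarrow> real) \<Rightarrow> ('a \<Rightarrow> real \<Rightarrow> real) \<Rightarrow> bool" where
  "is_weak_solution s u\<^sub>0 u \<longleftrightarrow>
     (AE x in lebesgue. 0 \<le> u\<^sub>0 x) \<and> locally_integrable u\<^sub>0 \<and>
     (AE z in lebesgue_on space_time. 0 \<le> u (fst z) (snd z)) \<and>
     Linf_sobolev s u \<and> L2loc_sobolev (1 + s) u \<and>
     (\<exists>p G.
        (AE t in lebesgue_on {0<..}. is_frac_laplacian s (\<lambda>x. u x t) (\<lambda>x. p x t)) \<and>
        L2loc_sobolev (1 - s) p \<and>
        measurable_space_time G \<and>
        (AE t in lebesgue_on {0<..}. is_weak_gradient (\<lambda>x. u x t) (\<lambda>x. G x t)) \<and>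
        (\<forall>\<phi>. test_function \<phi> \<longrightarrow>
           - (LINT (x, t)|lebesgue_on space_time. u x t * time_deriv \<phi> (x, t))
           - (LINT (x, t)|lebesgue_on space_time. p x t * u x t * space_laplacian \<phi> (x, t))
           - (LINT (x, t)|lebesgue_on space_time. p x t * (G x t \<bullet> space_grad \<phi> (x, t)))
           = (LINT x|lebesgue. u\<^sub>0 x * \<phi> (x, 0))))"


section \<open>The obstacle problem\<close>

definition C1_holder :: "real \<Rightarrow> ('a::euclidean_space \<Rightarrow> real) \<Rightarrow> bool" where
  "C1_holder a v \<longleftrightarrow>
     (\<exists>g. (\<forall>x. (v has_derivative (\<lambda>h. g x \<bullet> h)) (at x)) \<and>
          bounded (range v) \<and> bounded (range g) \<and>
          (\<exists>K. \<forall>x y. norm (g x - g y) \<le> K * dist x y powr a))"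

definition gamma_sd :: "real \<Rightarrow> 'a::euclidean_space itself \<Rightarrow> real" where
  "gamma_sd s _ = 1 + 2 * s / DIM('a)"

definition obstacle_radius :: "real \<Rightarrow> real \<Rightarrow> real \<Rightarrow> 'a::euclidean_space itself \<Rightarrow> real" where
  "obstacle_radius s \<beta> C d =
     (let lam = sqrt (\<beta> / (2 * gamma_sd s d)); R\<^sub>D = 1 / lam in C powr (1/2) * R\<^sub>D)"

text \<open>The condition that the fractional Laplacian of \<open>v\<close> is a square integrable function \<open>p\<close> is
  no additional restriction: a compactly supported function of class \<open>C\<^sup>1\<^sup>,\<^sup>a\<close> for all \<open>a < s\<close>
  lies in \<open>H\<^sup>2\<^sup>s\<close>.  The problem is solved by \<open>v y = c * (max 0 (C - lam\<^sup>2 * (norm y)\<^sup>2)) powr (1 + s)\<close> with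
  \<open>1 / c = lam powr (2*s) * 2 powr (2*s) * Gamma (s+2) * Gamma (s+d/2) / Gamma (d/2)\<close>.\<close>

definition is_obstacle_solution ::
    "real \<Rightarrow> real \<Rightarrow> real \<Rightarrow> ('a::euclidean_space \<Rightarrow> real) \<Rightarrow> bool" where
  "is_obstacle_solution s \<beta> C v \<longleftrightarrow>
     (\<forall>a\<in>{0<..<s}. C1_holder a v) \<and>
     (\<exists>p. is_frac_laplacian s v p \<and>
        (AE y in lebesgue. 0 \<le> v y \<and> p y \<ge> C - \<beta> / 2 * (norm y)\<^sup>2) \<and>
        (\<forall>y. y \<notin> ball 0 (obstacle_radius s \<beta> C TYPE('a)) \<longrightarrow> v y = 0) \<and>
        (AE y in lebesgue. y \<in> ball 0 (obstacle_radius s \<beta> C TYPE('a)) \<longrightarrow>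
            0 < v y \<and> p y = C - \<beta> / 2 * (norm y)\<^sup>2))"

definition self_similar ::
    "real \<Rightarrow> real \<Rightarrow> ('a::euclidean_space \<Rightarrow> real) \<Rightarrow> 'a \<Rightarrow> real \<Rightarrow> real" where
  "self_similar \<alpha> \<beta> v x t = 1 / (1 + t) powr \<alpha> * v (x /\<^sub>R (1 + t) powr \<beta>)"

end

theory Submission
  imports Defs "HOL-Probability.Characteristic_Functions"
begin

text \<open>Neither the explicit formula for the obstacle solution \<open>v\<close> nor any regularity theory is
  needed.  With \<open>p = (-\<Delta>)\<^sup>s v\<close> and the parabola \<open>\<phi> = C - \<beta>/2 |y|\<^sup>2\<close>, complementarity
  (\<open>p \<ge> \<phi>\<close>, \<open>v \<ge> 0\<close>, and \<open>p = \<phi>\<close> where \<open>v > 0\<close>) gives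
  \<open>p (2 v - v(\<cdot> + h) - v(\<cdot> - h)) \<le> \<phi> (2 v - v(\<cdot> + h) - v(\<cdot> - h))\<close>; integrating, using Parseval
  on the left and the constant second differences of \<open>\<phi>\<close> on the right, bounds
  \<open>\<integral> |\<xi>|\<^sup>2\<^sup>s (2 - 2 cos (h \<bullet> \<xi>)) |V(\<xi>)|\<^sup>2\<close>, \<open>V\<close> being the Fourier transform of \<open>v\<close>, by a multiple
  of \<open>|h|\<^sup>2\<close>, and Fatou's lemma yields \<open>v \<in> H\<^sup>1\<^sup>+\<^sup>s\<close>.
  In the weak formulation \<open>p\<close> may be replaced by a paraboloid \<open>P\<close> in \<open>x\<close> with
  \<open>\<nabla>P = - \<beta> x / (1 + t)\<close>; after an integration by parts and the substitution
  \<open>x = (1 + t)\<^sup>\<beta> y\<close> the integrand is \<open>v(y)\<close> times the time derivative of the test function along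
  the curve \<open>t \<mapsto> ((1 + t)\<^sup>\<beta> y, t)\<close>.
  The mass is computed by uniqueness of the obstacle solution: \<open>v\<^sub>C\<close> is a rescaling of \<open>v\<^sub>1\<close>.\<close>

text \<open>Parseval is only ever applied with one factor continuous, compactly supported and with a
  square integrable transform: a symmetric second difference of \<open>v\<close>, or the difference
  of two solutions. For such a factor the multiplication formula with a Gaussian regularisation
  suffices. The symmetric second difference has a known sign where \<open>v\<close> vanishes, and
  the linear terms of the paraboloid cancel in it, which gives the order \<open>|h|^2\<close>. The
  energy \<open>|\<xi>|^(2+2s) |V|^2\<close> then serves \<open>u\<close> and \<open>p\<close>
  alike, since \<open>p\<close> has transform \<open>|\<xi>|^(2s) V\<close> and
  \<open>(1-s) + 2s = 1+s\<close>. The exponents are fixed by two relations: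
  \<open>\<alpha> = d \<beta>\<close> conserves mass under the dilation, and
  \<open>\<alpha> + 2s\<beta> + 2\<beta> = 1\<close> makes \<open>-\<nabla>P\<close> the velocity
  \<open>\<beta> x / (1 + t)\<close> of the curves \<open>t \<mapsto> (1 + t)^\<beta> y\<close>, so
  the equation acts on \<open>u\<close> as transport along explicit curves. The exponent of the mass
  law is \<open>1 + s\<close> from the amplitude of the rescaled obstacle solution plus
  \<open>d/2\<close> from its dilation.\<close>

lemma borel_measurable_cis [measurable (raw)]:
  "f \<in> borel_measurable M \<Longrightarrow> (\<lambda>x. cis (f x)) \<in> borel_measurable M"
  by (rule borel_measurable_continuous_on[where f = cis]) (auto intro: continuous_intros)

section \<open>Affine changes of variables\<close>

text \<open>The change of variables theorem scales each coordinate by its own factor; here all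
  factors equal \<open>c\<close>. The second part is measurability between completed sigma-algebras,
  which is what composing a merely Lebesgue measurable function with the map requires.\<close>

lemma lebesgue_affine:
  fixes t :: "'a::euclidean_space"
  assumes "c \<noteq> 0"
  shows "lebesgue = density (distr lebesgue lebesgue (\<lambda>x. t + c *\<^sub>R x)) (\<lambda>_. ennreal (\<bar>c\<bar> ^ DIM('a)))"
    and "(\<lambda>x. t + c *\<^sub>R x) \<in> lebesgue \<rightarrow>\<^sub>M lebesgue"
proof -
  have *: "(\<Sum>j\<in>Basis. (c * (x \<bullet> j)) *\<^sub>R j) = c *\<^sub>R x" for x :: 'a
    by (simp add: scaleR_sum_right[symmetric] scaleR_scaleR[symmetric] euclidean_representation
        del: scaleR_scaleR)
  show "lebesgue = density (distr lebesgue lebesgue (\<lambda>x. t + c *\<^sub>R x)) (\<lambda>_. ennreal (\<bar>c\<bar> ^ DIM('a)))"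
    using lebesgue_affine_euclidean[of "\<lambda>_. c" t] assms
    by (simp add: * ennreal_power)
  show "(\<lambda>x. t + c *\<^sub>R x) \<in> lebesgue \<rightarrow>\<^sub>M lebesgue"
    using lebesgue_affine_measurable[of "\<lambda>_. c" t] assms by (simp add: *)
qed

lemma measurable_compose_affine:
  fixes f :: "'a::euclidean_space \<Rightarrow> 'b::topological_space"
  assumes "c \<noteq> 0" "f \<in> borel_measurable lebesgue"
  shows "(\<lambda>x. f (t + c *\<^sub>R x)) \<in> borel_measurable lebesgue"
  using lebesgue_affine(2)[OF assms(1)] assms(2) by (rule measurable_compose)

lemma AE_lebesgue_affine:
  fixes t :: "'a::euclidean_space"
  assumes "c \<noteq> 0" "AE x in lebesgue. P x"
  shows "AE x in lebesgue. P (t + c *\<^sub>R x)"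
proof -
  have "AE x in density (distr lebesgue lebesgue (\<lambda>x. t + c *\<^sub>R x)) (\<lambda>_. ennreal (\<bar>c\<bar> ^ DIM('a))). P x"
    using assms(2) by (simp only: lebesgue_affine(1)[OF assms(1), of t, symmetric])
  then have "AE x in distr lebesgue lebesgue (\<lambda>x. t + c *\<^sub>R x). P x"
    using assms(1) by (subst (asm) AE_density) auto
  then show ?thesis
    by (rule AE_distrD[OF lebesgue_affine(2)[OF assms(1)]])
qed

lemma integral_lebesgue_affine:
  fixes f :: "'a::euclidean_space \<Rightarrow> 'b::{banach, second_countable_topology}"
  assumes "c \<noteq> 0" "f \<in> borel_measurable lebesgue"
  shows "(LINT x|lebesgue. f (t + c *\<^sub>R x)) = (1 / \<bar>c\<bar> ^ DIM('a)) *\<^sub>R (LINT x|lebesgue. f x)"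
proof -
  have "(LINT x|lebesgue. f x) =
      (LINT x|density (distr lebesgue lebesgue (\<lambda>x. t + c *\<^sub>R x)) (\<lambda>_. ennreal (\<bar>c\<bar> ^ DIM('a))). f x)"
    by (simp only: lebesgue_affine(1)[OF assms(1), of t, symmetric])
  also have "\<dots> = (LINT x|distr lebesgue lebesgue (\<lambda>x. t + c *\<^sub>R x). \<bar>c\<bar> ^ DIM('a) *\<^sub>R f x)"
    using assms by (subst integral_density) auto
  also have "\<dots> = (LINT x|lebesgue. \<bar>c\<bar> ^ DIM('a) *\<^sub>R f (t + c *\<^sub>R x))"
    using assms lebesgue_affine(2)[OF assms(1)] by (subst integral_distr) auto
  finally show ?thesis using assms(1) by simp
qed

lemma integrable_lebesgue_affine:
  fixes f :: "'a::euclidean_space \<Rightarrow> 'b::{banach, second_countable_topology}"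
  assumes "c \<noteq> 0" "integrable lebesgue f"
  shows "integrable lebesgue (\<lambda>x. f (t + c *\<^sub>R x))"
proof -
  note [measurable] = borel_measurable_integrable[OF assms(2)]
  have "integrable (density (distr lebesgue lebesgue (\<lambda>x. t + c *\<^sub>R x)) (\<lambda>_. ennreal (\<bar>c\<bar> ^ DIM('a)))) f"
    using assms(2) by (simp only: lebesgue_affine(1)[OF assms(1), of t, symmetric])
  then have "integrable (distr lebesgue lebesgue (\<lambda>x. t + c *\<^sub>R x)) (\<lambda>x. \<bar>c\<bar> ^ DIM('a) *\<^sub>R f x)"
    by (subst (asm) integrable_density) auto
  then have "integrable lebesgue (\<lambda>x. \<bar>c\<bar> ^ DIM('a) *\<^sub>R f (t + c *\<^sub>R x))"
    using lebesgue_affine(2)[OF assms(1), of t] by (subst (asm) integrable_distr_eq) auto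
  from integrable_scaleR_right[OF this, of "1 / \<bar>c\<bar> ^ DIM('a)"] show ?thesis
    using assms(1) by simp
qed

lemma nn_integral_lebesgue_affine:
  fixes f :: "'a::euclidean_space \<Rightarrow> ennreal"
  assumes "c \<noteq> 0" "f \<in> borel_measurable lebesgue"
  shows "(\<integral>\<^sup>+ x. f x \<partial>lebesgue) = ennreal (\<bar>c\<bar> ^ DIM('a)) * (\<integral>\<^sup>+ x. f (t + c *\<^sub>R x) \<partial>lebesgue)"
proof -
  have "(\<integral>\<^sup>+ x. f x \<partial>lebesgue) =
      (\<integral>\<^sup>+ x. f x \<partial>density (distr lebesgue lebesgue (\<lambda>x. t + c *\<^sub>R x)) (\<lambda>_. ennreal (\<bar>c\<bar> ^ DIM('a))))"
    by (simp only: lebesgue_affine(1)[OF assms(1), of t, symmetric])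
  also have "\<dots> = (\<integral>\<^sup>+ x. ennreal (\<bar>c\<bar> ^ DIM('a)) * f x \<partial>distr lebesgue lebesgue (\<lambda>x. t + c *\<^sub>R x))"
    using assms by (subst nn_integral_density) auto
  also have "\<dots> = (\<integral>\<^sup>+ x. ennreal (\<bar>c\<bar> ^ DIM('a)) * f (t + c *\<^sub>R x) \<partial>lebesgue)"
    using assms lebesgue_affine(2)[OF assms(1)] by (subst nn_integral_distr) auto
  also have "\<dots> = ennreal (\<bar>c\<bar> ^ DIM('a)) * (\<integral>\<^sup>+ x. f (t + c *\<^sub>R x) \<partial>lebesgue)"
    using measurable_compose_affine[OF assms] by (subst nn_integral_cmult) auto
  finally show ?thesis .
qed

section \<open>The Fourier transform of the Gaussian\<close>

text \<open>Up to the factor \<open>sqrt (2 * pi)\<close> the integral is the characteristic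
  function of the standard normal distribution.\<close>

lemma gaussian_1d:
  "integrable lborel (\<lambda>x::real. cis (- (x * \<xi>)) * complex_of_real (exp (- x\<^sup>2 / 2)))"
  "(LINT x::real|lborel. cis (- (x * \<xi>)) * complex_of_real (exp (- x\<^sup>2 / 2))) =
     complex_of_real (sqrt (2 * pi) * exp (- \<xi>\<^sup>2 / 2))"
proof -
  have "integrable lborel (\<lambda>x::real. sqrt (2 * pi) * std_normal_density x)"
    by (intro integrable_mult_right integrable_normal_density) auto
  then have *: "integrable lborel (\<lambda>x::real. exp (- x\<^sup>2 / 2))"
    by (simp add: std_normal_density_def)
  show "integrable lborel (\<lambda>x::real. cis (- (x * \<xi>)) * complex_of_real (exp (- x\<^sup>2 / 2)))"
    by (rule Bochner_Integration.integrable_bound[OF *]) (auto simp: norm_mult)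
  \<comment> \<open>\<open>char\<close> uses the kernel \<open>exp (i t x)\<close>, the transform
    uses \<open>exp (- i x \<xi>)\<close>; hence the argument \<open>- \<xi>\<close>.\<close>
  have "complex_of_real (exp (- \<xi>\<^sup>2 / 2)) = char std_normal_distribution (- \<xi>)"
    by (simp add: char_std_normal_distribution)
  also have "\<dots> = (LINT x|lborel. std_normal_density x *\<^sub>R iexp (- \<xi> * x))"
    unfolding char_def by (subst integral_density) auto
  also have "\<dots> = (LINT x|lborel. (1 / sqrt (2 * pi)) *\<^sub>R
      (cis (- (x * \<xi>)) * complex_of_real (exp (- x\<^sup>2 / 2))))"
    by (intro Bochner_Integration.integral_cong refl)
      (simp add: std_normal_density_def cis_conv_exp scaleR_conv_of_real mult.commute)
  also have "\<dots> = (1 / sqrt (2 * pi)) *\<^sub>R (LINT x|lborel.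
      (cis (- (x * \<xi>)) * complex_of_real (exp (- x\<^sup>2 / 2))))"
    by simp
  finally show "(LINT x::real|lborel. cis (- (x * \<xi>)) * complex_of_real (exp (- x\<^sup>2 / 2))) =
     complex_of_real (sqrt (2 * pi) * exp (- \<xi>\<^sup>2 / 2))"
    by (simp add: scaleR_conv_of_real field_simps)
qed

lemma cis_sum: "finite A \<Longrightarrow> cis (\<Sum>a\<in>A. f a) = (\<Prod>a\<in>A. cis (f a))"
  by (induction rule: finite_induct) (auto simp: cis_mult[symmetric])

text \<open>Both the phase and the Gaussian factorise over \<open>Basis\<close>, so the integral is
  a product of one-dimensional ones.\<close>

lemma gaussian_fourier:
  fixes \<xi> :: "'a::euclidean_space"
  shows "integrable lborel (\<lambda>x::'a. cis (- (x \<bullet> \<xi>)) * complex_of_real (exp (- (norm x)\<^sup>2 / 2)))"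
    and "(LINT x|lborel. cis (- (x \<bullet> \<xi>)) * complex_of_real (exp (- (norm x)\<^sup>2 / 2))) =
      complex_of_real (sqrt (2 * pi) ^ DIM('a) * exp (- (norm \<xi>)\<^sup>2 / 2))"
proof -
  let ?g = "\<lambda>b x. cis (- (x * (\<xi> \<bullet> b))) * complex_of_real (exp (- x\<^sup>2 / 2))"
  let ?P = "\<Pi>\<^sub>M b\<in>(Basis::'a set). (lborel::real measure)"
  let ?T = "\<lambda>f. \<Sum>b\<in>Basis. f b *\<^sub>R b :: 'a"
  interpret product_sigma_finite "\<lambda>_::'a. lborel::real measure" by standard
  have norm_eq: "(norm x)\<^sup>2 = (\<Sum>b\<in>Basis. (x \<bullet> b)\<^sup>2)" for x :: 'a
    by (metis (no_types, lifting) euclidean_inner power2_eq_square power2_norm_eq_inner sum.cong)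
  have fact: "cis (- (?T f \<bullet> \<xi>)) * complex_of_real (exp (- (norm (?T f))\<^sup>2 / 2)) =
      (\<Prod>b\<in>Basis. ?g b (f b))" for f
  proof -
    have 1: "?T f \<bullet> \<xi> = (\<Sum>b\<in>Basis. f b * (\<xi> \<bullet> b))"
      by (simp add: inner_sum_left inner_commute[of \<xi>])
    have 2: "(norm (?T f))\<^sup>2 = (\<Sum>b\<in>Basis. (f b)\<^sup>2)"
      by (simp add: norm_eq)
    show ?thesis
      by (simp add: 1 2 sum_negf[symmetric] cis_sum sum_divide_distrib exp_sum prod.distrib)
  qed
  have meas: "?T \<in> ?P \<rightarrow>\<^sub>M borel" by measurable
  have int: "integrable ?P (\<lambda>f. \<Prod>b\<in>Basis. ?g b (f b))"
    by (rule product_integrable_prod[OF finite_Basis gaussian_1d(1)])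
  show "integrable lborel (\<lambda>x::'a. cis (- (x \<bullet> \<xi>)) * complex_of_real (exp (- (norm x)\<^sup>2 / 2)))"
    by (subst lborel_eq, subst integrable_distr_eq[OF meas]) (measurable, simp only: fact int)
  have "(LINT x|lborel. cis (- (x \<bullet> \<xi>)) * complex_of_real (exp (- (norm x)\<^sup>2 / 2))) =
      (LINT f|?P. (\<Prod>b\<in>Basis. ?g b (f b)))"
    by (subst lborel_eq, subst integral_distr[OF meas]) (measurable, simp only: fact)
  also have "\<dots> = (\<Prod>b\<in>Basis. complex_of_real (sqrt (2 * pi) * exp (- (\<xi> \<bullet> b)\<^sup>2 / 2)))"
    by (subst product_integral_prod[OF finite_Basis gaussian_1d(1)]) (simp only: gaussian_1d(2))
  also have "\<dots> = complex_of_real (sqrt (2 * pi) ^ DIM('a) * exp (- (norm \<xi>)\<^sup>2 / 2))"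
    by (simp add: prod.distrib norm_eq sum_negf[symmetric] sum_divide_distrib exp_sum)
  finally show "(LINT x|lborel. cis (- (x \<bullet> \<xi>)) * complex_of_real (exp (- (norm x)\<^sup>2 / 2))) =
      complex_of_real (sqrt (2 * pi) ^ DIM('a) * exp (- (norm \<xi>)\<^sup>2 / 2))" .
qed

section \<open>Parseval's formula\<close>

lemma borel_measurable_cnj [measurable (raw)]:
  "f \<in> borel_measurable M \<Longrightarrow> (\<lambda>x. cnj (f x)) \<in> borel_measurable M"
  by (rule borel_measurable_continuous_on[where f = cnj]) (auto intro: continuous_intros)

lemma measurable_borel_lebesgue:
  "f \<in> borel_measurable borel \<Longrightarrow> f \<in> borel_measurable lebesgue"
  by (rule measurable_completion) simp

lemma fourier_L1_lborel:
  "f \<in> borel_measurable borel \<Longrightarrow> fourier_L1 f \<xi> = (LINT x|lborel. cis (- (x \<bullet> \<xi>)) * f x)"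
  unfolding fourier_L1_def by (rule integral_completion) measurable

lemma integrable_cis_mult:
  fixes f :: "'a::euclidean_space \<Rightarrow> complex"
  assumes "integrable lborel f"
  shows "integrable lborel (\<lambda>x. cis (- (x \<bullet> \<xi>)) * f x)"
proof (rule Bochner_Integration.integrable_bound[OF assms])
  show "(\<lambda>x. cis (- (x \<bullet> \<xi>)) * f x) \<in> borel_measurable lborel"
    using borel_measurable_integrable[OF assms] by measurable
qed (auto simp: norm_mult)

text \<open>Dominated convergence with dominating function \<open>norm (f x)\<close>. The purpose is
  Borel measurability of the transform.\<close>

lemma continuous_fourier_L1:
  fixes f :: "'a::euclidean_space \<Rightarrow> complex"
  assumes f: "integrable lborel f"
  shows "continuous_on UNIV (fourier_L1 f)"
proof -
  have fm: "f \<in> borel_measurable borel" using borel_measurable_integrable[OF f] by simp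
  note [measurable] = fm
  show ?thesis
    unfolding continuous_on_sequentially o_def fourier_L1_lborel[OF fm]
  proof safe
    fix X :: "nat \<Rightarrow> 'a" and a assume X: "X \<longlonglongrightarrow> a"
    show "(\<lambda>n. LINT x|lborel. cis (- (x \<bullet> X n)) * f x) \<longlonglongrightarrow> (LINT x|lborel. cis (- (x \<bullet> a)) * f x)"
    proof (rule integral_dominated_convergence[where w="\<lambda>x. norm (f x)"])
      show "AE x in lborel. (\<lambda>n. cis (- (x \<bullet> X n)) * f x) \<longlonglongrightarrow> cis (- (x \<bullet> a)) * f x"
      proof (rule AE_I2)
        fix x
        have "isCont cis (- (x \<bullet> a))"
          using continuous_on_cis[OF continuous_on_id, of UNIV]
          by (simp add: continuous_on_eq_continuous_at)
        moreover have "(\<lambda>n. - (x \<bullet> X n)) \<longlonglongrightarrow> - (x \<bullet> a)"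
          by (intro tendsto_intros X)
        ultimately show "(\<lambda>n. cis (- (x \<bullet> X n)) * f x) \<longlonglongrightarrow> cis (- (x \<bullet> a)) * f x"
          by (intro tendsto_mult tendsto_const isCont_tendsto_compose[where g=cis])
      qed
      show "integrable lborel (\<lambda>x. norm (f x))" using f by simp
      show "AE x in lborel. norm (cis (- (x \<bullet> X n)) * f x) \<le> norm (f x)" for n
        by (simp add: norm_mult)
    qed measurable
  qed
qed

lemma fourier_L1_measurable:
  fixes f :: "'a::euclidean_space \<Rightarrow> complex"
  shows "integrable lborel f \<Longrightarrow> fourier_L1 f \<in> borel_measurable borel"
  by (intro borel_measurable_continuous_onI continuous_fourier_L1)

lemma fourier_L1_bound:
  fixes f :: "'a::euclidean_space \<Rightarrow> complex"
  assumes f: "integrable lborel f"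
  shows "norm (fourier_L1 f \<xi>) \<le> (LINT x|lborel. norm (f x))"
proof -
  have fm: "f \<in> borel_measurable borel" using borel_measurable_integrable[OF f] by simp
  have "norm (LINT x|lborel. cis (- (x \<bullet> \<xi>)) * f x) \<le> (LINT x|lborel. norm (cis (- (x \<bullet> \<xi>)) * f x))"
    by (rule integral_norm_bound)
  then show ?thesis by (simp add: fourier_L1_lborel[OF fm] norm_mult)
qed

text \<open>The kernel \<open>cis (- (x \<bullet> \<xi>))\<close> is symmetric in its two arguments,
  so Fubini moves the transform from one factor to the other.\<close>

lemma fourier_multiplication_formula:
  fixes f g :: "'a::euclidean_space \<Rightarrow> complex"
  assumes f: "integrable lborel f" and g: "integrable lborel g"
  shows "(LINT \<xi>|lborel. fourier_L1 f \<xi> * g \<xi>) = (LINT x|lborel. f x * fourier_L1 g x)"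
proof -
  have fm: "f \<in> borel_measurable borel" using borel_measurable_integrable[OF f] by simp
  have gm: "g \<in> borel_measurable borel" using borel_measurable_integrable[OF g] by simp
  note [measurable] = fm gm
  have int: "integrable (lborel \<Otimes>\<^sub>M lborel) (case_prod (\<lambda>x \<xi>. cis (- (x \<bullet> \<xi>)) * f x * g \<xi>))"
  proof (rule lborel_pair.Fubini_integrable)
    show "case_prod (\<lambda>x \<xi>. cis (- (x \<bullet> \<xi>)) * f x * g \<xi>) \<in> borel_measurable (lborel \<Otimes>\<^sub>M lborel)"
      by measurable
    show "integrable lborel (\<lambda>x. LINT y|lborel. norm (case (x, y) of (x, \<xi>) \<Rightarrow> cis (- (x \<bullet> \<xi>)) * f x * g \<xi>))"
      using f by (simp add: norm_mult)
    have "integrable lborel (\<lambda>\<xi>. cis (- (x \<bullet> \<xi>)) * f x * g \<xi>)" for x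
      using integrable_mult_right[OF integrable_cis_mult[OF g, of x], of "f x"]
      by (simp add: mult_ac inner_commute)
    then show "AE x in lborel. integrable lborel (\<lambda>y. case (x, y) of (x, \<xi>) \<Rightarrow> cis (- (x \<bullet> \<xi>)) * f x * g \<xi>)"
      by simp
  qed
  have "(LINT \<xi>|lborel. fourier_L1 f \<xi> * g \<xi>) =
      (LINT \<xi>|lborel. LINT x|lborel. cis (- (x \<bullet> \<xi>)) * f x * g \<xi>)"
    by (simp add: fourier_L1_lborel[OF fm])
  also have "\<dots> = (LINT x|lborel. LINT \<xi>|lborel. cis (- (x \<bullet> \<xi>)) * f x * g \<xi>)"
    by (rule lborel_pair.Fubini_integral[OF int])
  also have "\<dots> = (LINT x|lborel. LINT \<xi>|lborel. f x * (cis (- (\<xi> \<bullet> x)) * g \<xi>))"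
    by (simp add: mult_ac inner_commute)
  also have "\<dots> = (LINT x|lborel. f x * fourier_L1 g x)"
    by (simp add: fourier_L1_lborel[OF gm])
  finally show ?thesis .
qed

lemma integrable_continuous_compact:
  fixes f :: "'a::euclidean_space \<Rightarrow> 'b::{banach, second_countable_topology}"
  assumes f: "continuous_on UNIV f" and supp: "\<And>x. norm x > R \<Longrightarrow> f x = 0"
  shows "integrable lborel f"
proof -
  have "integrable lborel (\<lambda>x. indicator (cball 0 R) x *\<^sub>R f x)"
    using borel_integrable_compact[of "cball 0 R" f] f continuous_on_subset[OF f] by (simp add: )
  also have "(\<lambda>x. indicator (cball 0 R) x *\<^sub>R f x) = f"
    using supp by (auto simp: indicator_def fun_eq_iff)
  finally show ?thesis .
qed

lemma bounded_continuous_compact: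
  fixes f :: "'a::euclidean_space \<Rightarrow> 'b::real_normed_vector"
  assumes f: "continuous_on UNIV f" and supp: "\<And>x. norm x > R \<Longrightarrow> f x = 0"
  obtains B where "B \<ge> 0" "\<And>x. norm (f x) \<le> B"
proof -
  have "compact (f ` cball 0 R)"
    by (intro compact_continuous_image continuous_on_subset[OF f]) auto
  then have "bounded (f ` cball 0 R)" by (rule compact_imp_bounded)
  then obtain B where B: "\<And>x. x \<in> cball 0 R \<Longrightarrow> norm (f x) \<le> B"
    unfolding bounded_iff by blast
  have "norm (f x) \<le> max 0 B" for x
    using B[of x] supp[of x] by (cases "norm x > R") (simp, intro max.coboundedI2, simp)
  then show ?thesis using that[of "max 0 B"] by auto
qed

lemma lborel_integral_affine:
  fixes f :: "'a::euclidean_space \<Rightarrow> 'b::{banach, second_countable_topology}"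
  assumes "c \<noteq> 0" "f \<in> borel_measurable borel"
  shows "(LINT x|lborel. f (t + c *\<^sub>R x)) = (1 / \<bar>c\<bar> ^ DIM('a)) *\<^sub>R (LINT x|lborel. f x)"
proof -
  note [measurable] = assms(2)
  show ?thesis
    using integral_lebesgue_affine[OF assms(1) measurable_borel_lebesgue[OF assms(2)], of t]
    by (simp add: integral_completion)
qed

lemma lborel_integrable_affine:
  fixes f :: "'a::euclidean_space \<Rightarrow> 'b::{banach, second_countable_topology}"
  assumes "c \<noteq> 0" "integrable lborel f"
  shows "integrable lborel (\<lambda>x. f (t + c *\<^sub>R x))"
proof -
  have [measurable]: "f \<in> borel_measurable borel" using borel_measurable_integrable[OF assms(2)] by simp
  show ?thesis
    using integrable_lebesgue_affine[of c f t] assms by (simp add: integrable_completion)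
qed

text \<open>Exhibits the conjugate of a transform as a transform again, so that the multiplication
  formula can be applied to it.\<close>

lemma fourier_L1_cnj_reflect:
  fixes w :: "'a::euclidean_space \<Rightarrow> complex"
  assumes [measurable]: "w \<in> borel_measurable borel"
  shows "fourier_L1 (\<lambda>y. cnj (w (- y))) \<xi> = cnj (fourier_L1 w \<xi>)"
proof -
  have "fourier_L1 (\<lambda>y. cnj (w (- y))) \<xi> = (LINT x|lborel. cis (- (x \<bullet> \<xi>)) * cnj (w (- x)))"
    by (subst fourier_L1_lborel) measurable
  also have "\<dots> = (LINT x|lborel. cnj (cis (- (x \<bullet> \<xi>)) * w x))"
    using lborel_integral_affine[of "-1" "\<lambda>x. cnj (cis (- (x \<bullet> \<xi>)) * w x)" 0] by (simp add: cis_cnj)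
  also have "\<dots> = cnj (fourier_L1 w \<xi>)"
    by (simp only: Bochner_Integration.integral_cnj fourier_L1_lborel[OF assms])
  finally show ?thesis .
qed

lemma gaussian_integrable_scaled:
  assumes "\<delta> > 0"
  shows "integrable lborel (\<lambda>x::'a::euclidean_space. complex_of_real (exp (- (norm (\<delta> *\<^sub>R x))\<^sup>2 / 2)))"
proof -
  have "integrable lborel (\<lambda>x::'a. complex_of_real (exp (- (norm x)\<^sup>2 / 2)))"
    using gaussian_fourier(1)[of "0::'a"] by simp
  from lborel_integrable_affine[OF _ this, of \<delta> 0] show ?thesis using assms by simp
qed

lemma fourier_gaussian_scaled:
  fixes \<xi> :: "'a::euclidean_space"
  assumes \<delta>: "\<delta> > 0"
  shows "fourier_L1 (\<lambda>x. complex_of_real (exp (- (norm (\<delta> *\<^sub>R x))\<^sup>2 / 2))) \<xi> =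
    complex_of_real (sqrt (2 * pi) ^ DIM('a) / \<delta> ^ DIM('a) * exp (- (norm (\<xi> /\<^sub>R \<delta>))\<^sup>2 / 2))"
proof -
  let ?h = "\<lambda>x::'a. cis (- (x \<bullet> (\<xi> /\<^sub>R \<delta>))) * complex_of_real (exp (- (norm x)\<^sup>2 / 2))"
  have "fourier_L1 (\<lambda>x. complex_of_real (exp (- (norm (\<delta> *\<^sub>R x))\<^sup>2 / 2))) \<xi> =
      (LINT x|lborel. ?h (0 + \<delta> *\<^sub>R x))"
    using \<delta> by (subst fourier_L1_lborel) (auto simp: mult.assoc[symmetric])
  also have "\<dots> = (1 / \<bar>\<delta>\<bar> ^ DIM('a)) *\<^sub>R (LINT x|lborel. ?h x)"
    by (rule lborel_integral_affine) (use \<delta> in auto)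
  finally show ?thesis
    using \<delta> by (simp only: gaussian_fourier(2)) (simp add: scaleR_conv_of_real)
qed

text \<open>The transform of \<open>w\<close> is bounded but perhaps not integrable; the Gaussian
  factor repairs this. Two uses of the multiplication formula turn the right-hand side into
  \<open>f\<close> paired with \<open>cnj w\<close> mollified at scale \<open>\<delta>\<close>. The
  factor \<open>sqrt (2 * pi) ^ d\<close> and the equal mass of the Gaussian together give the
  eventual constant \<open>(2 * pi) ^ d\<close>.\<close>

lemma fourier_gaussian_regularised:
  fixes f w :: "'a::euclidean_space \<Rightarrow> complex"
  assumes f: "integrable lborel f" and w: "integrable lborel w" and \<delta>: "\<delta> > 0"
  shows "(LINT \<xi>|lborel. fourier_L1 f \<xi> * (cnj (fourier_L1 w \<xi>) * exp (- (norm (\<delta> *\<^sub>R \<xi>))\<^sup>2 / 2))) =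
    (LINT x|lborel. f x * (sqrt (2 * pi) ^ DIM('a) *
      (LINT z|lborel. cnj (w (x - \<delta> *\<^sub>R z)) * exp (- (norm z)\<^sup>2 / 2))))"
proof -
  let ?G = "\<lambda>\<xi>::'a. complex_of_real (exp (- (norm (\<delta> *\<^sub>R \<xi>))\<^sup>2 / 2))"
  let ?w = "\<lambda>y. cnj (w (- y))"
  have wm[measurable]: "w \<in> borel_measurable borel" using borel_measurable_integrable[OF w] by simp
  have [measurable]: "fourier_L1 w \<in> borel_measurable borel" by (rule fourier_L1_measurable[OF w])
  have w': "integrable lborel ?w"
    using lborel_integrable_affine[of "-1" "\<lambda>x. cnj (w x)" 0] w by simp
  have G: "integrable lborel ?G" by (rule gaussian_integrable_scaled[OF \<delta>])
  have "integrable lborel (\<lambda>\<xi>. (LINT x|lborel. norm (w x)) * ?G \<xi>)"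
    using G by (intro integrable_mult_right)
  then have g: "integrable lborel (\<lambda>\<xi>. cnj (fourier_L1 w \<xi>) * ?G \<xi>)"
    by (rule Bochner_Integration.integrable_bound)
      (auto simp: norm_mult intro!: mult_mono AE_I2 order_trans[OF fourier_L1_bound[OF w]])
  have T: "fourier_L1 (\<lambda>\<xi>. cnj (fourier_L1 w \<xi>) * ?G \<xi>) x = sqrt (2 * pi) ^ DIM('a) *
      (LINT z|lborel. cnj (w (x - \<delta> *\<^sub>R z)) * exp (- (norm z)\<^sup>2 / 2))" for x
  proof -
    let ?H = "\<lambda>y. complex_of_real (exp (- (norm ((x + y) /\<^sub>R \<delta>))\<^sup>2 / 2))"
    let ?c = "complex_of_real (sqrt (2 * pi) ^ DIM('a))"
    have Gx: "integrable lborel (\<lambda>\<xi>. cis (- (\<xi> \<bullet> x)) * ?G \<xi>)" by (rule integrable_cis_mult[OF G])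
    have "fourier_L1 (\<lambda>\<xi>. cnj (fourier_L1 w \<xi>) * ?G \<xi>) x =
        (LINT \<xi>|lborel. cis (- (\<xi> \<bullet> x)) * (cnj (fourier_L1 w \<xi>) * ?G \<xi>))"
      by (rule fourier_L1_lborel) measurable
    also have "\<dots> = (LINT \<xi>|lborel. fourier_L1 ?w \<xi> * (cis (- (\<xi> \<bullet> x)) * ?G \<xi>))"
      by (simp add: fourier_L1_cnj_reflect mult_ac)
    also have "\<dots> = (LINT y|lborel. ?w y * fourier_L1 (\<lambda>\<xi>. cis (- (\<xi> \<bullet> x)) * ?G \<xi>) y)"
      by (rule fourier_multiplication_formula[OF w' Gx])
    also have "\<dots> = (LINT y|lborel. ?w y * (?c / \<delta> ^ DIM('a) * ?H y))"
    proof (intro Bochner_Integration.integral_cong refl, rule arg_cong[where f = "(*) _"])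
      fix y
      have "fourier_L1 (\<lambda>\<xi>. cis (- (\<xi> \<bullet> x)) * ?G \<xi>) y =
          (LINT \<xi>|lborel. cis (- (\<xi> \<bullet> y)) * (cis (- (\<xi> \<bullet> x)) * ?G \<xi>))"
        by (rule fourier_L1_lborel) measurable
      also have "\<dots> = (LINT \<xi>|lborel. cis (- (\<xi> \<bullet> (x + y))) * ?G \<xi>)"
        by (simp add: mult.assoc[symmetric] cis_mult inner_add_right add.commute)
      also have "\<dots> = fourier_L1 ?G (x + y)"
        by (rule fourier_L1_lborel[symmetric]) measurable
      also have "\<dots> = ?c / \<delta> ^ DIM('a) * ?H y"
        by (subst fourier_gaussian_scaled[OF \<delta>]) simp
      finally show "fourier_L1 (\<lambda>\<xi>. cis (- (\<xi> \<bullet> x)) * ?G \<xi>) y = ?c / \<delta> ^ DIM('a) * ?H y" .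
    qed
    \<comment> \<open>The substitution \<open>y = - x + \<delta> z\<close> turns the Gaussian of
      width \<open>\<delta>\<close> around \<open>- x\<close> into one of unit width; its Jacobian
      \<open>\<delta> ^ d\<close> cancels the \<open>1 / \<delta> ^ d\<close> of the transformed
      Gaussian.\<close>
    also have "\<dots> = \<delta> ^ DIM('a) *\<^sub>R (LINT z|lborel. ?w (- x + \<delta> *\<^sub>R z) * (?c / \<delta> ^ DIM('a) * ?H (- x + \<delta> *\<^sub>R z)))"
      using \<delta> by (subst lborel_integral_affine[where f = "\<lambda>y. ?w y * (?c / \<delta> ^ DIM('a) * ?H y)"]) auto
    also have "\<dots> = \<delta> ^ DIM('a) *\<^sub>R (LINT z|lborel. ?c / \<delta> ^ DIM('a) *
        (cnj (w (x - \<delta> *\<^sub>R z)) * exp (- (norm z)\<^sup>2 / 2)))"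
      using \<delta> by (simp add: mult_ac)
    also have "\<dots> = ?c * (LINT z|lborel. cnj (w (x - \<delta> *\<^sub>R z)) * exp (- (norm z)\<^sup>2 / 2))"
      using \<delta> by (simp add: scaleR_conv_of_real)
    finally show ?thesis by simp
  qed
  show ?thesis
    by (subst fourier_multiplication_formula[OF f g]) (simp only: T)
qed

lemma square_integrable_mult:
  fixes f g :: "'a \<Rightarrow> complex"
  assumes [measurable]: "f \<in> borel_measurable M" "g \<in> borel_measurable M"
    and "integrable M (\<lambda>x. (cmod (f x))\<^sup>2)" "integrable M (\<lambda>x. (cmod (g x))\<^sup>2)"
  shows "integrable M (\<lambda>x. f x * g x)"
proof (rule Bochner_Integration.integrable_bound)
  show "integrable M (\<lambda>x. (cmod (f x))\<^sup>2 + (cmod (g x))\<^sup>2)"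
    using assms by simp
  have "a * b \<le> a\<^sup>2 + b\<^sup>2" if "a \<ge> 0" "b \<ge> 0" for a b :: real
    using sum_squares_bound[of a b] mult_nonneg_nonneg[OF that] by linarith
  then show "AE x in M. norm (f x * g x) \<le> norm ((cmod (f x))\<^sup>2 + (cmod (g x))\<^sup>2)"
    by (simp add: norm_mult)
qed measurable

text \<open>Let \<open>\<delta>\<close> tend to 0 in \<open>fourier_gaussian_regularised\<close>. On
  the Fourier side the two square integrability assumptions provide the dominating function. On the
  other side the mollification of \<open>w\<close> converges pointwise because \<open>w\<close> is
  continuous, and stays below a multiple of a bound of \<open>w\<close>.\<close>

lemma parseval_L1:
  fixes f w :: "'a::euclidean_space \<Rightarrow> complex"
  assumes f: "integrable lborel f"
    and w: "continuous_on UNIV w" "\<And>x. norm x > R \<Longrightarrow> w x = 0"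
    and fL2: "integrable lborel (\<lambda>\<xi>. (cmod (fourier_L1 f \<xi>))\<^sup>2)"
    and wL2: "integrable lborel (\<lambda>\<xi>. (cmod (fourier_L1 w \<xi>))\<^sup>2)"
  shows "(LINT \<xi>|lborel. fourier_L1 f \<xi> * cnj (fourier_L1 w \<xi>)) =
    (2 * pi) ^ DIM('a) * (LINT x|lborel. f x * cnj (w x))"
proof -
  have wi: "integrable lborel w" using integrable_continuous_compact[OF w] .
  obtain B where B: "B \<ge> 0" "\<And>x. norm (w x) \<le> B"
    using bounded_continuous_compact[OF w] by blast
  have fm[measurable]: "f \<in> borel_measurable borel" using borel_measurable_integrable[OF f] by simp
  have wm[measurable]: "w \<in> borel_measurable borel" using borel_measurable_integrable[OF wi] by simp
  have [measurable]: "fourier_L1 w \<in> borel_measurable borel" "fourier_L1 f \<in> borel_measurable borel"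
    by (auto intro: fourier_L1_measurable wi f)
  define \<delta> where "\<delta> n = 1 / real (Suc n)" for n
  have \<delta>: "\<delta> n > 0" for n by (simp add: \<delta>_def)
  have \<delta>0: "\<delta> \<longlonglongrightarrow> 0"
    unfolding \<delta>_def using LIMSEQ_inverse_real_of_nat by (simp add: inverse_eq_divide)
  let ?c = "complex_of_real (sqrt (2 * pi) ^ DIM('a))"
  let ?g = "\<lambda>z::'a. exp (- (norm z)\<^sup>2 / 2)"
  let ?T = "\<lambda>n x. ?c * (LINT z|lborel. cnj (w (x - \<delta> n *\<^sub>R z)) * ?g z)"
  have gc: "integrable lborel (\<lambda>z::'a. complex_of_real (?g z))"
    using gaussian_fourier(1)[of "0::'a"] by simp
  then have gi: "integrable lborel ?g" by (simp only: complex_of_real_integrable_eq)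
  have gc_eq: "(LINT z|lborel. complex_of_real (?g z)) = ?c"
    using gaussian_fourier(2)[of "0::'a"] by simp
  have g_eq: "(LINT z|lborel. ?g z) = sqrt (2 * pi) ^ DIM('a)"
    using gc_eq unfolding integral_complex_of_real by (simp only: of_real_eq_iff)
  have lim1: "(\<lambda>n. LINT \<xi>|lborel. fourier_L1 f \<xi> * (cnj (fourier_L1 w \<xi>) * ?g (\<delta> n *\<^sub>R \<xi>)))
      \<longlonglongrightarrow> (LINT \<xi>|lborel. fourier_L1 f \<xi> * cnj (fourier_L1 w \<xi>))"
  proof (rule integral_dominated_convergence[where w="\<lambda>\<xi>. norm (fourier_L1 f \<xi> * cnj (fourier_L1 w \<xi>))"])
    show "integrable lborel (\<lambda>\<xi>. norm (fourier_L1 f \<xi> * cnj (fourier_L1 w \<xi>)))"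
      using fL2 wL2 by (intro integrable_norm square_integrable_mult) auto
    show "AE \<xi> in lborel. (\<lambda>n. fourier_L1 f \<xi> * (cnj (fourier_L1 w \<xi>) * ?g (\<delta> n *\<^sub>R \<xi>)))
        \<longlonglongrightarrow> fourier_L1 f \<xi> * cnj (fourier_L1 w \<xi>)"
    proof (rule AE_I2)
      fix \<xi> :: 'a
      have "(\<lambda>n. complex_of_real (?g (\<delta> n *\<^sub>R \<xi>))) \<longlonglongrightarrow> complex_of_real (?g (0 *\<^sub>R \<xi>))"
        by (intro tendsto_intros \<delta>0) auto
      then have "(\<lambda>n. complex_of_real (?g (\<delta> n *\<^sub>R \<xi>))) \<longlonglongrightarrow> 1" by simp
      then have "(\<lambda>n. fourier_L1 f \<xi> * (cnj (fourier_L1 w \<xi>) * ?g (\<delta> n *\<^sub>R \<xi>)))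
        \<longlonglongrightarrow> fourier_L1 f \<xi> * (cnj (fourier_L1 w \<xi>) * 1)" by (intro tendsto_mult tendsto_const)
      then show "(\<lambda>n. fourier_L1 f \<xi> * (cnj (fourier_L1 w \<xi>) * ?g (\<delta> n *\<^sub>R \<xi>)))
        \<longlonglongrightarrow> fourier_L1 f \<xi> * cnj (fourier_L1 w \<xi>)" by simp
    qed
    show "AE \<xi> in lborel. norm (fourier_L1 f \<xi> * (cnj (fourier_L1 w \<xi>) * ?g (\<delta> n *\<^sub>R \<xi>)))
        \<le> norm (fourier_L1 f \<xi> * cnj (fourier_L1 w \<xi>))" for n
      by (rule AE_I2) (auto simp: norm_mult mult.assoc[symmetric] intro!: mult_left_le)
  qed measurable
  have T_lim: "(\<lambda>n. ?T n x) \<longlonglongrightarrow> ?c * (cnj (w x) * ?c)" for x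
  proof -
    have "(\<lambda>n. LINT z|lborel. cnj (w (x - \<delta> n *\<^sub>R z)) * ?g z) \<longlonglongrightarrow> (LINT z|lborel. cnj (w x) * ?g z)"
    proof (rule integral_dominated_convergence[where w="\<lambda>z. B * ?g z"])
      show "AE z in lborel. (\<lambda>n. cnj (w (x - \<delta> n *\<^sub>R z)) * ?g z) \<longlonglongrightarrow> cnj (w x) * ?g z"
      proof (rule AE_I2)
        fix z :: 'a
        have "(\<lambda>n. x - \<delta> n *\<^sub>R z) \<longlonglongrightarrow> x - 0 *\<^sub>R z"
          by (intro tendsto_intros \<delta>0)
        moreover have "isCont w x"
          using w(1) by (simp add: continuous_on_eq_continuous_at)
        ultimately have "(\<lambda>n. w (x - \<delta> n *\<^sub>R z)) \<longlonglongrightarrow> w x"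
          by (intro isCont_tendsto_compose[where g=w]) auto
        then show "(\<lambda>n. cnj (w (x - \<delta> n *\<^sub>R z)) * ?g z) \<longlonglongrightarrow> cnj (w x) * ?g z"
          by (intro tendsto_intros)
      qed
      show "integrable lborel (\<lambda>z. B * ?g z)" using gi by simp
      show "AE z in lborel. norm (cnj (w (x - \<delta> n *\<^sub>R z)) * ?g z) \<le> B * ?g z" for n
        using B by (auto simp: norm_mult intro!: mult_right_mono)
    qed measurable
    then show ?thesis
      using gc_eq by (intro tendsto_mult tendsto_const) (simp del: of_real_power of_real_exp)
  qed
  have lim2: "(\<lambda>n. LINT x|lborel. f x * ?T n x) \<longlonglongrightarrow> (LINT x|lborel. f x * (?c * (cnj (w x) * ?c)))"
  proof (rule integral_dominated_convergence[where w="\<lambda>x. norm (f x) * (norm ?c * (B * norm ?c))"])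
    show "AE x in lborel. (\<lambda>n. f x * ?T n x) \<longlonglongrightarrow> f x * (?c * (cnj (w x) * ?c))"
      by (intro AE_I2 tendsto_mult tendsto_const T_lim)
    show "integrable lborel (\<lambda>x. norm (f x) * (norm ?c * (B * norm ?c)))"
      using f by simp
    have "norm (LINT z|lborel. cnj (w (x - \<delta> n *\<^sub>R z)) * ?g z) \<le> B * norm ?c" for n x
    proof -
      have "norm (LINT z|lborel. cnj (w (x - \<delta> n *\<^sub>R z)) * ?g z) \<le> (LINT z|lborel. B * ?g z)"
      proof (rule Bochner_Integration.integral_norm_bound_integral)
        show "integrable lborel (\<lambda>z. cnj (w (x - \<delta> n *\<^sub>R z)) * complex_of_real (?g z))"
        proof (rule Bochner_Integration.integrable_bound)
          show "integrable lborel (\<lambda>z. B * ?g z)" using gi by simp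
          show "AE z in lborel. norm (cnj (w (x - \<delta> n *\<^sub>R z)) * complex_of_real (?g z)) \<le> norm (B * ?g z)"
            using B by (auto simp: norm_mult intro!: mult_right_mono)
        qed measurable
        show "norm (cnj (w (x - \<delta> n *\<^sub>R z)) * complex_of_real (?g z)) \<le> B * ?g z" for z
          using B by (auto simp: norm_mult intro!: mult_right_mono)
      qed (use gi in simp)
      also have "\<dots> = B * norm ?c" using g_eq by (simp add: norm_power)
      finally show ?thesis .
    qed
    then show "AE x in lborel. norm (f x * ?T n x) \<le> norm (f x) * (norm ?c * (B * norm ?c))" for n
      by (auto simp: norm_mult intro!: mult_left_mono)
  qed measurable
  have "(LINT \<xi>|lborel. fourier_L1 f \<xi> * cnj (fourier_L1 w \<xi>)) =
      (LINT x|lborel. f x * (?c * (cnj (w x) * ?c)))"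
    using LIMSEQ_unique[OF lim1] lim2 fourier_gaussian_regularised[OF f wi \<delta>] by simp
  also have "\<dots> = (LINT x|lborel. (?c * ?c) * (f x * cnj (w x)))"
    by (simp add: mult_ac)
  also have "\<dots> = (?c * ?c) * (LINT x|lborel. f x * cnj (w x))"
    by simp
  also have "?c * ?c = complex_of_real ((2 * pi) ^ DIM('a))"
  proof -
    have "sqrt (2 * pi) ^ DIM('a) * sqrt (2 * pi) ^ DIM('a) = (2 * pi) ^ DIM('a)"
      by (simp only: power_mult_distrib[symmetric] real_sqrt_mult_self) simp
    then show ?thesis by (simp only: of_real_mult[symmetric])
  qed
  finally show ?thesis by simp
qed

section \<open>The Fourier transform of square integrable functions\<close>

lemma ex_borel_version:
  fixes f :: "'a::euclidean_space \<Rightarrow> real"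
  assumes "f \<in> borel_measurable lebesgue"
  obtains g where "g \<in> borel_measurable borel" "AE x in lebesgue. f x = g x"
proof -
  obtain g where "g \<in> borel_measurable lborel" "AE x in lborel. f x = g x"
    using completion_ex_borel_measurable_real[OF assms] by blast
  then show ?thesis by (intro that[of g] AE_completion) auto
qed

lemma ex_borel_version_complex:
  fixes f :: "'a::euclidean_space \<Rightarrow> complex"
  assumes [measurable]: "f \<in> borel_measurable lebesgue"
  obtains g where "g \<in> borel_measurable borel" "AE x in lebesgue. f x = g x"
proof -
  have 1: "(\<lambda>x. Re (f x)) \<in> borel_measurable lebesgue" and 2: "(\<lambda>x. Im (f x)) \<in> borel_measurable lebesgue"
    by measurable
  obtain g1 where g1: "g1 \<in> borel_measurable borel" "AE x in lebesgue. Re (f x) = g1 x"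
    using ex_borel_version[OF 1] .
  obtain g2 where g2: "g2 \<in> borel_measurable borel" "AE x in lebesgue. Im (f x) = g2 x"
    using ex_borel_version[OF 2] .
  note [measurable] = g1(1) g2(1)
  show ?thesis
  proof (rule that)
    show "(\<lambda>x. complex_of_real (g1 x) + \<i> * complex_of_real (g2 x)) \<in> borel_measurable borel"
      by measurable
    show "AE x in lebesgue. f x = complex_of_real (g1 x) + \<i> * complex_of_real (g2 x)"
      using g1(2) g2(2)
    proof eventually_elim
      case (elim x)
      then show ?case using complex_eq[of "f x"] by simp
    qed
  qed
qed

lemma borel_measurable_indicator_complex [measurable]:
  fixes A :: "'a::topological_space set"
  assumes "A \<in> sets borel"
  shows "(indicator A :: 'a \<Rightarrow> complex) \<in> borel_measurable borel"
proof -
  have "(indicator A :: 'a \<Rightarrow> complex) = (\<lambda>x. complex_of_real (indicator A x))"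
    by (auto simp: indicator_def)
  then show ?thesis using assms by simp
qed

text \<open>The indicator of a ball is square integrable, so its product with \<open>f\<close> is
  integrable and \<open>fourier_L1\<close> of a truncation is an absolutely convergent
  integral.\<close>

lemma integrable_truncation:
  fixes f :: "'a::euclidean_space \<Rightarrow> complex"
  assumes "square_integrable f"
  shows "integrable lebesgue (\<lambda>x. indicator (cball 0 R) x * f x)"
proof (rule square_integrable_mult)
  show "(\<lambda>x. indicator (cball 0 R) x :: complex) \<in> borel_measurable lebesgue"
    by (rule measurable_borel_lebesgue) simp
  have "integrable lebesgue (indicator (cball (0::'a) R) :: 'a \<Rightarrow> real)"
    using emeasure_lborel_cball_finite[of "0::'a" R] by (intro integrable_real_indicator) auto
  moreover have "(\<lambda>x. (cmod (indicator (cball (0::'a) R) x))\<^sup>2) = indicator (cball 0 R)"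
    by (auto simp: indicator_def)
  ultimately show "integrable lebesgue (\<lambda>x. (cmod (indicator (cball (0::'a) R) x))\<^sup>2)" by simp
qed (use assms in \<open>auto simp: square_integrable_def\<close>)

lemma fourier_L1_cong_AE:
  fixes f g :: "'a::euclidean_space \<Rightarrow> complex"
  assumes "AE x in lebesgue. f x = g x" "f \<in> borel_measurable lebesgue" "g \<in> borel_measurable lebesgue"
  shows "fourier_L1 f = fourier_L1 g"
proof
  fix \<xi> :: 'a
  have [measurable]: "(\<lambda>x. cis (- (x \<bullet> \<xi>))) \<in> borel_measurable lebesgue"
    by (rule measurable_borel_lebesgue) measurable
  note [measurable] = assms(2,3)
  show "fourier_L1 f \<xi> = fourier_L1 g \<xi>"
    unfolding fourier_L1_def
    by (rule integral_cong_AE) (use assms(1) in auto)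
qed

text \<open>The transform ignores null sets, so the result for a Borel version of \<open>f\<close>
  carries over.\<close>

lemma fourier_L1_measurable_lebesgue:
  fixes f :: "'a::euclidean_space \<Rightarrow> complex"
  assumes "integrable lebesgue f"
  shows "fourier_L1 f \<in> borel_measurable borel"
proof -
  have fm: "f \<in> borel_measurable lebesgue" using borel_measurable_integrable[OF assms] .
  then obtain g where g: "g \<in> borel_measurable borel" "AE x in lebesgue. f x = g x"
    using ex_borel_version_complex by blast
  have gm: "g \<in> borel_measurable lebesgue" using g(1) by (rule measurable_borel_lebesgue)
  have "integrable lebesgue g"
    using assms g(2) fm gm by (subst (asm) integrable_cong_AE) auto
  then have "integrable lborel g" using g(1) by (simp add: integrable_completion)
  then show ?thesis
    using fourier_L1_cong_AE[OF g(2) fm gm] fourier_L1_measurable by simp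
qed

lemma fourier_truncation_measurable:
  fixes f :: "'a::euclidean_space \<Rightarrow> complex"
  assumes "square_integrable f"
  shows "fourier_L1 (\<lambda>x. indicator (cball 0 R) x * f x) \<in> borel_measurable borel"
  using fourier_L1_measurable_lebesgue[OF integrable_truncation[OF assms]] .

lemma is_fourier_L2_cong_AE:
  assumes "is_fourier_L2 f F" "AE x in lebesgue. f x = g x" "AE x in lebesgue. F x = G x"
    and [measurable]: "g \<in> borel_measurable lebesgue" "G \<in> borel_measurable lebesgue"
  shows "is_fourier_L2 g G"
proof -
  have sf: "square_integrable f" and sF: "square_integrable F"
    using assms(1) by (auto simp: is_fourier_L2_def)
  have fm[measurable]: "f \<in> borel_measurable lebesgue" and Fm[measurable]: "F \<in> borel_measurable lebesgue"
    using sf sF by (auto simp: square_integrable_def)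
  have "integrable lebesgue (\<lambda>x. (cmod (f x))\<^sup>2) = integrable lebesgue (\<lambda>x. (cmod (g x))\<^sup>2)"
    by (rule integrable_cong_AE) (use assms(2) in auto)
  then have 1: "square_integrable g" using sf by (auto simp: square_integrable_def)
  have "integrable lebesgue (\<lambda>x. (cmod (F x))\<^sup>2) = integrable lebesgue (\<lambda>x. (cmod (G x))\<^sup>2)"
    by (rule integrable_cong_AE) (use assms(3) in auto)
  then have 2: "square_integrable G" using sF by (auto simp: square_integrable_def)
  have eq: "fourier_L1 (\<lambda>x. indicator (cball 0 R) x * f x) = fourier_L1 (\<lambda>x. indicator (cball 0 R) x * g x)" for R
    by (rule fourier_L1_cong_AE)
      (use assms(2) borel_measurable_integrable[OF integrable_truncation[OF sf]]
         borel_measurable_integrable[OF integrable_truncation[OF 1]] in auto)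
  have "(\<integral>\<^sup>+ \<xi>. ennreal ((cmod (F \<xi> - fourier_L1 (\<lambda>x. indicator (cball 0 R) x * f x) \<xi>))\<^sup>2) \<partial>lebesgue) =
        (\<integral>\<^sup>+ \<xi>. ennreal ((cmod (G \<xi> - fourier_L1 (\<lambda>x. indicator (cball 0 R) x * g x) \<xi>))\<^sup>2) \<partial>lebesgue)" for R
    unfolding eq by (rule nn_integral_cong_AE) (use assms(3) in auto)
  then show ?thesis using assms(1) 1 2 by (simp add: is_fourier_L2_def)
qed

text \<open>Both are limits in the mean of the same truncated transforms, compared through
  \<open>|a - b|^2 \<le> 2 |a - c|^2 + 2 |b - c|^2\<close>. This makes \<open>sobolev_norm\<close>,
  which is defined by a choice, computable.\<close>

lemma is_fourier_L2_unique:
  assumes F: "is_fourier_L2 f F" and G: "is_fourier_L2 f G"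
  shows "AE \<xi> in lebesgue. F \<xi> = G \<xi>"
proof -
  have sf: "square_integrable f"
    and [measurable]: "F \<in> borel_measurable lebesgue" "G \<in> borel_measurable lebesgue"
    using F G by (auto simp: is_fourier_L2_def square_integrable_def)
  define \<Phi> where "\<Phi> R = fourier_L1 (\<lambda>x. indicator (cball 0 R) x * f x)" for R
  have [measurable]: "\<Phi> R \<in> borel_measurable lebesgue" for R
    unfolding \<Phi>_def by (intro measurable_borel_lebesgue fourier_truncation_measurable sf)
  have "(\<integral>\<^sup>+ \<xi>. ennreal ((cmod (F \<xi> - G \<xi>))\<^sup>2) \<partial>lebesgue) \<le>
      2 * (\<integral>\<^sup>+ \<xi>. ennreal ((cmod (F \<xi> - \<Phi> R \<xi>))\<^sup>2) \<partial>lebesgue)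
      + 2 * (\<integral>\<^sup>+ \<xi>. ennreal ((cmod (G \<xi> - \<Phi> R \<xi>))\<^sup>2) \<partial>lebesgue)" for R
  proof -
    have ineq: "(cmod (F \<xi> - G \<xi>))\<^sup>2 \<le> 2 * (cmod (F \<xi> - \<Phi> R \<xi>))\<^sup>2 + 2 * (cmod (G \<xi> - \<Phi> R \<xi>))\<^sup>2" for \<xi>
    proof -
      have "cmod (F \<xi> - G \<xi>) \<le> cmod (F \<xi> - \<Phi> R \<xi>) + cmod (G \<xi> - \<Phi> R \<xi>)"
        using norm_triangle_ineq4[of "F \<xi> - \<Phi> R \<xi>" "G \<xi> - \<Phi> R \<xi>"] by simp
      then have "(cmod (F \<xi> - G \<xi>))\<^sup>2 \<le> (cmod (F \<xi> - \<Phi> R \<xi>) + cmod (G \<xi> - \<Phi> R \<xi>))\<^sup>2"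
        by (intro power_mono) auto
      also have "\<dots> \<le> 2 * (cmod (F \<xi> - \<Phi> R \<xi>))\<^sup>2 + 2 * (cmod (G \<xi> - \<Phi> R \<xi>))\<^sup>2"
        using sum_squares_bound[of "cmod (F \<xi> - \<Phi> R \<xi>)" "cmod (G \<xi> - \<Phi> R \<xi>)"]
        by (simp add: power2_sum)
      finally show ?thesis .
    qed
    have "(\<integral>\<^sup>+ \<xi>. ennreal ((cmod (F \<xi> - G \<xi>))\<^sup>2) \<partial>lebesgue) \<le>
       (\<integral>\<^sup>+ \<xi>. 2 * ennreal ((cmod (F \<xi> - \<Phi> R \<xi>))\<^sup>2) + 2 * ennreal ((cmod (G \<xi> - \<Phi> R \<xi>))\<^sup>2) \<partial>lebesgue)"
    proof (rule nn_integral_mono)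
      fix \<xi>
      have "ennreal ((cmod (F \<xi> - G \<xi>))\<^sup>2) \<le>
          ennreal (2 * (cmod (F \<xi> - \<Phi> R \<xi>))\<^sup>2 + 2 * (cmod (G \<xi> - \<Phi> R \<xi>))\<^sup>2)"
        using ineq by (rule ennreal_leI)
      also have "\<dots> = 2 * ennreal ((cmod (F \<xi> - \<Phi> R \<xi>))\<^sup>2) + 2 * ennreal ((cmod (G \<xi> - \<Phi> R \<xi>))\<^sup>2)"
        by (simp add: ennreal_mult)
      finally show "ennreal ((cmod (F \<xi> - G \<xi>))\<^sup>2) \<le>
        2 * ennreal ((cmod (F \<xi> - \<Phi> R \<xi>))\<^sup>2) + 2 * ennreal ((cmod (G \<xi> - \<Phi> R \<xi>))\<^sup>2)" .
    qed
    also have "\<dots> = 2 * (\<integral>\<^sup>+ \<xi>. ennreal ((cmod (F \<xi> - \<Phi> R \<xi>))\<^sup>2) \<partial>lebesgue)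
      + 2 * (\<integral>\<^sup>+ \<xi>. ennreal ((cmod (G \<xi> - \<Phi> R \<xi>))\<^sup>2) \<partial>lebesgue)"
      by (subst nn_integral_add) (auto simp: nn_integral_cmult)
    finally show ?thesis .
  qed
  moreover have "((\<lambda>R. 2 * (\<integral>\<^sup>+ \<xi>. ennreal ((cmod (F \<xi> - \<Phi> R \<xi>))\<^sup>2) \<partial>lebesgue)
      + 2 * (\<integral>\<^sup>+ \<xi>. ennreal ((cmod (G \<xi> - \<Phi> R \<xi>))\<^sup>2) \<partial>lebesgue)) \<longlongrightarrow> 2 * 0 + 2 * 0) at_top"
    using F G unfolding is_fourier_L2_def \<Phi>_def
    by (intro tendsto_add ennreal_tendsto_cmult) auto
  ultimately have "(\<integral>\<^sup>+ \<xi>. ennreal ((cmod (F \<xi> - G \<xi>))\<^sup>2) \<partial>lebesgue) \<le> 0"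
    by (intro tendsto_lowerbound[where F = at_top and f = "\<lambda>R. 2 * (\<integral>\<^sup>+ \<xi>. ennreal ((cmod (F \<xi> - \<Phi> R \<xi>))\<^sup>2) \<partial>lebesgue)
      + 2 * (\<integral>\<^sup>+ \<xi>. ennreal ((cmod (G \<xi> - \<Phi> R \<xi>))\<^sup>2) \<partial>lebesgue)"]) auto
  then have "(\<integral>\<^sup>+ \<xi>. ennreal ((cmod (F \<xi> - G \<xi>))\<^sup>2) \<partial>lebesgue) = 0" by simp
  then have "AE \<xi> in lebesgue. ennreal ((cmod (F \<xi> - G \<xi>))\<^sup>2) = 0"
    by (subst (asm) nn_integral_0_iff_AE) auto
  then show ?thesis by eventually_elim simp
qed

text \<open>For \<open>R \<le> S\<close> truncation to radius \<open>S\<close> changes nothing, so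
  the error in the mean is eventually constant in \<open>S\<close> and, tending to 0, must
  vanish.\<close>

lemma fourier_L2_eq_L1:
  fixes f :: "'a::euclidean_space \<Rightarrow> complex"
  assumes F: "is_fourier_L2 f F" and R: "\<And>x. norm x > R \<Longrightarrow> f x = 0"
  shows "is_fourier_L2 f (fourier_L1 f)" "AE \<xi> in lebesgue. F \<xi> = fourier_L1 f \<xi>"
proof -
  have sf: "square_integrable f" and Fm[measurable]: "F \<in> borel_measurable lebesgue"
    using F by (auto simp: is_fourier_L2_def square_integrable_def)
  have tr: "(\<lambda>x. indicator (cball 0 S) x * f x) = f" if "S \<ge> R" for S
    using R that by (auto simp: indicator_def fun_eq_iff)
  have [measurable]: "fourier_L1 f \<in> borel_measurable lebesgue"
    using fourier_truncation_measurable[OF sf, of R] tr[of R] by (auto intro: measurable_borel_lebesgue)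
  have "eventually (\<lambda>S. (\<integral>\<^sup>+ \<xi>. ennreal ((cmod (F \<xi> - fourier_L1 (\<lambda>x. indicator (cball 0 S) x * f x) \<xi>))\<^sup>2) \<partial>lebesgue)
     = (\<integral>\<^sup>+ \<xi>. ennreal ((cmod (F \<xi> - fourier_L1 f \<xi>))\<^sup>2) \<partial>lebesgue)) at_top"
    using eventually_ge_at_top[of R] by eventually_elim (simp add: tr)
  then have "((\<lambda>S. \<integral>\<^sup>+ \<xi>. ennreal ((cmod (F \<xi> - fourier_L1 (\<lambda>x. indicator (cball 0 S) x * f x) \<xi>))\<^sup>2) \<partial>lebesgue)
     \<longlongrightarrow> (\<integral>\<^sup>+ \<xi>. ennreal ((cmod (F \<xi> - fourier_L1 f \<xi>))\<^sup>2) \<partial>lebesgue)) at_top"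
    by (rule tendsto_eventually)
  moreover have "((\<lambda>S::real. \<integral>\<^sup>+ \<xi>. ennreal ((cmod (F \<xi> - fourier_L1 (\<lambda>x. indicator (cball 0 S) x * f x) \<xi>))\<^sup>2) \<partial>lebesgue)
     \<longlongrightarrow> 0) at_top"
    using F by (simp add: is_fourier_L2_def)
  ultimately have "(\<integral>\<^sup>+ \<xi>. ennreal ((cmod (F \<xi> - fourier_L1 f \<xi>))\<^sup>2) \<partial>lebesgue) = 0"
    by (intro tendsto_unique[OF trivial_limit_at_top_linorder])
  then have "AE \<xi> in lebesgue. ennreal ((cmod (F \<xi> - fourier_L1 f \<xi>))\<^sup>2) = 0"
    by (subst (asm) nn_integral_0_iff_AE) auto
  then show AE: "AE \<xi> in lebesgue. F \<xi> = fourier_L1 f \<xi>" by eventually_elim simp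
  show "is_fourier_L2 f (fourier_L1 f)"
    by (rule is_fourier_L2_cong_AE[OF F _ AE]) (use sf in \<open>auto simp: square_integrable_def\<close>)
qed

text \<open>Truncating the dilated function at radius \<open>R\<close> is dilating the truncation at
  radius \<open>R / a\<close>. Hence the mean square error at \<open>R\<close> is a fixed multiple
  of the original error at \<open>R / a\<close>, and \<open>R / a\<close> tends to infinity with
  \<open>R\<close>.\<close>

lemma is_fourier_L2_scale:
  fixes f :: "'a::euclidean_space \<Rightarrow> complex"
  assumes F: "is_fourier_L2 f F" and a: "a > 0"
  shows "is_fourier_L2 (\<lambda>x. complex_of_real c * f (x /\<^sub>R a))
    (\<lambda>\<xi>. complex_of_real (c * a ^ DIM('a)) * F (a *\<^sub>R \<xi>))"
proof -
  let ?C = "complex_of_real (c * a ^ DIM('a))"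
  have sf: "square_integrable f" and sF: "square_integrable F"
    and lim: "((\<lambda>R::real. \<integral>\<^sup>+ \<xi>. ennreal ((cmod (F \<xi> -
          fourier_L1 (\<lambda>x. indicator (cball 0 R) x * f x) \<xi>))\<^sup>2) \<partial>lebesgue) \<longlongrightarrow> 0) at_top"
    using F by (auto simp: is_fourier_L2_def)
  have fm[measurable]: "f \<in> borel_measurable lebesgue" and Fm[measurable]: "F \<in> borel_measurable lebesgue"
    using sf sF by (auto simp: square_integrable_def)
  have [measurable]: "(\<lambda>x. f (x /\<^sub>R a)) \<in> borel_measurable lebesgue"
    using measurable_compose_affine[OF _ fm, of "inverse a" 0] a by simp
  have [measurable]: "(\<lambda>x. F (a *\<^sub>R x)) \<in> borel_measurable lebesgue"
    using measurable_compose_affine[OF _ Fm, of a 0] a by simp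
  have 1: "square_integrable (\<lambda>x. complex_of_real c * f (x /\<^sub>R a))"
    using integrable_lebesgue_affine[of "inverse a" "\<lambda>x. (cmod (f x))\<^sup>2" 0] a sf
    by (auto simp: square_integrable_def norm_mult power_mult_distrib)
  have 2: "square_integrable (\<lambda>\<xi>. ?C * F (a *\<^sub>R \<xi>))"
    using integrable_lebesgue_affine[of a "\<lambda>x. (cmod (F x))\<^sup>2" 0] a sF
    by (auto simp: square_integrable_def norm_mult power_mult_distrib)
  define \<Phi> where "\<Phi> R = fourier_L1 (\<lambda>x. indicator (cball 0 R) x * f x)" for R
  have [measurable]: "\<Phi> R \<in> borel_measurable lebesgue" for R
    unfolding \<Phi>_def by (intro measurable_borel_lebesgue fourier_truncation_measurable sf)
  have tr: "fourier_L1 (\<lambda>x. indicator (cball 0 R) x * (complex_of_real c * f (x /\<^sub>R a))) \<xi> = ?C * \<Phi> (R / a) (a *\<^sub>R \<xi>)"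
    for R \<xi>
  proof -
    let ?h = "\<lambda>y. complex_of_real c * (cis (- (y \<bullet> (a *\<^sub>R \<xi>))) * (indicator (cball 0 (R / a)) y * f y))"
    have [measurable]: "(\<lambda>y. cis (- (y \<bullet> (a *\<^sub>R \<xi>)))) \<in> borel_measurable lebesgue"
      by (rule measurable_borel_lebesgue) measurable
    have [measurable]: "(\<lambda>y. indicator (cball 0 (R / a)) y * f y) \<in> borel_measurable lebesgue"
      using borel_measurable_integrable[OF integrable_truncation[OF sf]] .
    have ind: "indicator (cball 0 R) x = (indicator (cball 0 (R / a)) (x /\<^sub>R a) :: complex)" for x :: 'a
      using a by (auto simp: indicator_def field_simps)
    have hm: "?h \<in> borel_measurable lebesgue" by measurable
    have inv: "a * (inverse a * z) = z" for z using a by simp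
    have "fourier_L1 (\<lambda>x. indicator (cball 0 R) x * (complex_of_real c * f (x /\<^sub>R a))) \<xi> =
        (LINT x|lebesgue. ?h (0 + inverse a *\<^sub>R x))"
      unfolding fourier_L1_def using a by (intro Bochner_Integration.integral_cong refl) (simp add: ind mult_ac inv)
    also have "\<dots> = (1 / \<bar>inverse a\<bar> ^ DIM('a)) *\<^sub>R (LINT x|lebesgue. ?h x)"
      by (rule integral_lebesgue_affine[OF _ hm]) (use a in simp)
    also have "\<dots> = ?C * \<Phi> (R / a) (a *\<^sub>R \<xi>)"
      using a by (simp add: \<Phi>_def fourier_L1_def scaleR_conv_of_real power_inverse field_simps)
    finally show ?thesis .
  qed
  have nn: "(\<integral>\<^sup>+ \<xi>. ennreal ((cmod (?C * F (a *\<^sub>R \<xi>) -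
       fourier_L1 (\<lambda>x. indicator (cball 0 R) x * (complex_of_real c * f (x /\<^sub>R a))) \<xi>))\<^sup>2) \<partial>lebesgue) =
     ennreal ((cmod ?C)\<^sup>2 / a ^ DIM('a)) * (\<integral>\<^sup>+ \<xi>. ennreal ((cmod (F \<xi> - \<Phi> (R / a) \<xi>))\<^sup>2) \<partial>lebesgue)" for R
  proof -
    let ?k = "\<lambda>\<xi>. ennreal ((cmod (F \<xi> - \<Phi> (R / a) \<xi>))\<^sup>2)"
    have "(\<integral>\<^sup>+ \<xi>. ennreal ((cmod (?C * F (a *\<^sub>R \<xi>) -
       fourier_L1 (\<lambda>x. indicator (cball 0 R) x * (complex_of_real c * f (x /\<^sub>R a))) \<xi>))\<^sup>2) \<partial>lebesgue) =
       (\<integral>\<^sup>+ \<xi>. ennreal ((cmod ?C)\<^sup>2) * ?k (0 + a *\<^sub>R \<xi>) \<partial>lebesgue)"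
      unfolding tr right_diff_distrib[symmetric] norm_mult power_mult_distrib
      by (simp add: ennreal_mult)
    also have "\<dots> = ennreal ((cmod ?C)\<^sup>2) * (\<integral>\<^sup>+ \<xi>. ?k (0 + a *\<^sub>R \<xi>) \<partial>lebesgue)"
      using a by (intro nn_integral_cmult measurable_compose_affine[where f = ?k]) auto
    also have "\<dots> = ennreal ((cmod ?C)\<^sup>2 / a ^ DIM('a)) * (ennreal (\<bar>a\<bar> ^ DIM('a)) * (\<integral>\<^sup>+ \<xi>. ?k (0 + a *\<^sub>R \<xi>) \<partial>lebesgue))"
      using a by (simp add: mult.assoc[symmetric] ennreal_mult[symmetric])
    also have "\<dots> = ennreal ((cmod ?C)\<^sup>2 / a ^ DIM('a)) * (\<integral>\<^sup>+ \<xi>. ?k \<xi> \<partial>lebesgue)"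
      using a by (subst nn_integral_lebesgue_affine[of a ?k 0]) auto
    finally show ?thesis .
  qed
  have "filterlim (\<lambda>R::real. R / a) at_top at_top"
    using a by (auto intro!: filterlim_at_top_mult_tendsto_pos[OF tendsto_const _ filterlim_ident]
        simp: divide_inverse)
  from filterlim_compose[OF lim this]
  have "((\<lambda>R. ennreal ((cmod ?C)\<^sup>2 / a ^ DIM('a)) * (\<integral>\<^sup>+ \<xi>. ennreal ((cmod (F \<xi> - \<Phi> (R / a) \<xi>))\<^sup>2) \<partial>lebesgue))
      \<longlongrightarrow> ennreal ((cmod ?C)\<^sup>2 / a ^ DIM('a)) * 0) at_top"
    unfolding \<Phi>_def by (intro ennreal_tendsto_cmult) auto
  then show ?thesis
    unfolding is_fourier_L2_def nn using 1 2 by auto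
qed

text \<open>\<open>parseval_L1\<close> applies to each truncated \<open>f\<close>. Once the
  truncation radius is at least \<open>R\<close>, the product with \<open>w\<close> no longer sees
  the truncation, so the right-hand side is already exact and only the transform has to be passed to
  the limit, which \<open>est\<close> does by a weighted Young inequality.\<close>

lemma parseval_L2:
  fixes f F w :: "'a::euclidean_space \<Rightarrow> complex"
  assumes F: "is_fourier_L2 f F" and fm[measurable]: "f \<in> borel_measurable borel"
    and Fm[measurable]: "F \<in> borel_measurable borel"
    and w: "continuous_on UNIV w" "\<And>x. norm x > R \<Longrightarrow> w x = 0"
    and wL2: "integrable lborel (\<lambda>\<xi>. (cmod (fourier_L1 w \<xi>))\<^sup>2)"
  shows "integrable lborel (\<lambda>\<xi>. F \<xi> * cnj (fourier_L1 w \<xi>))"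
    and "(LINT \<xi>|lborel. F \<xi> * cnj (fourier_L1 w \<xi>)) = (2 * pi) ^ DIM('a) * (LINT x|lborel. f x * cnj (w x))"
proof -
  have sf: "square_integrable f" and sF: "square_integrable F"
    and lim: "((\<lambda>R::real. \<integral>\<^sup>+ \<xi>. ennreal ((cmod (F \<xi> -
          fourier_L1 (\<lambda>x. indicator (cball 0 R) x * f x) \<xi>))\<^sup>2) \<partial>lebesgue) \<longlongrightarrow> 0) at_top"
    using F by (auto simp: is_fourier_L2_def)
  have FL2: "integrable lborel (\<lambda>\<xi>. (cmod (F \<xi>))\<^sup>2)"
    using sF by (simp add: square_integrable_def integrable_completion)
  have wi: "integrable lborel w" using integrable_continuous_compact[OF w] .
  have wm[measurable]: "fourier_L1 w \<in> borel_measurable borel" by (rule fourier_L1_measurable[OF wi])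
  define \<Phi> where "\<Phi> R = fourier_L1 (\<lambda>x. indicator (cball 0 R) x * f x)" for R
  have [measurable]: "\<Phi> R \<in> borel_measurable borel" for R
    unfolding \<Phi>_def by (intro fourier_truncation_measurable sf)
  show Fw: "integrable lborel (\<lambda>\<xi>. F \<xi> * cnj (fourier_L1 w \<xi>))"
    using FL2 wL2 by (intro square_integrable_mult) auto
  let ?c = "(2 * pi) ^ DIM('a) * (LINT x|lborel. f x * cnj (w x))"
  let ?d = "cmod ((LINT \<xi>|lborel. F \<xi> * cnj (fourier_L1 w \<xi>)) - ?c)"
  let ?W = "LINT \<xi>|lborel. (cmod (fourier_L1 w \<xi>))\<^sup>2"
  have est: "?d \<le> \<epsilon> * (1 + ?W)" if \<epsilon>: "\<epsilon> > 0" for \<epsilon>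
  proof -
    \<comment> \<open>The threshold \<open>\<epsilon> * \<epsilon>\<close> compensates the division
      by \<open>\<epsilon>\<close> in
      \<open>a * b \<le> a\<^sup>2 / \<epsilon> + \<epsilon> * b\<^sup>2\<close>.\<close>
    have "eventually (\<lambda>S::real. (\<integral>\<^sup>+ \<xi>. ennreal ((cmod (F \<xi> - \<Phi> S \<xi>))\<^sup>2) \<partial>lebesgue) < ennreal (\<epsilon> * \<epsilon>)) at_top"
      using lim \<epsilon> unfolding \<Phi>_def by (intro order_tendstoD) auto
    with eventually_ge_at_top[of R] have "eventually (\<lambda>S::real. S \<ge> R \<and>
        (\<integral>\<^sup>+ \<xi>. ennreal ((cmod (F \<xi> - \<Phi> S \<xi>))\<^sup>2) \<partial>lebesgue) < ennreal (\<epsilon> * \<epsilon>)) at_top"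
      by eventually_elim auto
    then obtain S where S: "S \<ge> R" "(\<integral>\<^sup>+ \<xi>. ennreal ((cmod (F \<xi> - \<Phi> S \<xi>))\<^sup>2) \<partial>lebesgue) < ennreal (\<epsilon> * \<epsilon>)"
      using eventually_happens'[OF trivial_limit_at_top_linorder] by blast
    then have S2: "(\<integral>\<^sup>+ \<xi>. ennreal ((cmod (F \<xi> - \<Phi> S \<xi>))\<^sup>2) \<partial>lborel) < ennreal (\<epsilon> * \<epsilon>)"
      by (simp add: nn_integral_completion)
    have D: "integrable lborel (\<lambda>\<xi>. (cmod (F \<xi> - \<Phi> S \<xi>))\<^sup>2)"
      using order.strict_trans[OF S2 ennreal_less_top] by (intro integrableI_bounded) auto
    have "ennreal (LINT \<xi>|lborel. (cmod (F \<xi> - \<Phi> S \<xi>))\<^sup>2) < ennreal (\<epsilon> * \<epsilon>)"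
      using S2 by (subst nn_integral_eq_integral[symmetric, OF D]) auto
    then have D2: "(LINT \<xi>|lborel. (cmod (F \<xi> - \<Phi> S \<xi>))\<^sup>2) < \<epsilon> * \<epsilon>"
      by (subst (asm) ennreal_less_iff) auto
    \<comment> \<open>\<open>parseval_L1\<close> asks for a square integrable transform of the
      truncation; it differs from \<open>F\<close> by a square integrable function.\<close>
    have \<Phi>L2: "integrable lborel (\<lambda>\<xi>. (cmod (\<Phi> S \<xi>))\<^sup>2)"
    proof (rule Bochner_Integration.integrable_bound)
      show "integrable lborel (\<lambda>\<xi>. 2 * (cmod (F \<xi> - \<Phi> S \<xi>))\<^sup>2 + 2 * (cmod (F \<xi>))\<^sup>2)"
        using D FL2 by simp
      show "AE \<xi> in lborel. norm ((cmod (\<Phi> S \<xi>))\<^sup>2) \<le> norm (2 * (cmod (F \<xi> - \<Phi> S \<xi>))\<^sup>2 + 2 * (cmod (F \<xi>))\<^sup>2)"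
      proof (rule AE_I2)
        fix \<xi>
        have "cmod (\<Phi> S \<xi>) \<le> cmod (F \<xi> - \<Phi> S \<xi>) + cmod (F \<xi>)"
          using norm_triangle_ineq4[of "F \<xi>" "F \<xi> - \<Phi> S \<xi>"] by simp
        then have "(cmod (\<Phi> S \<xi>))\<^sup>2 \<le> (cmod (F \<xi> - \<Phi> S \<xi>) + cmod (F \<xi>))\<^sup>2"
          by (intro power_mono) auto
        then show "norm ((cmod (\<Phi> S \<xi>))\<^sup>2) \<le> norm (2 * (cmod (F \<xi> - \<Phi> S \<xi>))\<^sup>2 + 2 * (cmod (F \<xi>))\<^sup>2)"
          using sum_squares_bound[of "cmod (F \<xi> - \<Phi> S \<xi>)" "cmod (F \<xi>)"]
          by (simp add: power2_sum)
      qed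
    qed measurable
    have fS: "integrable lborel (\<lambda>x. indicator (cball 0 S) x * f x)"
      using integrable_truncation[OF sf, of S] by (simp add: integrable_completion)
    have "(LINT \<xi>|lborel. \<Phi> S \<xi> * cnj (fourier_L1 w \<xi>)) = (2 * pi) ^ DIM('a) *
        (LINT x|lborel. indicator (cball 0 S) x * f x * cnj (w x))"
      using parseval_L1[OF fS w _ wL2] \<Phi>L2 by (simp add: \<Phi>_def)
    also have "(\<lambda>x. indicator (cball 0 S) x * f x * cnj (w x)) = (\<lambda>x. f x * cnj (w x))"
      using w(2) S(1) by (auto simp: indicator_def fun_eq_iff)
    finally have c: "?c = (LINT \<xi>|lborel. \<Phi> S \<xi> * cnj (fourier_L1 w \<xi>))" by simp
    have \<Phi>w: "integrable lborel (\<lambda>\<xi>. \<Phi> S \<xi> * cnj (fourier_L1 w \<xi>))"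
      using \<Phi>L2 wL2 by (intro square_integrable_mult) auto
    have "(LINT \<xi>|lborel. F \<xi> * cnj (fourier_L1 w \<xi>)) - ?c =
        (LINT \<xi>|lborel. (F \<xi> - \<Phi> S \<xi>) * cnj (fourier_L1 w \<xi>))"
      unfolding c left_diff_distrib by (rule Bochner_Integration.integral_diff[symmetric]) (fact Fw \<Phi>w)+
    also have "cmod \<dots> \<le> (LINT \<xi>|lborel. (cmod (F \<xi> - \<Phi> S \<xi>))\<^sup>2 / \<epsilon> + \<epsilon> * (cmod (fourier_L1 w \<xi>))\<^sup>2)"
    proof (rule Bochner_Integration.integral_norm_bound_integral)
      show "integrable lborel (\<lambda>\<xi>. (F \<xi> - \<Phi> S \<xi>) * cnj (fourier_L1 w \<xi>))"
        using D wL2 by (intro square_integrable_mult) auto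
      show "integrable lborel (\<lambda>\<xi>. (cmod (F \<xi> - \<Phi> S \<xi>))\<^sup>2 / \<epsilon> + \<epsilon> * (cmod (fourier_L1 w \<xi>))\<^sup>2)"
        using D wL2 by simp
      show "cmod ((F \<xi> - \<Phi> S \<xi>) * cnj (fourier_L1 w \<xi>)) \<le>
          (cmod (F \<xi> - \<Phi> S \<xi>))\<^sup>2 / \<epsilon> + \<epsilon> * (cmod (fourier_L1 w \<xi>))\<^sup>2" for \<xi>
      proof -
        have "a * b \<le> a\<^sup>2 / \<epsilon> + \<epsilon> * b\<^sup>2" if "a \<ge> 0" "b \<ge> 0" for a b :: real
        proof -
          have "0 \<le> a * b * \<epsilon>" using that \<epsilon> by simp
          moreover have "2 * (a * b * \<epsilon>) \<le> a\<^sup>2 + (\<epsilon> * b)\<^sup>2"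
            using sum_squares_bound[of a "\<epsilon> * b"] by (simp add: mult_ac)
          ultimately have "a * b * \<epsilon> \<le> a\<^sup>2 + (\<epsilon> * b)\<^sup>2" by linarith
          then show ?thesis using \<epsilon> by (simp add: field_simps power2_eq_square)
        qed
        then show ?thesis by (simp add: norm_mult)
      qed
    qed
    also have "\<dots> = (LINT \<xi>|lborel. (cmod (F \<xi> - \<Phi> S \<xi>))\<^sup>2) / \<epsilon> + \<epsilon> * ?W"
      using D wL2 by simp
    also have "\<dots> \<le> \<epsilon> + \<epsilon> * ?W"
      using D2 \<epsilon> by (simp add: field_simps)
    finally show ?thesis by (simp add: field_simps)
  qed
  have W: "?W \<ge> 0" by simp
  have "?d \<le> 0"
  proof (rule field_le_epsilon)
    fix e :: real assume "e > 0"
    moreover have "1 + ?W > 0" using W by linarith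
    ultimately have "?d \<le> e / (1 + ?W) * (1 + ?W)" by (intro est) simp
    also have "\<dots> = e" using \<open>1 + ?W > 0\<close> by simp
    finally show "?d \<le> 0 + e" by simp
  qed
  then show "(LINT \<xi>|lborel. F \<xi> * cnj (fourier_L1 w \<xi>)) = ?c" by simp
qed

section \<open>Sobolev regularity of the obstacle solution\<close>

lemma fourier_L1_shift:
  fixes f :: "'a::euclidean_space \<Rightarrow> complex"
  assumes [measurable]: "f \<in> borel_measurable borel"
  shows "fourier_L1 (\<lambda>x. f (h + x)) \<xi> = cis (h \<bullet> \<xi>) * fourier_L1 f \<xi>"
proof -
  have "fourier_L1 (\<lambda>x. f (h + x)) \<xi> = (LINT x|lborel. cis (- (x \<bullet> \<xi>)) * f (h + x))"
    by (rule fourier_L1_lborel) measurable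
  also have "\<dots> = (LINT x|lborel. cis (h \<bullet> \<xi>) * (cis (- ((h + 1 *\<^sub>R x) \<bullet> \<xi>)) * f (h + 1 *\<^sub>R x)))"
    by (simp add: mult.assoc[symmetric] cis_mult inner_add_left)
  also have "\<dots> = (LINT x|lborel. cis (h \<bullet> \<xi>) * (cis (- (x \<bullet> \<xi>)) * f x))"
    by (subst lborel_integral_affine[where f = "\<lambda>x. cis (h \<bullet> \<xi>) * (cis (- (x \<bullet> \<xi>)) * f x)"]) auto
  finally show ?thesis by (simp add: fourier_L1_lborel)
qed

text \<open>The half-angle identity writes the quotient as
  \<open>(sin z / z)\<^sup>2 * y\<^sup>2\<close> with \<open>z = \<tau> n * y / 2\<close>. The limit
  recovers the weight of a directional derivative from the multiplier of a second
  difference.\<close>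

lemma tendsto_second_difference_cos:
  fixes y :: real
  assumes \<tau>: "\<tau> \<longlonglongrightarrow> 0" "\<And>n. \<tau> n \<noteq> 0"
  shows "(\<lambda>n. (2 - 2 * cos (\<tau> n * y)) / (\<tau> n)\<^sup>2) \<longlonglongrightarrow> y\<^sup>2"
proof (cases "y = 0")
  case False
  have "(\<lambda>h. (sin (0 + h) - sin 0) / h) \<midarrow>0\<rightarrow> cos (0::real)"
    using DERIV_sin[of "0::real"] by (simp only: DERIV_def)
  then have "((\<lambda>h::real. sin h / h) \<longlongrightarrow> 1) (at 0)" by simp
  moreover have "filterlim (\<lambda>n. \<tau> n * y / 2) (at 0) sequentially"
    using False \<tau> by (intro filterlim_atI) (auto intro!: tendsto_eq_intros)
  ultimately have "(\<lambda>n. sin (\<tau> n * y / 2) / (\<tau> n * y / 2)) \<longlonglongrightarrow> 1"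
    by (rule filterlim_compose)
  then have "(\<lambda>n. (sin (\<tau> n * y / 2) / (\<tau> n * y / 2))\<^sup>2 * y\<^sup>2) \<longlonglongrightarrow> 1\<^sup>2 * y\<^sup>2"
    by (intro tendsto_intros)
  moreover have "(sin (\<tau> n * y / 2) / (\<tau> n * y / 2))\<^sup>2 * y\<^sup>2 = (2 - 2 * cos (\<tau> n * y)) / (\<tau> n)\<^sup>2" for n
  proof -
    have "cos (\<tau> n * y) = 1 - 2 * (sin (\<tau> n * y / 2))\<^sup>2"
      using cos_double_sin[of "\<tau> n * y / 2"] by simp
    then show ?thesis using False \<tau>(2)[of n] by (simp add: field_simps power2_eq_square)
  qed
  ultimately show ?thesis by simp
qed simp

text \<open>The obstacle problem in pointwise form: \<open>p\<close> is a Borel version that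
  satisfies the equation at every point of the ball, the Hoelder condition has become continuity of
  the gradient \<open>g\<close>, and the transform of \<open>v\<close> is the explicit integral
  \<open>fourier_L1\<close>. The radius \<open>r\<close> is a parameter of its own, which lets
  \<open>rescale\<close> produce an instance by multiplying it.\<close>

locale obstacle =
  fixes s \<beta> C r :: real and v p :: "'a::euclidean_space \<Rightarrow> real" and g :: "'a \<Rightarrow> 'a"
  assumes s: "0 < s" "s < 1" and \<beta>: "0 < \<beta>" and r: "0 < r"
    and deriv: "\<And>y. (v has_derivative (\<lambda>h. g y \<bullet> h)) (at y)"
    and g_cont: "continuous_on UNIV g"
    and v_nonneg: "\<And>y. 0 \<le> v y"
    and v_zero: "\<And>y. r \<le> norm y \<Longrightarrow> v y = 0"
    and p_meas [measurable]: "p \<in> borel_measurable borel"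
    and v_fourier: "is_fourier_L2 (\<lambda>x. complex_of_real (v x)) (fourier_L1 (\<lambda>x. complex_of_real (v x)))"
    and p_fourier: "is_fourier_L2 (\<lambda>x. complex_of_real (p x))
      (\<lambda>\<xi>. complex_of_real (norm \<xi> powr (2 * s)) * fourier_L1 (\<lambda>x. complex_of_real (v x)) \<xi>)"
    and p_eq: "\<And>y. norm y < r \<Longrightarrow> p y = C - \<beta> / 2 * (norm y)\<^sup>2"
    and p_ge: "AE y in lborel. C - \<beta> / 2 * (norm y)\<^sup>2 \<le> p y"
begin

definition V :: "'a \<Rightarrow> complex" where "V = fourier_L1 (\<lambda>x. complex_of_real (v x))"

lemma v_cont: "continuous_on A v"
  by (meson continuous_at_imp_continuous_on has_derivative_continuous deriv)

lemma v_meas [measurable]: "v \<in> borel_measurable borel"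
  by (rule borel_measurable_continuous_onI[OF v_cont])

lemma g_meas [measurable]: "g \<in> borel_measurable borel"
  by (rule borel_measurable_continuous_onI[OF g_cont])

lemma v_integrable: "integrable lborel v"
  by (rule integrable_continuous_compact[OF v_cont, of r]) (simp add: v_zero)

text \<open>Off the open ball \<open>v\<close> is zero and thus at its minimum, so the derivative
  vanishes. This includes the sphere \<open>norm y = r\<close>, which lies outside the reach of
  \<open>p_eq\<close>.\<close>

lemma g_zero:
  assumes "r \<le> norm y"
  shows "g y = 0"
proof -
  have "(\<lambda>h. g y \<bullet> h) = (\<lambda>h. 0)"
    by (rule differential_zero_maxmin[OF _ open_UNIV deriv]) (auto simp: v_zero[OF assms] v_nonneg)
  then have "g y \<bullet> g y = 0" by meson
  then show ?thesis by simp
qed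

lemma V_meas [measurable]: "V \<in> borel_measurable borel"
  unfolding V_def by (rule fourier_L1_measurable) (simp add: v_integrable)

lemma V_L2: "integrable lborel (\<lambda>\<xi>. (cmod (V \<xi>))\<^sup>2)"
  using v_fourier by (simp add: is_fourier_L2_def square_integrable_def integrable_completion flip: V_def)

lemma p_L2: "integrable lborel (\<lambda>x. (p x)\<^sup>2)"
  using p_fourier by (simp add: is_fourier_L2_def square_integrable_def integrable_completion)

text \<open>\<open>2 - 2 * cos (h \<bullet> \<xi>)\<close> is the Fourier multiplier of the
  symmetric second difference \<open>w\<close>, so \<open>E\<close> is the transform of
  \<open>p\<close> times the conjugate transform of \<open>w\<close>, and its integral is
  \<open>(2 * pi) ^ d\<close> times that of \<open>p * w\<close>.\<close>

lemma second_difference_energy: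
  fixes h :: 'a
  defines "E \<equiv> \<lambda>\<xi>. norm \<xi> powr (2 * s) * (2 - 2 * cos (h \<bullet> \<xi>)) * (cmod (V \<xi>))\<^sup>2"
  shows "integrable lborel E"
    and "(LINT \<xi>|lborel. E \<xi>) \<le> (2 * pi) ^ DIM('a) * (\<beta> * (norm h)\<^sup>2 * (LINT y|lborel. v y))"
proof -
  define w where "w x = 2 * v x - v (h + x) - v (- h + x)" for x
  define \<phi> where "\<phi> y = C - \<beta> / 2 * (norm y)\<^sup>2" for y :: 'a
  have v_cont': "continuous_on UNIV (\<lambda>x. v (k + x))" for k
    by (rule continuous_on_compose2[OF v_cont]) (auto intro: continuous_intros)
  have w_cont: "continuous_on UNIV w"
    unfolding w_def by (intro continuous_intros v_cont v_cont')
  have [measurable]: "w \<in> borel_measurable borel" by (rule borel_measurable_continuous_onI[OF w_cont])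
  have far: "r \<le> norm x" "r \<le> norm (h + x)" "r \<le> norm (- h + x)" if "norm x > r + norm h" for x
    using that norm_triangle_ineq4[of "h + x" h] norm_triangle_ineq[of "- h + x" h] norm_ge_zero[of h]
    by (auto simp del: norm_ge_zero)
  have w_zero: "w x = 0" if "norm x > r + norm h" for x
    using far[OF that] by (simp add: w_def v_zero)
  have vi: "integrable lborel (\<lambda>x. complex_of_real (v x))" using v_integrable by simp
  have vi': "integrable lborel (\<lambda>x. complex_of_real (v (k + x)))" for k
    using lborel_integrable_affine[OF _ vi, of 1 k] by simp
  have w_hat: "fourier_L1 (\<lambda>x. complex_of_real (w x)) \<xi> = complex_of_real (2 - 2 * cos (h \<bullet> \<xi>)) * V \<xi>" for \<xi>
  proof -
    have "fourier_L1 (\<lambda>x. complex_of_real (w x)) \<xi> =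
       (LINT x|lborel. 2 * (cis (- (x \<bullet> \<xi>)) * v x) - cis (- (x \<bullet> \<xi>)) * v (h + x) - cis (- (x \<bullet> \<xi>)) * v (- h + x))"
      by (subst fourier_L1_lborel) (auto simp: w_def algebra_simps)
    also have "\<dots> = 2 * (LINT x|lborel. cis (- (x \<bullet> \<xi>)) * v x) - (LINT x|lborel. cis (- (x \<bullet> \<xi>)) * v (h + x))
        - (LINT x|lborel. cis (- (x \<bullet> \<xi>)) * v (- h + x))"
      using integrable_cis_mult[OF vi, of \<xi>] integrable_cis_mult[OF vi'[of h], of \<xi>]
        integrable_cis_mult[OF vi'[of "- h"], of \<xi>] by simp
    also have "\<dots> = 2 * V \<xi> - cis (h \<bullet> \<xi>) * V \<xi> - cis (- h \<bullet> \<xi>) * V \<xi>"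
      using fourier_L1_shift[of "\<lambda>x. complex_of_real (v x)" h \<xi>]
        fourier_L1_shift[of "\<lambda>x. complex_of_real (v x)" "- h" \<xi>]
      by (simp add: V_def fourier_L1_lborel)
    also have "\<dots> = (2 - (cis (h \<bullet> \<xi>) + cis (- (h \<bullet> \<xi>)))) * V \<xi>"
      by (simp add: algebra_simps)
    also have "cis (h \<bullet> \<xi>) + cis (- (h \<bullet> \<xi>)) = 2 * cos (h \<bullet> \<xi>)"
      by (simp add: complex_eq_iff)
    finally show ?thesis by simp
  qed
  have w_L2: "integrable lborel (\<lambda>\<xi>. (cmod (fourier_L1 (\<lambda>x. complex_of_real (w x)) \<xi>))\<^sup>2)"
  proof (rule Bochner_Integration.integrable_bound)
    show "integrable lborel (\<lambda>\<xi>. 16 * (cmod (V \<xi>))\<^sup>2)" using V_L2 by simp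
    show "AE \<xi> in lborel. norm ((cmod (fourier_L1 (\<lambda>x. complex_of_real (w x)) \<xi>))\<^sup>2) \<le> norm (16 * (cmod (V \<xi>))\<^sup>2)"
    proof (rule AE_I2)
      fix \<xi>
      have "\<bar>2 - 2 * cos (h \<bullet> \<xi>)\<bar> \<le> 4"
        using abs_cos_le_one[of "h \<bullet> \<xi>"] by linarith
      then have "(2 - 2 * cos (h \<bullet> \<xi>))\<^sup>2 \<le> 4\<^sup>2"
        by (metis abs_le_square_iff abs_numeral)
      then show "norm ((cmod (fourier_L1 (\<lambda>x. complex_of_real (w x)) \<xi>))\<^sup>2) \<le> norm (16 * (cmod (V \<xi>))\<^sup>2)"
        unfolding w_hat norm_mult power_mult_distrib norm_of_real power2_abs
        by (intro mult_right_mono) auto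
    qed
  qed (simp add: w_hat)
  have E_eq: "complex_of_real (norm \<xi> powr (2 * s)) * V \<xi> * cnj (fourier_L1 (\<lambda>x. complex_of_real (w x)) \<xi>)
      = complex_of_real (E \<xi>)" for \<xi>
    unfolding E_def w_hat using complex_norm_square[of "V \<xi>"] by (simp add: mult_ac)
  have w_contc: "continuous_on UNIV (\<lambda>x. complex_of_real (w x))"
    using w_cont by (intro continuous_intros)
  have w_zeroc: "complex_of_real (w x) = 0" if "norm x > r + norm h" for x
    using w_zero[OF that] by simp
  have pF: "is_fourier_L2 (\<lambda>x. complex_of_real (p x)) (\<lambda>\<xi>. complex_of_real (norm \<xi> powr (2 * s)) * V \<xi>)"
    using p_fourier by (simp add: V_def)
  note pars = parseval_L2[OF pF _ _ w_contc w_zeroc w_L2, unfolded E_eq]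
  have "integrable lborel (\<lambda>\<xi>. complex_of_real (E \<xi>))"
    by (rule pars) measurable
  then show "integrable lborel E" by (simp only: complex_of_real_integrable_eq)
  have "(LINT \<xi>|lborel. complex_of_real (E \<xi>)) =
      (2 * pi) ^ DIM('a) * (LINT x|lborel. complex_of_real (p x) * cnj (complex_of_real (w x)))"
    by (rule pars) measurable
  also have "\<dots> = complex_of_real ((2 * pi) ^ DIM('a) * (LINT x|lborel. p x * w x))"
    by (simp flip: of_real_mult)
  finally have E_int: "(LINT \<xi>|lborel. E \<xi>) = (2 * pi) ^ DIM('a) * (LINT x|lborel. p x * w x)"
    unfolding integral_complex_of_real of_real_eq_iff .
  have cont_int: "integrable lborel f" if "continuous_on UNIV f" "\<And>x. norm x > r + norm h \<Longrightarrow> f x = 0"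
    for f :: "'a \<Rightarrow> real"
    using integrable_continuous_compact that by blast
  have "(LINT x|lborel. p x * w x) \<le> (LINT x|lborel. \<phi> x * w x)"
  proof (rule integral_mono_AE)
    show "integrable lborel (\<lambda>x. p x * w x)"
    proof (rule Bochner_Integration.integrable_bound)
      have "integrable lborel (\<lambda>x. (w x)\<^sup>2)"
        by (rule cont_int) (auto intro!: continuous_intros w_cont simp: w_zero)
      then show "integrable lborel (\<lambda>x. (p x)\<^sup>2 + (w x)\<^sup>2)" using p_L2 by simp
      show "AE x in lborel. norm (p x * w x) \<le> norm ((p x)\<^sup>2 + (w x)\<^sup>2)"
      proof (rule AE_I2)
        fix x
        have "2 * (\<bar>p x\<bar> * \<bar>w x\<bar>) \<le> (p x)\<^sup>2 + (w x)\<^sup>2"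
          using sum_squares_bound[of "\<bar>p x\<bar>" "\<bar>w x\<bar>"] by simp
        moreover have "0 \<le> \<bar>p x\<bar> * \<bar>w x\<bar>" by simp
        ultimately have "\<bar>p x\<bar> * \<bar>w x\<bar> \<le> (p x)\<^sup>2 + (w x)\<^sup>2" by linarith
        then show "norm (p x * w x) \<le> norm ((p x)\<^sup>2 + (w x)\<^sup>2)"
          by (simp add: abs_mult)
      qed
    qed measurable
    show "integrable lborel (\<lambda>x. \<phi> x * w x)"
      unfolding \<phi>_def by (rule cont_int) (auto intro!: continuous_intros w_cont simp: w_zero)
    show "AE x in lborel. p x * w x \<le> \<phi> x * w x"
      using p_ge
    proof eventually_elim
      case (elim x)
      show ?case
      proof (cases "norm x < r")
        case True
        then show ?thesis by (simp add: p_eq \<phi>_def)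
      next
        case False
        \<comment> \<open>Here \<open>v x = 0\<close>, so only the two negative terms of
          \<open>w x\<close> remain and multiplication by \<open>w x\<close> reverses the inequality
          between \<open>p\<close> and \<open>\<phi>\<close>.\<close>
        then have "w x \<le> 0" using v_nonneg[of "h + x"] v_nonneg[of "- h + x"] by (simp add: w_def v_zero)
        then show ?thesis using elim by (intro mult_right_mono_neg) (auto simp: \<phi>_def)
      qed
    qed
  qed
  \<comment> \<open>Translations move the second difference from \<open>v\<close> onto
    \<open>\<phi>\<close>; the compact support of \<open>v\<close> keeps every product integrable
    although \<open>\<phi>\<close> is unbounded.\<close>
  also have "\<dots> = \<beta> * (norm h)\<^sup>2 * (LINT y|lborel. v y)"
  proof -
    have \<phi>c: "continuous_on UNIV (\<lambda>x. \<phi> (k + x))" for k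
      unfolding \<phi>_def by (intro continuous_intros)
    have [measurable]: "\<phi> \<in> borel_measurable borel"
      unfolding \<phi>_def by measurable
    have i0: "integrable lborel (\<lambda>x. \<phi> x * v x)"
      using \<phi>c[of 0] by (intro cont_int continuous_intros v_cont) (auto simp: v_zero far)
    have i1: "integrable lborel (\<lambda>x. \<phi> x * v (h + x))" "integrable lborel (\<lambda>x. \<phi> x * v (- h + x))"
      using \<phi>c[of 0] far v_cont'[of h] v_cont'[of "- h"]
      by (auto intro!: cont_int continuous_intros simp: v_zero)
    have i2: "integrable lborel (\<lambda>x. \<phi> (- h + x) * v x)" "integrable lborel (\<lambda>x. \<phi> (h + x) * v x)"
      using far \<phi>c[of h] \<phi>c[of "- h"] by (auto intro!: cont_int continuous_intros v_cont simp: v_zero)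
    have s1: "(LINT x|lborel. \<phi> x * v (h + x)) = (LINT x|lborel. \<phi> (- h + x) * v x)"
      using lborel_integral_affine[of 1 "\<lambda>x. \<phi> (- h + x) * v x" h] by simp
    have s2: "(LINT x|lborel. \<phi> x * v (- h + x)) = (LINT x|lborel. \<phi> (h + x) * v x)"
      using lborel_integral_affine[of 1 "\<lambda>x. \<phi> (h + x) * v x" "- h"] by simp
    have "(LINT x|lborel. \<phi> x * w x) = 
        (LINT x|lborel. 2 * (\<phi> x * v x) - \<phi> x * v (h + x) - \<phi> x * v (- h + x))"
      by (simp add: w_def algebra_simps)
    also have "\<dots> = (LINT x|lborel. 2 * (\<phi> x * v x)) - (LINT x|lborel. \<phi> (- h + x) * v x) - (LINT x|lborel. \<phi> (h + x) * v x)"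
      using i0 i1 s1 s2 by simp
    also have "\<dots> = (LINT x|lborel. 2 * (\<phi> x * v x) - \<phi> (- h + x) * v x - \<phi> (h + x) * v x)"
      using i0 i2 by simp
    also have "(\<lambda>x. 2 * (\<phi> x * v x) - \<phi> (- h + x) * v x - \<phi> (h + x) * v x) = (\<lambda>x. \<beta> * (norm h)\<^sup>2 * v x)"
    proof
      fix x
      \<comment> \<open>The terms linear in \<open>h\<close> cancel, and each of the two shifts
        contributes \<open>\<beta> / 2 * (norm h)\<^sup>2\<close>.\<close>
      have "2 * \<phi> x - \<phi> (- h + x) - \<phi> (h + x) = \<beta> * (norm h)\<^sup>2"
        unfolding \<phi>_def power2_norm_eq_inner by (simp add: inner_simps inner_commute algebra_simps)
      then show "2 * (\<phi> x * v x) - \<phi> (- h + x) * v x - \<phi> (h + x) * v x = \<beta> * (norm h)\<^sup>2 * v x"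
        by (simp only: left_diff_distrib[symmetric] mult.assoc[symmetric])
    qed
    finally show ?thesis by simp
  qed
  finally show "(LINT \<xi>|lborel. E \<xi>) \<le> (2 * pi) ^ DIM('a) * (\<beta> * (norm h)\<^sup>2 * (LINT y|lborel. v y))"
    unfolding E_int by (intro mult_left_mono) auto
qed

text \<open>Along \<open>h = \<tau> n *\<^sub>R b\<close> the bound of
  \<open>second_difference_energy\<close> is proportional to \<open>(\<tau> n)\<^sup>2\<close>, so
  the quotients have integrals below one constant \<open>?K\<close>, which survives in the limit.
  Summing over \<open>Basis\<close> assembles the full \<open>(norm \<xi>)\<^sup>2\<close>.\<close>

lemma V_gradient_energy:
  "integrable lborel (\<lambda>\<xi>. norm \<xi> powr (2 * s) * (norm \<xi>)\<^sup>2 * (cmod (V \<xi>))\<^sup>2)"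
proof -
  let ?f = "\<lambda>b \<xi>. norm \<xi> powr (2 * s) * (b \<bullet> \<xi>)\<^sup>2 * (cmod (V \<xi>))\<^sup>2"
  have 1: "integrable lborel (?f b)" if b: "b \<in> Basis" for b
  proof -
    define \<tau> where "\<tau> n = 1 / real (Suc n)" for n
    have \<tau>: "\<tau> n > 0" for n by (simp add: \<tau>_def)
    have \<tau>0: "\<tau> \<longlonglongrightarrow> 0"
      unfolding \<tau>_def using LIMSEQ_inverse_real_of_nat by (simp add: inverse_eq_divide)
    let ?K = "(2 * pi) ^ DIM('a) * (\<beta> * (LINT y|lborel. v y))"
    let ?E = "\<lambda>n \<xi>. norm \<xi> powr (2 * s) * (2 - 2 * cos ((\<tau> n *\<^sub>R b) \<bullet> \<xi>)) * (cmod (V \<xi>))\<^sup>2"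
    have E_nonneg: "0 \<le> ?E n \<xi>" for n \<xi>
      using cos_le_one[of "(\<tau> n *\<^sub>R b) \<bullet> \<xi>"] by (intro mult_nonneg_nonneg) auto
    have le: "(\<integral>\<^sup>+ \<xi>. ennreal (?E n \<xi> / (\<tau> n)\<^sup>2) \<partial>lborel) \<le> ennreal ?K" for n
    proof -
      note sd = second_difference_energy[of "\<tau> n *\<^sub>R b"]
      have "(\<integral>\<^sup>+ \<xi>. ennreal (?E n \<xi> / (\<tau> n)\<^sup>2) \<partial>lborel) = ennreal (LINT \<xi>|lborel. ?E n \<xi> / (\<tau> n)\<^sup>2)"
        using sd(1) E_nonneg by (intro nn_integral_eq_integral AE_I2) auto
      also have "(LINT \<xi>|lborel. ?E n \<xi> / (\<tau> n)\<^sup>2) = (LINT \<xi>|lborel. ?E n \<xi>) / (\<tau> n)\<^sup>2" by simp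
      also have "\<dots> \<le> (2 * pi) ^ DIM('a) * (\<beta> * (norm (\<tau> n *\<^sub>R b))\<^sup>2 * (LINT y|lborel. v y)) / (\<tau> n)\<^sup>2"
        using sd(2) by (rule divide_right_mono) simp
      also have "\<dots> = ?K" using \<tau>[of n] b by (simp add: field_simps)
      finally show ?thesis by (simp add: ennreal_leI)
    qed
    have lim: "(\<lambda>n. ennreal (?E n \<xi> / (\<tau> n)\<^sup>2)) \<longlonglongrightarrow> ennreal (?f b \<xi>)" for \<xi>
    proof -
      have "(\<lambda>n. norm \<xi> powr (2 * s) * ((2 - 2 * cos (\<tau> n * (b \<bullet> \<xi>))) / (\<tau> n)\<^sup>2) * (cmod (V \<xi>))\<^sup>2) \<longlonglongrightarrow> ?f b \<xi>"
        using \<tau> by (intro tendsto_intros tendsto_second_difference_cos \<tau>0) (simp add: less_imp_neq[symmetric])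
      then show ?thesis by (intro tendsto_ennrealI) (simp add: mult_ac)
    qed
    have "(\<integral>\<^sup>+ \<xi>. ennreal (?f b \<xi>) \<partial>lborel) = (\<integral>\<^sup>+ \<xi>. liminf (\<lambda>n. ennreal (?E n \<xi> / (\<tau> n)\<^sup>2)) \<partial>lborel)"
      by (intro nn_integral_cong lim_imp_Liminf[symmetric] lim) simp
    also have "\<dots> \<le> liminf (\<lambda>n. \<integral>\<^sup>+ \<xi>. ennreal (?E n \<xi> / (\<tau> n)\<^sup>2) \<partial>lborel)"
      by (rule nn_integral_liminf) measurable
    also have "\<dots> \<le> liminf (\<lambda>n. ennreal ?K)"
      by (intro Liminf_mono always_eventually allI le)
    also have "\<dots> < \<infinity>" by (simp add: Liminf_const)
    finally show ?thesis
      by (intro integrableI_bounded) auto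
  qed
  have "(norm \<xi>)\<^sup>2 = (\<Sum>b\<in>Basis. (b \<bullet> \<xi>)\<^sup>2)" for \<xi> :: 'a
    by (metis (no_types, lifting) euclidean_inner inner_commute power2_eq_square power2_norm_eq_inner sum.cong)
  then have "(\<lambda>\<xi>. norm \<xi> powr (2 * s) * (norm \<xi>)\<^sup>2 * (cmod (V \<xi>))\<^sup>2) = (\<lambda>\<xi>. \<Sum>b\<in>Basis. ?f b \<xi>)"
    by (simp add: sum_distrib_left sum_distrib_right)
  then show ?thesis using 1 by simp
qed

text \<open>For \<open>q = 1 + s\<close> the weight is at most \<open>2 powr (1 + s)\<close> in the
  unit ball and at most \<open>(2 * (norm \<xi>)\<^sup>2) powr (1 + s)\<close> outside it;
  \<open>V_L2\<close> controls the one and \<open>V_gradient_energy\<close> the other. Smaller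
  \<open>q\<close> follow because the base is at least 1.\<close>

lemma V_sobolev:
  assumes "q \<le> 1 + s"
  shows "integrable lborel (\<lambda>\<xi>. (1 + (norm \<xi>)\<^sup>2) powr q * (cmod (V \<xi>))\<^sup>2)"
proof (rule Bochner_Integration.integrable_bound)
  let ?c = "2 powr (1 + s)"
  show "integrable lborel (\<lambda>\<xi>. ?c * ((cmod (V \<xi>))\<^sup>2 + norm \<xi> powr (2 * s) * (norm \<xi>)\<^sup>2 * (cmod (V \<xi>))\<^sup>2))"
    using V_L2 V_gradient_energy by simp
  show "AE \<xi> in lborel. norm ((1 + (norm \<xi>)\<^sup>2) powr q * (cmod (V \<xi>))\<^sup>2) \<le>
     norm (?c * ((cmod (V \<xi>))\<^sup>2 + norm \<xi> powr (2 * s) * (norm \<xi>)\<^sup>2 * (cmod (V \<xi>))\<^sup>2))"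
  proof (rule AE_I2)
    fix \<xi> :: 'a
    have "(1 + (norm \<xi>)\<^sup>2) powr q \<le> (1 + (norm \<xi>)\<^sup>2) powr (1 + s)"
      using assms by (intro powr_mono) auto
    also have "\<dots> \<le> ?c * (1 + norm \<xi> powr (2 * s) * (norm \<xi>)\<^sup>2)"
    proof (cases "norm \<xi> \<le> 1")
      case True
      then have "(norm \<xi>)\<^sup>2 \<le> 1" by (simp add: abs_square_le_1)
      then have "(1 + (norm \<xi>)\<^sup>2) powr (1 + s) \<le> ?c"
        using s by (intro powr_mono2) auto
      also have "\<dots> \<le> ?c * (1 + norm \<xi> powr (2 * s) * (norm \<xi>)\<^sup>2)"
        by (simp add: algebra_simps)
      finally show ?thesis .
    next
      case False
      then have "1 \<le> (norm \<xi>)\<^sup>2" by (simp add: one_le_power)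
      then have "(1 + (norm \<xi>)\<^sup>2) powr (1 + s) \<le> (2 * (norm \<xi>)\<^sup>2) powr (1 + s)"
        using s by (intro powr_mono2) auto
      also have "\<dots> = ?c * ((norm \<xi>)\<^sup>2) powr (1 + s)"
        by (simp add: powr_mult)
      also have "((norm \<xi>)\<^sup>2) powr (1 + s) = norm \<xi> powr (2 * s) * (norm \<xi>)\<^sup>2"
        using False by (simp add: powr_add powr_powr flip: powr_numeral)
      also have "?c * \<dots> \<le> ?c * (1 + norm \<xi> powr (2 * s) * (norm \<xi>)\<^sup>2)"
        by (intro mult_left_mono) auto
      finally show ?thesis .
    qed
    finally have "(1 + (norm \<xi>)\<^sup>2) powr q * (cmod (V \<xi>))\<^sup>2 \<le>
       ?c * (1 + norm \<xi> powr (2 * s) * (norm \<xi>)\<^sup>2) * (cmod (V \<xi>))\<^sup>2"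
      by (intro mult_right_mono) auto
    then show "norm ((1 + (norm \<xi>)\<^sup>2) powr q * (cmod (V \<xi>))\<^sup>2) \<le>
     norm (?c * ((cmod (V \<xi>))\<^sup>2 + norm \<xi> powr (2 * s) * (norm \<xi>)\<^sup>2 * (cmod (V \<xi>))\<^sup>2))"
      by (simp add: algebra_simps)
  qed
qed measurable

text \<open>The squared multiplier is at most
  \<open>(1 + (norm \<xi>)\<^sup>2) powr (2 * s)\<close>, and the exponents add up as
  \<open>(1 - s) + 2 * s = 1 + s\<close>.\<close>

lemma p_sobolev:
  "integrable lborel (\<lambda>\<xi>. (1 + (norm \<xi>)\<^sup>2) powr (1 - s) *
     (cmod (complex_of_real (norm \<xi> powr (2 * s)) * V \<xi>))\<^sup>2)"
proof (rule Bochner_Integration.integrable_bound[OF V_sobolev[of "1 + s"]])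
  show "AE \<xi> in lborel. norm ((1 + (norm \<xi>)\<^sup>2) powr (1 - s) *
     (cmod (complex_of_real (norm \<xi> powr (2 * s)) * V \<xi>))\<^sup>2) \<le> norm ((1 + (norm \<xi>)\<^sup>2) powr (1 + s) * (cmod (V \<xi>))\<^sup>2)"
  proof (rule AE_I2)
    fix \<xi> :: 'a
    have "(norm \<xi> powr (2 * s))\<^sup>2 = ((norm \<xi>)\<^sup>2) powr (2 * s)"
      by (cases "\<xi> = 0") (auto simp: powr_powr mult_ac simp flip: powr_numeral)
    also have "\<dots> \<le> (1 + (norm \<xi>)\<^sup>2) powr (2 * s)"
      using s by (intro powr_mono2) auto
    finally have "(1 + (norm \<xi>)\<^sup>2) powr (1 - s) * (norm \<xi> powr (2 * s))\<^sup>2 \<le>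
        (1 + (norm \<xi>)\<^sup>2) powr (1 - s) * (1 + (norm \<xi>)\<^sup>2) powr (2 * s)"
      by (intro mult_left_mono) auto
    also have "\<dots> = (1 + (norm \<xi>)\<^sup>2) powr (1 + s)"
      by (simp add: add.commute flip: powr_add)
    finally have "(1 + (norm \<xi>)\<^sup>2) powr (1 - s) * (norm \<xi> powr (2 * s))\<^sup>2 * (cmod (V \<xi>))\<^sup>2 \<le>
       (1 + (norm \<xi>)\<^sup>2) powr (1 + s) * (cmod (V \<xi>))\<^sup>2"
      by (intro mult_right_mono) auto
    then show "norm ((1 + (norm \<xi>)\<^sup>2) powr (1 - s) *
     (cmod (complex_of_real (norm \<xi> powr (2 * s)) * V \<xi>))\<^sup>2) \<le> norm ((1 + (norm \<xi>)\<^sup>2) powr (1 + s) * (cmod (V \<xi>))\<^sup>2)"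
      by (simp add: norm_mult power_mult_distrib mult_ac)
  qed
qed (simp, measurable)

end

section \<open>Self-similar functions in Bochner spaces\<close>

text \<open>By \<open>is_fourier_L2_unique\<close> the representative behind \<open>SOME\<close>
  agrees almost everywhere with \<open>F\<close>.\<close>

lemma sobolev_norm_eq:
  assumes F: "is_fourier_L2 (\<lambda>x. complex_of_real (f x)) F"
  shows "sobolev_norm q f = sqrt (LINT \<xi>|lebesgue. (1 + (norm \<xi>)\<^sup>2) powr q * (cmod (F \<xi>))\<^sup>2)"
proof -
  define F' where "F' = (SOME F. is_fourier_L2 (\<lambda>x. complex_of_real (f x)) F)"
  have F': "is_fourier_L2 (\<lambda>x. complex_of_real (f x)) F'"
    unfolding F'_def by (rule someI[of "is_fourier_L2 (\<lambda>x. complex_of_real (f x))", OF F])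
  have [measurable]: "F \<in> borel_measurable lebesgue" "F' \<in> borel_measurable lebesgue"
    using F F' by (auto simp: is_fourier_L2_def square_integrable_def)
  have [measurable]: "(\<lambda>\<xi>::'a. (1 + (norm \<xi>)\<^sup>2) powr q) \<in> borel_measurable lebesgue"
    by (rule measurable_borel_lebesgue) measurable
  have "(LINT \<xi>|lebesgue. (1 + (norm \<xi>)\<^sup>2) powr q * (cmod (F' \<xi>))\<^sup>2) =
      (LINT \<xi>|lebesgue. (1 + (norm \<xi>)\<^sup>2) powr q * (cmod (F \<xi>))\<^sup>2)"
    by (rule integral_cong_AE) (use is_fourier_L2_unique[OF F' F] in auto)
  then show ?thesis by (simp add: sobolev_norm_def F'_def[symmetric])
qed

lemma is_fourier_L2_self_similar:
  fixes f :: "'a::euclidean_space \<Rightarrow> real"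
  assumes F: "is_fourier_L2 (\<lambda>x. complex_of_real (f x)) F" and t: "t > -1"
  shows "is_fourier_L2 (\<lambda>x. complex_of_real (self_similar \<kappa> \<beta> f x t))
    (\<lambda>\<xi>. complex_of_real ((1 + t) powr (\<beta> * DIM('a) - \<kappa>)) * F ((1 + t) powr \<beta> *\<^sub>R \<xi>))"
proof -
  have "1 / (1 + t) powr \<kappa> * ((1 + t) powr \<beta>) ^ DIM('a) = (1 + t) powr (\<beta> * DIM('a) - \<kappa>)"
    using t by (simp add: powr_power powr_diff mult.commute)
  then show ?thesis
    using is_fourier_L2_scale[OF F, of "(1 + t) powr \<beta>" "1 / (1 + t) powr \<kappa>"] t
    by (simp add: self_similar_def)
qed

text \<open>The multiplier at the dilated frequency contributes an extra
  \<open>(1 + t) powr (2 * s * \<beta>)\<close>, which the larger amplitude exponent of the second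
  function absorbs.\<close>

lemma is_frac_laplacian_self_similar:
  fixes f h :: "'a::euclidean_space \<Rightarrow> real"
  assumes "is_frac_laplacian s f h" and t: "t > -1"
  shows "is_frac_laplacian s (\<lambda>x. self_similar \<kappa> \<beta> f x t) (\<lambda>x. self_similar (\<kappa> + 2 * s * \<beta>) \<beta> h x t)"
proof -
  obtain F where F: "is_fourier_L2 (\<lambda>x. complex_of_real (f x)) F"
    and H: "is_fourier_L2 (\<lambda>x. complex_of_real (h x)) (\<lambda>\<xi>. complex_of_real (norm \<xi> powr (2 * s)) * F \<xi>)"
    using assms(1) by (auto simp: is_frac_laplacian_def)
  let ?a = "(1 + t) powr \<beta>"
  have "(1 + t) powr (\<beta> * DIM('a) - (\<kappa> + 2 * s * \<beta>)) * norm (?a *\<^sub>R \<xi>) powr (2 * s) =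
      norm \<xi> powr (2 * s) * (1 + t) powr (\<beta> * DIM('a) - \<kappa>)" for \<xi> :: 'a
  proof -
    have "norm (?a *\<^sub>R \<xi>) powr (2 * s) = (1 + t) powr (2 * s * \<beta>) * norm \<xi> powr (2 * s)"
      by (simp add: powr_mult powr_powr mult_ac)
    moreover have "(1 + t) powr (\<beta> * DIM('a) - (\<kappa> + 2 * s * \<beta>)) * (1 + t) powr (2 * s * \<beta>) = (1 + t) powr (\<beta> * DIM('a) - \<kappa>)"
      using t by (simp flip: powr_add)
    ultimately show ?thesis by (simp add: mult_ac)
  qed
  then have "complex_of_real ((1 + t) powr (\<beta> * DIM('a) - (\<kappa> + 2 * s * \<beta>))) *
        (complex_of_real (norm (?a *\<^sub>R \<xi>) powr (2 * s)) * F (?a *\<^sub>R \<xi>)) =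
      complex_of_real (norm \<xi> powr (2 * s)) * (complex_of_real ((1 + t) powr (\<beta> * DIM('a) - \<kappa>)) * F (?a *\<^sub>R \<xi>))" for \<xi>
    by (simp only: of_real_mult[symmetric] mult.assoc[symmetric])
  then show ?thesis
    unfolding is_frac_laplacian_def
    using is_fourier_L2_self_similar[OF F t, of \<kappa> \<beta>] is_fourier_L2_self_similar[OF H t, of "\<kappa> + 2 * s * \<beta>" \<beta>]
    by (intro exI conjI) (assumption, simp only:)
qed

text \<open>The exponent is \<open>2 * (\<beta> * d - \<kappa>)\<close> from the squared transform
  minus \<open>\<beta> * d\<close> from the substitution in frequency.\<close>

lemma sobolev_norm_self_similar:
  fixes f :: "'a::euclidean_space \<Rightarrow> real"
  assumes F: "is_fourier_L2 (\<lambda>x. complex_of_real (f x)) F" and [measurable]: "F \<in> borel_measurable borel"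
    and t: "t > -1"
  shows "(sobolev_norm q (\<lambda>x. self_similar \<kappa> \<beta> f x t))\<^sup>2 = (1 + t) powr (\<beta> * DIM('a) - 2 * \<kappa>) *
    (LINT \<xi>|lborel. (1 + (norm (\<xi> /\<^sub>R (1 + t) powr \<beta>))\<^sup>2) powr q * (cmod (F \<xi>))\<^sup>2)"
proof -
  let ?a = "(1 + t) powr \<beta>" and ?k = "(1 + t) powr (\<beta> * DIM('a) - \<kappa>)"
  let ?h = "\<lambda>\<xi>. ?k\<^sup>2 * ((1 + (norm (\<xi> /\<^sub>R ?a))\<^sup>2) powr q * (cmod (F \<xi>))\<^sup>2)"
  have a: "?a > 0" using t by simp
  have "(sobolev_norm q (\<lambda>x. self_similar \<kappa> \<beta> f x t))\<^sup>2 =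
      (LINT \<xi>|lebesgue. (1 + (norm \<xi>)\<^sup>2) powr q * (cmod (complex_of_real ?k * F (?a *\<^sub>R \<xi>)))\<^sup>2)"
    unfolding sobolev_norm_eq[OF is_fourier_L2_self_similar[OF F t]]
    by (rule real_sqrt_pow2) simp
  also have "\<dots> = (LINT \<xi>|lborel. (1 + (norm \<xi>)\<^sup>2) powr q * (cmod (complex_of_real ?k * F (?a *\<^sub>R \<xi>)))\<^sup>2)"
    by (rule integral_completion) measurable
  also have "\<dots> = (LINT \<xi>|lborel. ?h (0 + ?a *\<^sub>R \<xi>))"
    using a by (intro Bochner_Integration.integral_cong refl) (simp add: norm_mult power_mult_distrib)
  also have "\<dots> = (1 / \<bar>?a\<bar> ^ DIM('a)) *\<^sub>R (LINT \<xi>|lborel. ?h \<xi>)"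
    by (rule lborel_integral_affine) (use t in auto)
  also have "\<dots> = (?k\<^sup>2 / ?a ^ DIM('a)) * (LINT \<xi>|lborel. (1 + (norm (\<xi> /\<^sub>R ?a))\<^sup>2) powr q * (cmod (F \<xi>))\<^sup>2)"
    using t by simp
  also have "?k\<^sup>2 / ?a ^ DIM('a) = (1 + t) powr (\<beta> * DIM('a) - 2 * \<kappa>)"
    using t by (simp add: powr_power flip: powr_diff)
  finally show ?thesis .
qed

lemma measurable_space_time_borel:
  fixes u :: "'a::euclidean_space \<Rightarrow> real \<Rightarrow> 'b::euclidean_space"
  assumes "(\<lambda>z. u (fst z) (snd z)) \<in> borel_measurable borel"
  shows "measurable_space_time u"
  unfolding measurable_space_time_def
  using assms by (intro measurable_restrict_space1 measurable_borel_lebesgue)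

lemma borel_measurable_fst_snd [measurable]:
  "(fst :: 'a::euclidean_space \<times> real \<Rightarrow> 'a) \<in> borel_measurable borel"
  "(snd :: 'a::euclidean_space \<times> real \<Rightarrow> real) \<in> borel_measurable borel"
  by (auto intro!: borel_measurable_continuous_onI continuous_intros)

lemma measurable_space_time_scaled:
  fixes f :: "'a::euclidean_space \<Rightarrow> 'b::euclidean_space"
  assumes [measurable]: "f \<in> borel_measurable borel"
  shows "measurable_space_time (\<lambda>x t. (1 / (1 + t) powr \<kappa>) *\<^sub>R f (x /\<^sub>R (1 + t) powr \<beta>))"
  by (rule measurable_space_time_borel) measurable

text \<open>For \<open>t > 0\<close> frequencies are divided by
  \<open>(1 + t) powr \<beta> \<ge> 1\<close>, which lowers the Sobolev weight, and
  \<open>\<beta> * d \<le> 2 * \<kappa>\<close> keeps the prefactor at most 1. So the norm never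
  exceeds its value at time 0, and such a bound is square integrable on bounded time
  intervals.\<close>

lemma self_similar_sobolev:
  fixes \<kappa> \<beta> q :: real and f :: "'a::euclidean_space \<Rightarrow> real"
  assumes F: "is_fourier_L2 (\<lambda>x. complex_of_real (f x)) F"
    and [measurable]: "f \<in> borel_measurable borel" "F \<in> borel_measurable borel"
    and I: "integrable lborel (\<lambda>\<xi>. (1 + (norm \<xi>)\<^sup>2) powr q * (cmod (F \<xi>))\<^sup>2)"
    and q: "0 \<le> q" and \<beta>: "0 \<le> \<beta>" "\<beta> * DIM('a) \<le> 2 * \<kappa>"
  shows "Linf_sobolev q (self_similar \<kappa> \<beta> f)" and "L2loc_sobolev q (self_similar \<kappa> \<beta> f)"
proof -
  let ?K = "LINT \<xi>|lborel. (1 + (norm \<xi>)\<^sup>2) powr q * (cmod (F \<xi>))\<^sup>2"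
  have a: "(1 + t) powr \<beta> \<ge> 1" if "t > 0" for t
    using that \<beta> by (intro ge_one_powr_ge_zero) auto
  have le: "(1 + (norm (\<xi> /\<^sub>R (1 + t) powr \<beta>))\<^sup>2) powr q \<le> (1 + (norm \<xi>)\<^sup>2) powr q" if "t > 0" for \<xi> :: 'a and t
  proof -
    have "norm (\<xi> /\<^sub>R (1 + t) powr \<beta>) \<le> norm \<xi>"
      using a[OF that] by (simp add: divide_le_eq mult_le_cancel_left1 inverse_eq_divide)
    then show ?thesis
      using q by (intro powr_mono2 add_left_mono power_mono) (auto simp del: norm_scaleR)
  qed
  have Il: "integrable lborel (\<lambda>\<xi>. (1 + (norm (\<xi> /\<^sub>R (1 + t) powr \<beta>))\<^sup>2) powr q * (cmod (F \<xi>))\<^sup>2)" if "t > 0" for t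
    by (rule Bochner_Integration.integrable_bound[OF I])
      (use le[OF that] in \<open>auto intro!: mult_right_mono AE_I2 simp del: norm_scaleR\<close>)
  have mem: "in_sobolev q (\<lambda>x. self_similar \<kappa> \<beta> f x t)" if t: "t > 0" for t
    unfolding in_sobolev_def
  proof (intro exI conjI)
    let ?a = "(1 + t) powr \<beta>" and ?k = "(1 + t) powr (\<beta> * DIM('a) - \<kappa>)"
    show "is_fourier_L2 (\<lambda>x. complex_of_real (self_similar \<kappa> \<beta> f x t))
      (\<lambda>\<xi>. complex_of_real ?k * F (?a *\<^sub>R \<xi>))"
      by (rule is_fourier_L2_self_similar[OF F]) (use t in simp)
    have "integrable lborel (\<lambda>\<xi>. ?k\<^sup>2 * ((1 + (norm ((0 + ?a *\<^sub>R \<xi>) /\<^sub>R ?a))\<^sup>2) powr q * (cmod (F (0 + ?a *\<^sub>R \<xi>)))\<^sup>2))"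
      using t by (intro integrable_mult_right lborel_integrable_affine[OF _ Il[OF t]]) simp
    then have "integrable lborel (\<lambda>\<xi>. (1 + (norm \<xi>)\<^sup>2) powr q * (cmod (complex_of_real ?k * F (?a *\<^sub>R \<xi>)))\<^sup>2)"
      using t by (simp add: norm_mult power_mult_distrib mult_ac)
    then show "integrable lebesgue (\<lambda>\<xi>. (1 + (norm \<xi>)\<^sup>2) powr q * (cmod (complex_of_real ?k * F (?a *\<^sub>R \<xi>)))\<^sup>2)"
      by (subst integrable_completion) measurable
  qed
  \<comment> \<open>An explicit formula for the squared norm. Since \<open>sobolev_norm\<close> is
    defined by a choice, measurability in \<open>t\<close> is read off from
    \<open>N\<close>.\<close>
  define N where "N t = (1 + t) powr (\<beta> * DIM('a) - 2 * \<kappa>) *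
    (LINT \<xi>|lborel. (1 + (norm (\<xi> /\<^sub>R (1 + t) powr \<beta>))\<^sup>2) powr q * (cmod (F \<xi>))\<^sup>2)" for t
  have N_eq: "(sobolev_norm q (\<lambda>x. self_similar \<kappa> \<beta> f x t))\<^sup>2 = N t" if "t > 0" for t
    unfolding N_def by (rule sobolev_norm_self_similar[OF F]) (use that in auto)
  have N_nonneg: "0 \<le> N t" for t
    unfolding N_def by (intro mult_nonneg_nonneg integral_nonneg_AE) auto
  have N_le: "N t \<le> ?K" if t: "t > 0" for t
  proof -
    have "(1 + t) powr (\<beta> * DIM('a) - 2 * \<kappa>) \<le> (1 + t) powr 0"
      using t \<beta> by (intro powr_mono) auto
    then have "(1 + t) powr (\<beta> * DIM('a) - 2 * \<kappa>) \<le> 1" using t by simp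
    then have "N t \<le> 1 * (LINT \<xi>|lborel. (1 + (norm (\<xi> /\<^sub>R (1 + t) powr \<beta>))\<^sup>2) powr q * (cmod (F \<xi>))\<^sup>2)"
      unfolding N_def by (intro mult_right_mono integral_nonneg_AE) auto
    also have "\<dots> \<le> ?K"
      unfolding mult_1 by (intro integral_mono Il I t mult_right_mono le) auto
    finally show ?thesis .
  qed
  have N_meas: "N \<in> borel_measurable borel"
    unfolding N_def by measurable
  have meas: "measurable_space_time (self_similar \<kappa> \<beta> f)"
    using measurable_space_time_scaled[of f \<kappa> \<beta>] by (simp add: self_similar_def[abs_def])
  have "sobolev_norm q (\<lambda>x. self_similar \<kappa> \<beta> f x t) \<le> sqrt ?K" if "t > 0" for t
    using N_le[OF that] N_eq[OF that] real_le_rsqrt by simp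
  then show "Linf_sobolev q (self_similar \<kappa> \<beta> f)"
    unfolding Linf_sobolev_def using meas mem
    by (intro conjI exI[of _ "sqrt ?K"] AE_I2) (auto simp: space_restrict_space)
  have "set_integrable lebesgue {0<..<T} (\<lambda>t. (sobolev_norm q (\<lambda>x. self_similar \<kappa> \<beta> f x t))\<^sup>2)" for T :: real
  proof -
    have "integrable lborel (\<lambda>t. indicator {0<..<T} t * N t)"
    proof (rule Bochner_Integration.integrable_bound)
      show "integrable lborel (\<lambda>t. indicator {0<..<T} t * ?K)"
        by (cases "0 \<le> T") (auto intro!: integrable_mult_left integrable_real_indicator)
      show "AE t in lborel. norm (indicator {0<..<T} t * N t) \<le> norm (indicator {0<..<T} t * ?K)"
        using N_le N_nonneg by (auto simp: indicator_def intro!: order_trans[OF N_le abs_ge_self])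
    qed (use N_meas in measurable)
    then have "integrable lebesgue (\<lambda>t. indicator {0<..<T} t * N t)"
      using N_meas by (subst integrable_completion) auto
    also have "(\<lambda>t. indicator {0<..<T} t * N t) =
        (\<lambda>t. indicator {0<..<T} t *\<^sub>R (sobolev_norm q (\<lambda>x. self_similar \<kappa> \<beta> f x t))\<^sup>2)"
      using N_eq by (auto simp: indicator_def)
    finally show ?thesis by (simp add: set_integrable_def)
  qed
  then show "L2loc_sobolev q (self_similar \<kappa> \<beta> f)"
    unfolding L2loc_sobolev_def using meas mem
    by (intro conjI AE_I2) (auto simp: space_restrict_space)
qed

section \<open>Test functions and integration by parts\<close>

lemma test_function_differentiable:
  "test_function \<phi> \<Longrightarrow> iter_dir_deriv hs \<phi> differentiable (at z)"
  by (simp add: test_function_def smooth_def)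

lemma test_function_has_derivative:
  "test_function \<phi> \<Longrightarrow> (iter_dir_deriv hs \<phi> has_derivative (\<lambda>h. iter_dir_deriv (h # hs) \<phi> z)) (at z)"
  using test_function_differentiable[of \<phi> hs z] by (simp add: frechet_derivative_works[symmetric])

lemma test_function_continuous:
  "test_function \<phi> \<Longrightarrow> continuous_on A (iter_dir_deriv hs \<phi>)"
  by (meson continuous_at_imp_continuous_on differentiable_imp_continuous_within test_function_differentiable)

text \<open>Vanishing on the open set \<open>norm z > R\<close> passes to derivatives, so one radius
  serves all of them.\<close>

lemma test_function_support:
  fixes \<phi> :: "'a::euclidean_space \<Rightarrow> real"
  assumes "test_function \<phi>"
  obtains R where "R > 0" "\<And>hs z. norm z > R \<Longrightarrow> iter_dir_deriv hs \<phi> z = 0"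
proof -
  have "bounded (closure {x. \<phi> x \<noteq> 0})"
    using assms by (simp add: test_function_def compact_imp_bounded)
  then have "bounded {x. \<phi> x \<noteq> 0}"
    by (rule bounded_subset[OF _ closure_subset])
  then obtain R where R: "R > 0" "\<And>x. \<phi> x \<noteq> 0 \<Longrightarrow> norm x \<le> R"
    unfolding bounded_pos by blast
  have "norm z > R \<Longrightarrow> iter_dir_deriv hs \<phi> z = 0" for hs z
  proof (induction hs arbitrary: z)
    case Nil
    then show ?case using R(2)[of z] by auto
  next
    case (Cons h hs)
    have "open {z::'a. norm z > R}"
      by (intro open_Collect_less continuous_intros)
    then have "(iter_dir_deriv hs \<phi> has_derivative (\<lambda>h. 0)) (at z)"
      by (rule has_derivative_transform_within_open[OF has_derivative_const])
        (use Cons in auto)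
    then have "(\<lambda>h. 0) = (\<lambda>h. iter_dir_deriv (h # hs) \<phi> z)"
      using test_function_has_derivative[OF assms] by (rule has_derivative_unique)
    from fun_cong[OF this, of h] show ?case by simp
  qed
  then show ?thesis using that R(1) by blast
qed

text \<open>By translation invariance every difference quotient has integral zero; the mean value
  theorem and the compact support allow dominated convergence.\<close>

lemma integral_derivative_eq_0:
  fixes f :: "'a::euclidean_space \<Rightarrow> real"
  assumes f: "\<And>x. (f has_derivative f' x) (at x)"
    and cont: "continuous_on UNIV (\<lambda>x. f' x h)"
    and supp: "\<And>x. norm x > R \<Longrightarrow> f x = 0" "\<And>x. norm x > R \<Longrightarrow> f' x h = 0"
  shows "(LINT x|lborel. f' x h) = 0"
proof -
  obtain B where B: "B \<ge> 0" "\<And>x. norm (f' x h) \<le> B"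
    using bounded_continuous_compact[OF cont supp(2)] by blast
  have f_cont: "continuous_on UNIV f"
    using f by (meson continuous_at_imp_continuous_on has_derivative_continuous)
  have [measurable]: "f \<in> borel_measurable borel" "(\<lambda>x. f' x h) \<in> borel_measurable borel"
    using f_cont cont by (auto intro: borel_measurable_continuous_onI)
  define \<tau> where "\<tau> n = 1 / real (Suc n)" for n
  have \<tau>: "\<tau> n > 0" "\<tau> n \<le> 1" for n by (auto simp: \<tau>_def)
  have \<tau>0: "\<tau> \<longlonglongrightarrow> 0"
    unfolding \<tau>_def using LIMSEQ_inverse_real_of_nat by (simp add: inverse_eq_divide)
  have line: "((\<lambda>\<sigma>. f (x + \<sigma> *\<^sub>R h)) has_real_derivative f' (x + \<sigma> *\<^sub>R h) h) (at \<sigma>)" for x \<sigma>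
  proof -
    have "((\<lambda>\<sigma>. f (x + \<sigma> *\<^sub>R h)) has_derivative (\<lambda>k. f' (x + \<sigma> *\<^sub>R h) (k *\<^sub>R h))) (at \<sigma>)"
      by (rule has_derivative_compose[where g = f, OF _ f]) (auto intro!: derivative_eq_intros)
    moreover have "f' (x + \<sigma> *\<^sub>R h) (k *\<^sub>R h) = f' (x + \<sigma> *\<^sub>R h) h * k" for k
      using f[of "x + \<sigma> *\<^sub>R h"] by (simp add: linear_cmul[OF has_derivative_linear])
    ultimately show ?thesis by (simp add: has_field_derivative_def)
  qed
  have fi: "integrable lborel f" by (rule integrable_continuous_compact[OF f_cont supp(1)])
  have zero: "(LINT x|lborel. (f (\<tau> n *\<^sub>R h + 1 *\<^sub>R x) - f x) / \<tau> n) = 0" for n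
  proof -
    have "integrable lborel (\<lambda>x. f (\<tau> n *\<^sub>R h + 1 *\<^sub>R x))"
      by (rule lborel_integrable_affine) (use fi in auto)
    moreover have "(LINT x|lborel. f (\<tau> n *\<^sub>R h + 1 *\<^sub>R x)) = (LINT x|lborel. f x)"
      by (subst lborel_integral_affine[where f = f]) auto
    ultimately show ?thesis using fi by simp
  qed
  have "(\<lambda>n. LINT x|lborel. (f (\<tau> n *\<^sub>R h + 1 *\<^sub>R x) - f x) / \<tau> n) \<longlonglongrightarrow> (LINT x|lborel. f' x h)"
  \<comment> \<open>Since \<open>\<tau> n \<le> 1\<close>, all difference quotients are supported in
    this enlarged ball.\<close>
  proof (rule integral_dominated_convergence[where w = "\<lambda>x. B * indicator (cball 0 (R + norm h)) x"])
    show "integrable lborel (\<lambda>x::'a. B * indicator (cball 0 (R + norm h)) x)"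
      by (intro integrable_mult_right integrable_real_indicator) (use emeasure_lborel_cball_finite[of 0 "R + norm h"] in auto)
    show "AE x in lborel. (\<lambda>n. (f (\<tau> n *\<^sub>R h + 1 *\<^sub>R x) - f x) / \<tau> n) \<longlonglongrightarrow> f' x h"
    proof (rule AE_I2)
      fix x
      have "((\<lambda>\<sigma>. (f (x + (0 + \<sigma>) *\<^sub>R h) - f (x + 0 *\<^sub>R h)) / \<sigma>) \<longlongrightarrow> f' (x + 0 *\<^sub>R h) h) (at 0)"
        using line[of x 0] by (simp only: DERIV_def)
      moreover have "filterlim \<tau> (at 0) sequentially"
        using \<tau>0 \<tau>(1) by (intro filterlim_atI) (auto simp: less_imp_neq[symmetric])
      ultimately have "(\<lambda>n. (f (x + (0 + \<tau> n) *\<^sub>R h) - f (x + 0 *\<^sub>R h)) / \<tau> n) \<longlonglongrightarrow> f' (x + 0 *\<^sub>R h) h"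
        by (rule filterlim_compose)
      then show "(\<lambda>n. (f (\<tau> n *\<^sub>R h + 1 *\<^sub>R x) - f x) / \<tau> n) \<longlonglongrightarrow> f' x h"
        by (simp add: add.commute)
    qed
    show "AE x in lborel. norm ((f (\<tau> n *\<^sub>R h + 1 *\<^sub>R x) - f x) / \<tau> n) \<le> B * indicator (cball 0 (R + norm h)) x" for n
    proof (rule AE_I2)
      fix x
      show "norm ((f (\<tau> n *\<^sub>R h + 1 *\<^sub>R x) - f x) / \<tau> n) \<le> B * indicator (cball 0 (R + norm h)) x"
      proof (cases "norm x \<le> R + norm h")
        case True
        obtain \<sigma> where "f (x + \<tau> n *\<^sub>R h) - f (x + 0 *\<^sub>R h) = (\<tau> n - 0) * f' (x + \<sigma> *\<^sub>R h) h"
          using MVT2[of 0 "\<tau> n" "\<lambda>\<sigma>. f (x + \<sigma> *\<^sub>R h)" "\<lambda>\<sigma>. f' (x + \<sigma> *\<^sub>R h) h"] line \<tau>(1)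
          by blast
        then have "(f (\<tau> n *\<^sub>R h + 1 *\<^sub>R x) - f x) / \<tau> n = f' (x + \<sigma> *\<^sub>R h) h"
          using \<tau>(1)[of n] by (simp add: add.commute)
        then show ?thesis using B True by simp
      next
        case False
        have "norm (\<tau> n *\<^sub>R h) \<le> norm h" using \<tau>[of n] by (simp add: mult_left_le_one_le)
        then have "norm (\<tau> n *\<^sub>R h + x) > R"
          using False norm_triangle_ineq4[of "\<tau> n *\<^sub>R h + x" "\<tau> n *\<^sub>R h"] by simp
        moreover have "norm x > R" using False norm_ge_zero[of h] by linarith
        ultimately show ?thesis using False by (simp add: supp)
      qed
    qed
  qed measurable
  then show ?thesis unfolding zero by (simp add: LIMSEQ_const_iff)
qed

lemma locally_integrable_continuous:
  fixes f :: "'a::euclidean_space \<Rightarrow> 'b::euclidean_space"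
  assumes f: "continuous_on UNIV f"
  shows "locally_integrable f"
  unfolding locally_integrable_def
proof safe
  fix K :: "'a set" assume K: "compact K"
  have [measurable]: "f \<in> borel_measurable borel" using f by (rule borel_measurable_continuous_onI)
  have [measurable]: "K \<in> sets borel" using K by (simp add: borel_compact)
  have "integrable lborel (\<lambda>x. indicator K x *\<^sub>R f x)"
    using K continuous_on_subset[OF f] by (intro borel_integrable_compact) auto
  then show "set_integrable lebesgue K f"
    unfolding set_integrable_def by (subst integrable_completion) auto
qed

text \<open>The derivative of the compactly supported product \<open>f * \<psi>\<close> integrates
  to zero.\<close>

lemma is_weak_gradient_C1:
  fixes f :: "'a::euclidean_space \<Rightarrow> real"
  assumes f: "\<And>x. (f has_derivative (\<lambda>h. G x \<bullet> h)) (at x)" and G: "continuous_on UNIV G"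
  shows "is_weak_gradient f G"
  unfolding is_weak_gradient_def
proof (intro conjI allI impI ballI)
  have f_cont: "continuous_on UNIV f"
    using f by (meson continuous_at_imp_continuous_on has_derivative_continuous)
  show "locally_integrable f" "locally_integrable G"
    using f_cont G by (auto intro: locally_integrable_continuous)
  fix \<psi> :: "'a \<Rightarrow> real" and b :: 'a assume \<psi>: "test_function \<psi>"
  obtain R where R: "R > 0" "\<And>hs z. norm z > R \<Longrightarrow> iter_dir_deriv hs \<psi> z = 0"
    using test_function_support[OF \<psi>] by blast
  have \<psi>c: "continuous_on UNIV \<psi>" "continuous_on UNIV (\<lambda>x. frechet_derivative \<psi> (at x) b)"
    using test_function_continuous[OF \<psi>, of UNIV "[]"] test_function_continuous[OF \<psi>, of UNIV "[b]"] by simp_all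
  have \<psi>0: "\<psi> x = 0" "frechet_derivative \<psi> (at x) b = 0" if "norm x > R" for x
    using R(2)[OF that, of "[]"] R(2)[OF that, of "[b]"] by simp_all
  have \<psi>d: "(\<psi> has_derivative (\<lambda>h. frechet_derivative \<psi> (at x) h)) (at x)" for x
    using test_function_has_derivative[OF \<psi>, of "[]"] by simp
  have "(LINT x|lborel. f x * frechet_derivative \<psi> (at x) b + (G x \<bullet> b) * \<psi> x) = 0"
    by (rule integral_derivative_eq_0[where R = R and f = "\<lambda>x. f x * \<psi> x" and f' = "\<lambda>x h. f x * frechet_derivative \<psi> (at x) h + (G x \<bullet> h) * \<psi> x"])
      (auto intro!: has_derivative_mult f \<psi>d continuous_intros f_cont G \<psi>c simp: \<psi>0)
  moreover have "integrable lborel (\<lambda>x. f x * frechet_derivative \<psi> (at x) b)"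
    by (rule integrable_continuous_compact[of _ R]) (auto intro!: continuous_intros f_cont \<psi>c simp: \<psi>0)
  moreover have "integrable lborel (\<lambda>x. (G x \<bullet> b) * \<psi> x)"
    by (rule integrable_continuous_compact[of _ R]) (auto intro!: continuous_intros G \<psi>c simp: \<psi>0)
  ultimately have "(LINT x|lborel. f x * frechet_derivative \<psi> (at x) b) = - (LINT x|lborel. (G x \<bullet> b) * \<psi> x)"
    by simp
  moreover have "(\<lambda>x. f x * frechet_derivative \<psi> (at x) b) \<in> borel_measurable borel"
    "(\<lambda>x. (G x \<bullet> b) * \<psi> x) \<in> borel_measurable borel"
    by (auto intro!: borel_measurable_continuous_onI continuous_intros f_cont G \<psi>c)
  ultimately show "(LINT x|lebesgue. f x * frechet_derivative \<psi> (at x) b) = - (LINT x|lebesgue. (G x \<bullet> b) * \<psi> x)"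
    by (simp add: integral_completion)
qed

section \<open>The weak formulation\<close>

text \<open>The spatial integral is the inner one, so that integration by parts can be done on each
  time slice separately.\<close>

lemma integral_space_time:
  fixes f :: "'a::euclidean_space \<times> real \<Rightarrow> real"
  assumes f: "continuous_on UNIV f" "\<And>z. norm z > R \<Longrightarrow> f z = 0"
  shows "integrable (lebesgue_on space_time) f"
    and "(LINT z|lebesgue_on space_time. f z) = (LINT t|lborel. indicator {0<..} t * (LINT x|lborel. f (x, t)))"
proof -
  have [measurable]: "f \<in> borel_measurable borel" using f(1) by (rule borel_measurable_continuous_onI)
  have "open (space_time :: ('a \<times> real) set)"
    unfolding space_time_def by (intro open_Times) auto
  then have st[measurable]: "(space_time :: ('a \<times> real) set) \<in> sets borel" by simp
  then have stl: "(space_time :: ('a \<times> real) set) \<in> sets lebesgue" by simp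
  let ?k = "\<lambda>z. indicator space_time z *\<^sub>R f z"
  have ki: "integrable lborel ?k"
    using integrable_continuous_compact[OF f] st by (intro integrable_mult_indicator) auto
  show "integrable (lebesgue_on space_time) f"
    using stl ki by (subst integrable_restrict_space) (auto simp: set_integrable_def integrable_completion)
  have "(LINT z|lebesgue_on space_time. f z) = (LINT z|lebesgue. ?k z)"
    using stl by (subst integral_restrict_space) auto
  also have "\<dots> = (LINT z|lborel. ?k z)" by (rule integral_completion) measurable
  also have "\<dots> = (LINT z|(lborel \<Otimes>\<^sub>M lborel). (case z of (x, t) \<Rightarrow> ?k (x, t)))"
    by (simp add: lborel_prod)
  also have "\<dots> = (LINT t|lborel. LINT x|lborel. ?k (x, t))"
    by (rule lborel_pair.integral_snd[symmetric]) (use ki in \<open>simp add: lborel_prod case_prod_unfold\<close>)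
  also have "\<dots> = (LINT t|lborel. indicator {0<..} t * (LINT x|lborel. f (x, t)))"
  proof (rule Bochner_Integration.integral_cong[OF refl])
    fix t :: real
    have eq: "?k (x, t) = indicator {0<..} t * f (x, t)" for x :: 'a
      by (simp add: space_time_def indicator_def)
    show "(LINT x|lborel. ?k (x, t)) = indicator {0<..} t * (LINT x|lborel. f (x, t))"
      unfolding eq by (rule integral_mult_right_zero)
  qed
  finally show "(LINT z|lebesgue_on space_time. f z) = (LINT t|lborel. indicator {0<..} t * (LINT x|lborel. f (x, t)))" .
qed

lemma test_function_section_derivative:
  fixes \<phi> :: "'a::euclidean_space \<times> real \<Rightarrow> real"
  assumes "test_function \<phi>"
  shows "((\<lambda>x. iter_dir_deriv hs \<phi> (x, t)) has_derivative (\<lambda>h. iter_dir_deriv ((h, 0) # hs) \<phi> (x, t))) (at x)"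
  by (rule has_derivative_compose[OF _ test_function_has_derivative[OF assms]])
    (auto intro!: derivative_eq_intros)

lemma test_function_derivative_expand:
  fixes \<phi> :: "'a::euclidean_space \<times> real \<Rightarrow> real"
  assumes "test_function \<phi>"
  shows "iter_dir_deriv [(w, 1)] \<phi> z = iter_dir_deriv [(0, 1)] \<phi> z + (\<Sum>b\<in>Basis. (w \<bullet> b) * iter_dir_deriv [(b, 0)] \<phi> z)"
proof -
  let ?D = "\<lambda>h. iter_dir_deriv [h] \<phi> z"
  have lin: "linear ?D"
    using test_function_has_derivative[OF assms, of "[]" z] by (rule has_derivative_linear)
  have "(w, 1) = (0, 1) + (\<Sum>b\<in>Basis. (w \<bullet> b) *\<^sub>R (b, 0::real))"
    by (simp add: prod_eq_iff fst_sum snd_sum euclidean_representation)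
  then have "?D (w, 1) = ?D ((0, 1) + (\<Sum>b\<in>Basis. (w \<bullet> b) *\<^sub>R (b, 0)))" by simp
  also have "\<dots> = ?D (0, 1) + (\<Sum>b\<in>Basis. (w \<bullet> b) * ?D (b, 0))"
    by (simp only: linear_add[OF lin] linear_sum[OF lin] linear_cmul[OF lin] real_scaleR_def)
  finally show ?thesis .
qed

text \<open>\<open>K\<close> is the derivative of
  \<open>t \<mapsto> \<phi> ((1 + t) powr \<beta> *\<^sub>R y, t)\<close>. The curve leaves the
  support of \<open>\<phi>\<close>, so the fundamental theorem of calculus retains only the value at
  \<open>t = 0\<close>.\<close>

lemma test_function_transport:
  fixes \<phi> :: "'a::euclidean_space \<times> real \<Rightarrow> real" and y :: 'a and \<beta> :: real
  assumes \<phi>: "test_function \<phi>" and R: "\<And>hs z. norm z > R \<Longrightarrow> iter_dir_deriv hs \<phi> z = 0"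
  defines "K \<equiv> \<lambda>t. iter_dir_deriv [(0, 1)] \<phi> ((1 + t) powr \<beta> *\<^sub>R y, t) +
      (\<Sum>b\<in>Basis. \<beta> * (1 + t) powr (\<beta> - 1) * (y \<bullet> b) * iter_dir_deriv [(b, 0)] \<phi> ((1 + t) powr \<beta> *\<^sub>R y, t))"
  shows "(LINT t|lborel. indicator {0<..} t * K t) = - \<phi> (y, 0)"
proof -
  define \<gamma> where "\<gamma> t = ((1 + t) powr \<beta> *\<^sub>R y, t)" for t
  \<comment> \<open>\<open>R\<close> may be negative; this choice gives \<open>0 \<le> S\<close> and
    puts \<open>(x, t)\<close> outside the support for all \<open>t \<ge> S\<close>, whatever
    \<open>x\<close> is.\<close>
  define S where "S = \<bar>R\<bar> + 1"
  have S: "S \<ge> 0" by (simp add: S_def)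
  have far: "norm (x, t) > R" if "t \<ge> S" for x :: 'a and t
    using norm_snd_le[of t x] that by (auto simp: S_def)
  have deriv: "((\<lambda>t. \<phi> (\<gamma> t)) has_vector_derivative K t) (at t within {0..S})" if "t \<in> {0..S}" for t
  proof -
    let ?w = "(\<beta> * (1 + t) powr (\<beta> - 1)) *\<^sub>R y"
    have t: "1 + t > 0" using that by simp
    have "((\<lambda>t. (1 + t) powr \<beta>) has_real_derivative \<beta> * (1 + t) powr (\<beta> - 1)) (at t)"
      using t by (auto intro!: derivative_eq_intros)
    then have "((\<lambda>t. (1 + t) powr \<beta> *\<^sub>R y) has_derivative (\<lambda>k. ((\<beta> * (1 + t) powr (\<beta> - 1)) * k) *\<^sub>R y)) (at t)"
      unfolding has_field_derivative_def by (rule has_derivative_scaleR_left)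
    from has_derivative_Pair[OF this has_derivative_ident]
    have "(\<gamma> has_derivative (\<lambda>k. k *\<^sub>R (?w, 1))) (at t)"
      unfolding \<gamma>_def by (simp add: mult_ac)
    moreover have "(\<phi> has_derivative (\<lambda>h. iter_dir_deriv [h] \<phi> (\<gamma> t))) (at (\<gamma> t))"
      using test_function_has_derivative[OF \<phi>, of "[]"] by simp
    ultimately have "((\<lambda>t. \<phi> (\<gamma> t)) has_derivative (\<lambda>k. iter_dir_deriv [k *\<^sub>R (?w, 1)] \<phi> (\<gamma> t))) (at t)"
      by (rule has_derivative_compose)
    moreover have "iter_dir_deriv [k *\<^sub>R (?w, 1)] \<phi> (\<gamma> t) = k *\<^sub>R iter_dir_deriv [(?w, 1)] \<phi> (\<gamma> t)" for k
      using test_function_has_derivative[OF \<phi>, of "[]"] linear_cmul has_derivative_linear by blast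
    moreover have "iter_dir_deriv [(?w, 1)] \<phi> (\<gamma> t) = K t"
      unfolding test_function_derivative_expand[OF \<phi>, of ?w] K_def \<gamma>_def by simp
    ultimately show ?thesis
      by (auto simp: has_vector_derivative_def intro: has_derivative_at_withinI)
  qed
  have cont: "continuous_on {0..S} K"
    unfolding K_def
    by (intro continuous_intros continuous_on_compose2[OF test_function_continuous[OF \<phi>, of UNIV]]) auto
  have "(LINT t|lborel. indicator {0<..} t * K t) = (LINT t|lborel. indicator {0..S} t *\<^sub>R K t)"
  proof (rule integral_cong_AE)
    have meas: "(\<lambda>t. indicator {0..S} t *\<^sub>R K t) \<in> borel_measurable borel"
      using cont by (intro borel_measurable_continuous_on_indicator) auto
    \<comment> \<open>For \<open>t \<ge> S\<close> the function \<open>K\<close> vanishes, so the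
      two integrands differ at most at the null point \<open>t = 0\<close>.\<close>
    have eq: "indicator {0<..} t * K t = indicator {0<..} t * (indicator {0..S} t *\<^sub>R K t)" for t
      using far[of t] by (auto simp: indicator_def K_def R simp del: iter_dir_deriv.simps)
    show "(\<lambda>t. indicator {0<..} t * K t) \<in> borel_measurable lborel"
      unfolding eq using meas by measurable
    show "(\<lambda>t. indicator {0..S} t *\<^sub>R K t) \<in> borel_measurable lborel"
      using meas by simp
    show "AE t in lborel. indicator {0<..} t * K t = indicator {0..S} t *\<^sub>R K t"
      using AE_lborel_singleton[of 0]
    proof eventually_elim
      case (elim t)
      then show ?case by (subst eq) (auto simp: indicator_def)
    qed
  qed
  also have "\<dots> = \<phi> (\<gamma> S) - \<phi> (\<gamma> 0)"
    by (rule integral_FTC_Icc[OF S]) (use deriv cont in auto)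
  also have "\<phi> (\<gamma> S) = 0" using R[of "\<gamma> S" "[]"] far[of S] by (simp add: \<gamma>_def)
  finally show ?thesis by (simp add: \<gamma>_def)
qed

section \<open>The self-similar profile as a weak solution\<close>

context obstacle
begin

lemma self_similar_cont: "continuous_on UNIV (\<lambda>x. self_similar \<kappa> \<sigma> v x t)"
  unfolding self_similar_def
  by (intro continuous_intros continuous_on_compose2[OF v_cont[of UNIV]]) auto

context
  fixes \<alpha> :: real
  assumes \<beta>_eq: "\<beta> = 1 / (real DIM('a) + 2 * (1 + s))"
    and \<alpha>_eq: "\<alpha> = \<beta> * real DIM('a)"
begin

text \<open>The spatial gradient of the self-similar function: to the amplitude exponent
  \<open>\<alpha>\<close> the chain rule adds \<open>\<beta>\<close>.\<close>

definition G :: "'a \<Rightarrow> real \<Rightarrow> 'a" where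
  "G x t = (1 / (1 + t) powr (\<alpha> + \<beta>)) *\<^sub>R g (x /\<^sub>R (1 + t) powr \<beta>)"

text \<open>The exponents add up to \<open>\<alpha> + 2s\<beta> + 2\<beta> = 1\<close>, so inside the support the pressure is
  this paraboloid.\<close>

definition \<Phi> :: "'a \<Rightarrow> real \<Rightarrow> real" where
  "\<Phi> x t = C / (1 + t) powr (\<alpha> + 2 * s * \<beta>) - \<beta> / (2 * (1 + t)) * (norm x)\<^sup>2"

lemma exponents: "\<alpha> + 2 * s * \<beta> + 2 * \<beta> = 1"
proof -
  have "real DIM('a) + 2 * (1 + s) > 0" using s by (simp add: add_pos_pos)
  then have "\<beta> * (real DIM('a) + 2 * (1 + s)) = 1" unfolding \<beta>_eq by simp
  then show ?thesis unfolding \<alpha>_eq by (simp add: algebra_simps)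
qed

text \<open>The constant \<open>C\<close> keeps the amplitude exponent
  \<open>\<alpha> + 2 * s * \<beta>\<close> of the pressure, whereas the quadratic term gains
  \<open>2 * \<beta>\<close> from the dilated argument and so arrives at exponent 1.\<close>

lemma pressure_eq:
  assumes t: "t > -1" and x: "norm (x /\<^sub>R (1 + t) powr \<beta>) < r"
  shows "self_similar (\<alpha> + 2 * s * \<beta>) \<beta> p x t = \<Phi> x t"
proof -
  have "1 / (1 + t) powr (\<alpha> + 2 * s * \<beta>) * (1 / ((1 + t) powr \<beta>)\<^sup>2) = 1 / (1 + t) powr (\<alpha> + 2 * s * \<beta> + 2 * \<beta>)"
    using t by (simp add: powr_add powr_power mult.commute)
  also have "\<dots> = 1 / (1 + t)" using t by (simp add: exponents)
  finally have *: "1 / (1 + t) powr (\<alpha> + 2 * s * \<beta>) * (1 / ((1 + t) powr \<beta>)\<^sup>2) = 1 / (1 + t)" .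
  have "self_similar (\<alpha> + 2 * s * \<beta>) \<beta> p x t =
     1 / (1 + t) powr (\<alpha> + 2 * s * \<beta>) * (C - \<beta> / 2 * (norm (x /\<^sub>R (1 + t) powr \<beta>))\<^sup>2)"
    using p_eq[OF x] by (simp add: self_similar_def)
  also have "(norm (x /\<^sub>R (1 + t) powr \<beta>))\<^sup>2 = 1 / ((1 + t) powr \<beta>)\<^sup>2 * (norm x)\<^sup>2"
    by (simp add: power_mult_distrib power_inverse inverse_eq_divide power_divide)
  also have "1 / (1 + t) powr (\<alpha> + 2 * s * \<beta>) * (C - \<beta> / 2 * (1 / ((1 + t) powr \<beta>)\<^sup>2 * (norm x)\<^sup>2)) =
     C / (1 + t) powr (\<alpha> + 2 * s * \<beta>) - \<beta> / 2 * (1 / (1 + t) powr (\<alpha> + 2 * s * \<beta>) * (1 / ((1 + t) powr \<beta>)\<^sup>2)) * (norm x)\<^sup>2"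
    by (simp add: right_diff_distrib)
  also have "\<dots> = \<Phi> x t"
    unfolding * \<Phi>_def by simp
  finally show ?thesis .
qed

text \<open>In the dilated ball \<open>pressure_eq\<close> identifies the pressure; elsewhere the
  factor \<open>u\<close> vanishes.\<close>

lemma pressure_times_u:
  assumes "t > -1"
  shows "self_similar (\<alpha> + 2 * s * \<beta>) \<beta> p x t * self_similar \<alpha> \<beta> v x t = \<Phi> x t * self_similar \<alpha> \<beta> v x t"
proof (cases "norm (x /\<^sub>R (1 + t) powr \<beta>) < r")
  case False
  then have "self_similar \<alpha> \<beta> v x t = 0" unfolding self_similar_def by (subst v_zero) auto
  then show ?thesis by simp
qed (simp add: pressure_eq[OF assms])

text \<open>As for \<open>u\<close>, with \<open>g_zero\<close> supplying the vanishing outside the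
  dilated ball and on its boundary sphere.\<close>

lemma pressure_times_G:
  assumes "t > -1"
  shows "self_similar (\<alpha> + 2 * s * \<beta>) \<beta> p x t * (G x t \<bullet> w) = \<Phi> x t * (G x t \<bullet> w)"
proof (cases "norm (x /\<^sub>R (1 + t) powr \<beta>) < r")
  case False
  then have "G x t = 0" unfolding G_def by (subst g_zero) auto
  then show ?thesis by simp
qed (simp add: pressure_eq[OF assms])

lemma self_similar_derivative:
  "((\<lambda>x. self_similar \<alpha> \<beta> v x t) has_derivative (\<lambda>h. G x t \<bullet> h)) (at x)"
proof -
  have "((\<lambda>x. v (x /\<^sub>R (1 + t) powr \<beta>)) has_derivative (\<lambda>h. g (x /\<^sub>R (1 + t) powr \<beta>) \<bullet> (h /\<^sub>R (1 + t) powr \<beta>))) (at x)"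
    by (rule has_derivative_compose[OF _ deriv]) (auto intro!: derivative_eq_intros)
  then have "((\<lambda>x. 1 / (1 + t) powr \<alpha> * v (x /\<^sub>R (1 + t) powr \<beta>)) has_derivative
      (\<lambda>h. 1 / (1 + t) powr \<alpha> * (g (x /\<^sub>R (1 + t) powr \<beta>) \<bullet> (h /\<^sub>R (1 + t) powr \<beta>)))) (at x)"
    by (rule has_derivative_mult_right)
  then show ?thesis
    by (simp add: self_similar_def G_def powr_add field_simps)
qed

lemma G_cont: "continuous_on UNIV (\<lambda>x. G x t)"
  unfolding G_def
  by (intro continuous_intros continuous_on_compose2[OF g_cont]) auto

text \<open>For each \<open>b\<close> the derivative along \<open>b\<close> of the product of
  \<open>\<Phi>\<close>, \<open>u\<close> and the \<open>b\<close>-derivative of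
  \<open>\<phi>\<close> integrates to zero. The terms differentiating \<open>u\<close> and
  \<open>\<phi>\<close> form the left-hand side; the term differentiating \<open>\<Phi>\<close>
  brings the factor \<open>- \<beta> / (1 + t) * (x \<bullet> b)\<close> and moves to the
  right.\<close>

lemma divergence_identity:
  fixes \<phi> :: "'a \<times> real \<Rightarrow> real"
  assumes \<phi>: "test_function \<phi>" and t: "t > 0"
  shows "(LINT x|lborel. \<Phi> x t * self_similar \<alpha> \<beta> v x t * space_laplacian \<phi> (x, t)
        + \<Phi> x t * (G x t \<bullet> space_grad \<phi> (x, t))) =
     (LINT x|lborel. \<beta> / (1 + t) * self_similar \<alpha> \<beta> v x t * (\<Sum>b\<in>Basis. (x \<bullet> b) * iter_dir_deriv [(b, 0)] \<phi> (x, t)))"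
proof -
  obtain R where R: "R > 0" "\<And>hs z. norm z > R \<Longrightarrow> iter_dir_deriv hs \<phi> z = 0"
    using test_function_support[OF \<phi>] by blast
  have far: "iter_dir_deriv hs \<phi> (x, t) = 0" if "norm x > R" for hs x
    using R(2)[of "(x, t)" hs] norm_fst_le[of x t] that by auto
  let ?u = "\<lambda>x. self_similar \<alpha> \<beta> v x t"
  let ?D = "\<lambda>b x. iter_dir_deriv [(b, 0)] \<phi> (x, t)"
  let ?DD = "\<lambda>b x. iter_dir_deriv [(b, 0), (b, 0)] \<phi> (x, t)"
  have \<phi>c: "continuous_on UNIV (\<lambda>x. iter_dir_deriv hs \<phi> (x, t))" for hs
    by (rule continuous_on_compose2[OF test_function_continuous[OF \<phi>, of UNIV]]) (auto intro!: continuous_intros)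
  have \<Phi>c: "continuous_on UNIV (\<lambda>x. \<Phi> x t)"
    unfolding \<Phi>_def by (intro continuous_intros)
  have \<Phi>d: "((\<lambda>x. \<Phi> x t) has_derivative (\<lambda>h. - (\<beta> / (1 + t)) * (x \<bullet> h))) (at x)" for x
  proof -
    have "((\<lambda>x. A - B * (x \<bullet> x)) has_derivative (\<lambda>h. - (2 * B) * (x \<bullet> h))) (at x)" for A B :: real
      by (auto intro!: derivative_eq_intros simp: inner_commute)
    note * = this[of "C / (1 + t) powr (\<alpha> + 2 * s * \<beta>)" "\<beta> / (2 * (1 + t))"]
    have "2 * (\<beta> / (2 * (1 + t))) = \<beta> / (1 + t)" using t by (simp add: field_simps)
    then show ?thesis
      unfolding \<Phi>_def power2_norm_eq_inner using * by (simp only:)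
  qed
  have "((\<lambda>x. \<Phi> x t * ?u x * ?D b x) has_derivative
     (\<lambda>h. \<Phi> x t * ?u x * iter_dir_deriv [(h, 0), (b, 0)] \<phi> (x, t) +
       (\<Phi> x t * (G x t \<bullet> h) + (- (\<beta> / (1 + t)) * (x \<bullet> h)) * ?u x) * ?D b x)) (at x)" for x b
    by (rule has_derivative_mult[OF has_derivative_mult[OF \<Phi>d self_similar_derivative]
        test_function_section_derivative[OF \<phi>]])
  then have zero: "(LINT x|lborel. \<Phi> x t * ?u x * ?DD b x +
       (\<Phi> x t * (G x t \<bullet> b) + (- (\<beta> / (1 + t)) * (x \<bullet> b)) * ?u x) * ?D b x) = 0" for b
    by (rule integral_derivative_eq_0[where R = R])
      (use far t in \<open>auto intro!: continuous_intros \<Phi>c self_similar_cont G_cont \<phi>c simp del: iter_dir_deriv.simps\<close>)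
  have i1: "integrable lborel (\<lambda>x. \<Phi> x t * ?u x * ?DD b x + \<Phi> x t * (G x t \<bullet> b) * ?D b x)" for b
    by (rule integrable_continuous_compact[where R = R])
      (use far t in \<open>auto intro!: continuous_intros \<Phi>c self_similar_cont G_cont \<phi>c simp del: iter_dir_deriv.simps\<close>)
  have i2: "integrable lborel (\<lambda>x. \<beta> / (1 + t) * ?u x * ((x \<bullet> b) * ?D b x))" for b
    by (rule integrable_continuous_compact[where R = R])
      (use far t in \<open>auto intro!: continuous_intros self_similar_cont \<phi>c simp del: iter_dir_deriv.simps\<close>)
  have eq: "(LINT x|lborel. \<Phi> x t * ?u x * ?DD b x + \<Phi> x t * (G x t \<bullet> b) * ?D b x) =
      (LINT x|lborel. \<beta> / (1 + t) * ?u x * ((x \<bullet> b) * ?D b x))" for b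
  proof -
    have "(LINT x|lborel. \<Phi> x t * ?u x * ?DD b x + \<Phi> x t * (G x t \<bullet> b) * ?D b x) -
      (LINT x|lborel. \<beta> / (1 + t) * ?u x * ((x \<bullet> b) * ?D b x)) =
      (LINT x|lborel. (\<Phi> x t * ?u x * ?DD b x + \<Phi> x t * (G x t \<bullet> b) * ?D b x) - \<beta> / (1 + t) * ?u x * ((x \<bullet> b) * ?D b x))"
      by (rule Bochner_Integration.integral_diff[symmetric, OF i1 i2])
    also have "\<dots> = (LINT x|lborel. \<Phi> x t * ?u x * ?DD b x +
       (\<Phi> x t * (G x t \<bullet> b) + (- (\<beta> / (1 + t)) * (x \<bullet> b)) * ?u x) * ?D b x)"
      by (intro Bochner_Integration.integral_cong refl) (simp add: algebra_simps del: iter_dir_deriv.simps)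
    finally show ?thesis using zero[of b] by simp
  qed
  have "(LINT x|lborel. \<Phi> x t * ?u x * space_laplacian \<phi> (x, t) + \<Phi> x t * (G x t \<bullet> space_grad \<phi> (x, t))) =
      (LINT x|lborel. (\<Sum>b\<in>Basis. \<Phi> x t * ?u x * ?DD b x + \<Phi> x t * (G x t \<bullet> b) * ?D b x))"
  proof (rule Bochner_Integration.integral_cong[OF refl])
    fix x
    have "\<Phi> x t * (G x t \<bullet> space_grad \<phi> (x, t)) = (\<Sum>b\<in>Basis. \<Phi> x t * (G x t \<bullet> b) * ?D b x)"
      by (simp add: space_grad_def inner_sum_right sum_distrib_left mult_ac)
    moreover have "\<Phi> x t * ?u x * space_laplacian \<phi> (x, t) = (\<Sum>b\<in>Basis. \<Phi> x t * ?u x * ?DD b x)"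
      unfolding space_laplacian_def by (rule sum_distrib_left)
    ultimately show "\<Phi> x t * ?u x * space_laplacian \<phi> (x, t) + \<Phi> x t * (G x t \<bullet> space_grad \<phi> (x, t)) =
        (\<Sum>b\<in>Basis. \<Phi> x t * ?u x * ?DD b x + \<Phi> x t * (G x t \<bullet> b) * ?D b x)"
      by (simp only: sum.distrib)
  qed
  also have "\<dots> = (\<Sum>b\<in>Basis. (LINT x|lborel. \<Phi> x t * ?u x * ?DD b x + \<Phi> x t * (G x t \<bullet> b) * ?D b x))"
    by (rule Bochner_Integration.integral_sum) (rule i1)
  also have "\<dots> = (\<Sum>b\<in>Basis. (LINT x|lborel. \<beta> / (1 + t) * ?u x * ((x \<bullet> b) * ?D b x)))"
    unfolding eq ..
  also have "\<dots> = (LINT x|lborel. (\<Sum>b\<in>Basis. \<beta> / (1 + t) * ?u x * ((x \<bullet> b) * ?D b x)))"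
    by (rule Bochner_Integration.integral_sum[symmetric]) (rule i2)
  also have "\<dots> = (LINT x|lborel. \<beta> / (1 + t) * ?u x * (\<Sum>b\<in>Basis. (x \<bullet> b) * ?D b x))"
    unfolding sum_distrib_left ..
  finally show ?thesis .
qed

text \<open>On a time slice the Jacobian \<open>(1 + t) powr (\<beta> * d)\<close> of the dilation
  cancels the amplitude \<open>(1 + t) powr (- \<alpha>)\<close>. What remains is the fixed profile
  \<open>v y\<close> times \<open>K (y, t)\<close>, so after Fubini the time integral can be
  evaluated for each \<open>y\<close> by \<open>test_function_transport\<close>.\<close>

lemma weak_formulation:
  fixes \<phi> :: "'a \<times> real \<Rightarrow> real"
  assumes \<phi>: "test_function \<phi>"
  shows "- (LINT (x, t)|lebesgue_on space_time. self_similar \<alpha> \<beta> v x t * time_deriv \<phi> (x, t))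
     - (LINT (x, t)|lebesgue_on space_time. self_similar (\<alpha> + 2 * s * \<beta>) \<beta> p x t * self_similar \<alpha> \<beta> v x t * space_laplacian \<phi> (x, t))
     - (LINT (x, t)|lebesgue_on space_time. self_similar (\<alpha> + 2 * s * \<beta>) \<beta> p x t * (G x t \<bullet> space_grad \<phi> (x, t)))
     = (LINT x|lebesgue. v x * \<phi> (x, 0))"
proof -
  obtain R where R: "R > 0" "\<And>hs z. norm z > R \<Longrightarrow> iter_dir_deriv hs \<phi> z = 0"
    using test_function_support[OF \<phi>] by blast
  note \<phi>c = test_function_continuous[OF \<phi>, of UNIV]
  \<comment> \<open>The coefficients blow up at \<open>t = -1\<close>; freezing them for negative times makes every integrand
    continuous with compact support on the whole of space-time.\<close>
  define T where "T z = max 0 (snd z)" for z :: "'a \<times> real"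
  have Tc: "continuous_on UNIV T" unfolding T_def by (intro continuous_intros)
  have T0: "T z \<ge> 0" "1 + T z \<noteq> 0" "2 + 2 * T z \<noteq> 0" for z by (auto simp: T_def max_def)
  have T_eq: "T (x, t) = t" if "t > 0" for x t using that by (simp add: T_def)
  have Pc: "continuous_on UNIV (\<lambda>z. (1 + T z) powr q)" for q
    by (intro continuous_intros Tc) (use T0 in auto)
  have P0: "(1 + T z) powr q \<noteq> 0" for z q using T0(2)[of z] by simp
  have uc: "continuous_on UNIV (\<lambda>z. self_similar \<alpha> \<beta> v (fst z) (T z))"
    unfolding self_similar_def
    by (intro continuous_intros Pc continuous_on_compose2[OF v_cont[of UNIV]]) (use P0 in auto)
  have Gc: "continuous_on UNIV (\<lambda>z. G (fst z) (T z))"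
    unfolding G_def
    by (intro continuous_intros Pc continuous_on_compose2[OF g_cont]) (use P0 in auto)
  have \<Phi>c: "continuous_on UNIV (\<lambda>z. \<Phi> (fst z) (T z))"
    unfolding \<Phi>_def
    by (intro continuous_intros Pc Tc) (use P0 T0 in \<open>auto simp: distrib_left\<close>)
  define e1 where "e1 z = self_similar \<alpha> \<beta> v (fst z) (T z) * time_deriv \<phi> z" for z
  define e2 where "e2 z = \<Phi> (fst z) (T z) * self_similar \<alpha> \<beta> v (fst z) (T z) * space_laplacian \<phi> z" for z
  define e3 where "e3 z = \<Phi> (fst z) (T z) * (G (fst z) (T z) \<bullet> space_grad \<phi> z)" for z
  have td: "time_deriv \<phi> = iter_dir_deriv [(0, 1)] \<phi>" by (simp add: time_deriv_def fun_eq_iff)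
  have sg: "space_grad \<phi> = (\<lambda>z. \<Sum>b\<in>Basis. iter_dir_deriv [(b, 0)] \<phi> z *\<^sub>R b)"
    by (simp add: space_grad_def fun_eq_iff)
  have sl: "space_laplacian \<phi> = (\<lambda>z. \<Sum>b\<in>Basis. iter_dir_deriv [(b, 0), (b, 0)] \<phi> z)"
    by (simp add: space_laplacian_def fun_eq_iff)
  have e1: "continuous_on UNIV e1" "\<And>z. norm z > R \<Longrightarrow> e1 z = 0"
    unfolding e1_def td by (auto intro!: continuous_intros uc \<phi>c simp: R simp del: iter_dir_deriv.simps)
  have e2: "continuous_on UNIV e2" "\<And>z. norm z > R \<Longrightarrow> e2 z = 0"
    unfolding e2_def sl by (auto intro!: continuous_intros uc \<Phi>c \<phi>c simp: R simp del: iter_dir_deriv.simps)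
  have e3: "continuous_on UNIV e3" "\<And>z. norm z > R \<Longrightarrow> e3 z = 0"
    unfolding e3_def sg by (auto intro!: continuous_intros \<Phi>c Gc \<phi>c simp: R simp del: iter_dir_deriv.simps)
  have I1: "(LINT (x, t)|lebesgue_on space_time. self_similar \<alpha> \<beta> v x t * time_deriv \<phi> (x, t)) =
      (LINT z|lebesgue_on space_time. e1 z)"
    by (rule Bochner_Integration.integral_cong[OF refl])
      (auto simp: space_restrict_space space_time_def e1_def T_eq)
  have I2: "(LINT (x, t)|lebesgue_on space_time. self_similar (\<alpha> + 2 * s * \<beta>) \<beta> p x t * self_similar \<alpha> \<beta> v x t * space_laplacian \<phi> (x, t)) =
      (LINT z|lebesgue_on space_time. e2 z)"
    by (rule Bochner_Integration.integral_cong[OF refl])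
      (auto simp: space_restrict_space space_time_def e2_def T_eq pressure_times_u)
  have I3: "(LINT (x, t)|lebesgue_on space_time. self_similar (\<alpha> + 2 * s * \<beta>) \<beta> p x t * (G x t \<bullet> space_grad \<phi> (x, t))) =
      (LINT z|lebesgue_on space_time. e3 z)"
    by (rule Bochner_Integration.integral_cong[OF refl])
      (auto simp: space_restrict_space space_time_def e3_def T_eq pressure_times_G)
  define e where "e z = e1 z + (e2 z + e3 z)" for z
  have e: "continuous_on UNIV e" "\<And>z. norm z > R \<Longrightarrow> e z = 0"
    using e1 e2 e3 by (auto simp: e_def intro!: continuous_intros)
  define K where "K z = iter_dir_deriv [(0, 1)] \<phi> ((1 + T z) powr \<beta> *\<^sub>R fst z, snd z) +
      (\<Sum>b\<in>Basis. \<beta> * (1 + T z) powr (\<beta> - 1) * (fst z \<bullet> b) * iter_dir_deriv [(b, 0)] \<phi> ((1 + T z) powr \<beta> *\<^sub>R fst z, snd z))" for z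
  have "continuous_on UNIV K"
    unfolding K_def by (intro continuous_intros Pc continuous_on_compose2[OF \<phi>c]) auto
  then have vK: "continuous_on UNIV (\<lambda>z. v (fst z) * K z)"
    by (intro continuous_intros continuous_on_compose2[OF v_cont[of UNIV]]) auto
  \<comment> \<open>\<open>v\<close> confines \<open>y\<close> to the ball of radius
    \<open>r\<close>, and the support of \<open>\<phi>\<close> confines \<open>t\<close> to
    \<open>[-R, R]\<close>.\<close>
  have vK0: "v (fst z) * K z = 0" if "norm z > r + R" for z
  proof (cases "norm (fst z) \<ge> r")
    case False
    then have "norm (snd z) > R"
      using that norm_Pair_le[of "fst z" "snd z"] by simp
    then have "norm (x, snd z) > R" for x :: 'a
      using norm_snd_le[of "snd z" x] by auto
    then show ?thesis unfolding K_def by (simp add: R del: iter_dir_deriv.simps)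
  qed (simp add: v_zero)
  have slice: "(LINT x|lborel. e (x, t)) = (LINT y|lborel. v y * K (y, t))" if t: "t > 0" for t
  proof -
    have slc: "continuous_on UNIV (\<lambda>x. f (x, t))" if "continuous_on UNIV f" for f :: "'a \<times> real \<Rightarrow> real"
      by (rule continuous_on_compose2[OF that]) (auto intro!: continuous_intros)
    have sl0: "f (x, t) = 0" if "\<And>z. norm z > R \<Longrightarrow> f z = 0" "norm x > R" for f :: "'a \<times> real \<Rightarrow> real" and x
      using that norm_fst_le[of x t] by auto
    have si: "integrable lborel (\<lambda>x. f (x, t))" if "continuous_on UNIV f" "\<And>z. norm z > R \<Longrightarrow> f z = 0"
      for f :: "'a \<times> real \<Rightarrow> real"
      using slc[OF that(1)] sl0[OF that(2)] by (rule integrable_continuous_compact)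
    let ?u = "\<lambda>x. self_similar \<alpha> \<beta> v x t"
    let ?S = "\<lambda>x. \<Sum>b\<in>Basis. (x \<bullet> b) * iter_dir_deriv [(b, 0)] \<phi> (x, t)"
    have \<phi>s: "continuous_on UNIV (\<lambda>x. iter_dir_deriv hs \<phi> (x, t))" for hs
      by (rule slc[OF \<phi>c])
    have Si: "integrable lborel (\<lambda>x. \<beta> / (1 + t) * ?u x * ?S x)"
      by (rule integrable_continuous_compact[where R = R])
        (use t in \<open>auto intro!: continuous_intros self_similar_cont \<phi>s simp: sl0 R simp del: iter_dir_deriv.simps\<close>)
    let ?H = "\<lambda>x. ?u x * iter_dir_deriv [(0, 1)] \<phi> (x, t) + \<beta> / (1 + t) * ?u x * ?S x"
    have Hm: "?H \<in> borel_measurable borel"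
      by (intro borel_measurable_continuous_onI continuous_intros self_similar_cont \<phi>s) (use t in auto)
    have "(LINT x|lborel. e (x, t)) = (LINT x|lborel. e1 (x, t)) + (LINT x|lborel. e2 (x, t) + e3 (x, t))"
      unfolding e_def by (intro Bochner_Integration.integral_add Bochner_Integration.integrable_add si e1 e2 e3)
    also have "(LINT x|lborel. e2 (x, t) + e3 (x, t)) = (LINT x|lborel. \<beta> / (1 + t) * ?u x * ?S x)"
      using divergence_identity[OF \<phi> t] by (simp add: e2_def e3_def T_eq t del: iter_dir_deriv.simps)
    also have "(LINT x|lborel. e1 (x, t)) + \<dots> = (LINT x|lborel. e1 (x, t) + \<beta> / (1 + t) * ?u x * ?S x)"
      by (intro Bochner_Integration.integral_add[symmetric] si e1 Si)
    also have "\<dots> = (LINT x|lborel. ?H x)"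
      by (simp add: e1_def td T_eq t del: iter_dir_deriv.simps)
    also have "\<dots> = ((1 + t) powr \<beta>) ^ DIM('a) * (LINT y|lborel. ?H (0 + (1 + t) powr \<beta> *\<^sub>R y))"
      using t by (subst lborel_integral_affine[OF _ Hm]) auto
    also have "\<dots> = (LINT y|lborel. ((1 + t) powr \<beta>) ^ DIM('a) * ?H (0 + (1 + t) powr \<beta> *\<^sub>R y))"
      by simp
    also have "\<dots> = (LINT y|lborel. v y * K (y, t))"
    proof (rule Bochner_Integration.integral_cong[OF refl])
      fix y :: 'a
      let ?x = "(1 + t) powr \<beta> *\<^sub>R y"
      have a: "((1 + t) powr \<beta>) ^ DIM('a) = (1 + t) powr \<alpha>"
        using t by (simp add: powr_power \<alpha>_eq mult.commute)
      have u: "?u ?x = v y / (1 + t) powr \<alpha>" using t by (simp add: self_similar_def)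
      have b: "\<beta> / (1 + t) * (1 + t) powr \<beta> = \<beta> * (1 + t) powr (\<beta> - 1)"
        using t by (simp add: powr_diff)
      have "\<beta> / (1 + t) * ?S ?x =
          (\<Sum>b\<in>Basis. (\<beta> / (1 + t) * (1 + t) powr \<beta>) * (y \<bullet> b) * iter_dir_deriv [(b, 0)] \<phi> (?x, t))"
        by (simp add: sum_distrib_left mult_ac del: iter_dir_deriv.simps)
      then have K: "K (y, t) = iter_dir_deriv [(0, 1)] \<phi> (?x, t) + \<beta> / (1 + t) * ?S ?x"
        unfolding K_def b by (simp add: T_eq t del: iter_dir_deriv.simps)
      have "?H ?x = ?u ?x * K (y, t)"
        unfolding K by (simp only: distrib_left mult_ac)
      then show "((1 + t) powr \<beta>) ^ DIM('a) * ?H (0 + ?x) = v y * K (y, t)"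
        unfolding a add_0 using t by (simp only: u) simp
    qed
    finally show ?thesis .
  qed
  have "(LINT (x, t)|lebesgue_on space_time. self_similar \<alpha> \<beta> v x t * time_deriv \<phi> (x, t))
     + (LINT (x, t)|lebesgue_on space_time. self_similar (\<alpha> + 2 * s * \<beta>) \<beta> p x t * self_similar \<alpha> \<beta> v x t * space_laplacian \<phi> (x, t))
     + (LINT (x, t)|lebesgue_on space_time. self_similar (\<alpha> + 2 * s * \<beta>) \<beta> p x t * (G x t \<bullet> space_grad \<phi> (x, t)))
     = (LINT z|lebesgue_on space_time. e z)"
    unfolding I1 I2 I3 e_def
    using integral_space_time(1)[OF e1] integral_space_time(1)[OF e2] integral_space_time(1)[OF e3] by simp
  also have "\<dots> = (LINT t|lborel. indicator {0<..} t * (LINT x|lborel. e (x, t)))"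
    by (rule integral_space_time(2)[OF e])
  also have "\<dots> = (LINT t|lborel. LINT y|lborel. indicator {0<..} t * (v y * K (y, t)))"
    by (rule Bochner_Integration.integral_cong[OF refl]) (simp add: slice indicator_def)
  also have "\<dots> = (LINT y|lborel. LINT t|lborel. indicator {0<..} t * (v y * K (y, t)))"
  proof (rule lborel_pair.Fubini_integral)
    have "integrable lborel (\<lambda>z. indicator ((UNIV :: 'a set) \<times> {0::real<..}) z *\<^sub>R (v (fst z) * K z))"
      using integrable_continuous_compact[OF vK vK0] by (intro integrable_mult_indicator) (auto intro!: borel_open open_Times)
    also have "(\<lambda>z. indicator ((UNIV :: 'a set) \<times> {0::real<..}) z *\<^sub>R (v (fst z) * K z)) =
        (\<lambda>(y, t). indicator {0<..} t * (v y * K (y, t)))"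
      by (auto simp: indicator_def fun_eq_iff)
    finally show "integrable (lborel \<Otimes>\<^sub>M lborel) (\<lambda>(y, t). indicator {0<..} t * (v y * K (y, t)))"
      by (simp add: lborel_prod)
  qed
  also have "\<dots> = (LINT y|lborel. v y * (- \<phi> (y, 0)))"
  proof (rule Bochner_Integration.integral_cong[OF refl])
    fix y :: 'a
    have "(LINT t|lborel. indicator {0<..} t * (v y * K (y, t))) = (LINT t|lborel. v y * (indicator {0<..} t * K (y, t)))"
      by (simp add: mult_ac)
    also have "\<dots> = v y * (LINT t|lborel. indicator {0<..} t * K (y, t))" by simp
    also have "(LINT t|lborel. indicator {0<..} t * K (y, t)) = - \<phi> (y, 0)"
      by (rule trans[OF Bochner_Integration.integral_cong[OF refl]
            test_function_transport[OF \<phi> R(2), where \<beta> = \<beta> and y = y]])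
        (auto simp: K_def T_def indicator_def simp del: iter_dir_deriv.simps)
    finally show "(LINT t|lborel. indicator {0<..} t * (v y * K (y, t))) = v y * (- \<phi> (y, 0))" .
  qed
  also have "\<dots> = - (LINT y|lborel. v y * \<phi> (y, 0))" by simp
  also have "(LINT y|lborel. v y * \<phi> (y, 0)) = (LINT y|lebesgue. v y * \<phi> (y, 0))"
  proof (rule integral_completion[symmetric])
    have "continuous_on UNIV (\<lambda>y. \<phi> (y, 0))"
      by (rule continuous_on_compose2[OF \<phi>c[of "[]", simplified]]) (auto intro!: continuous_intros)
    then have [measurable]: "(\<lambda>y. \<phi> (y, 0)) \<in> borel_measurable borel"
      by (rule borel_measurable_continuous_onI)
    show "(\<lambda>y. v y * \<phi> (y, 0)) \<in> borel_measurable lborel" by measurable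
  qed
  finally show ?thesis by linarith
qed

text \<open>The witnesses are the scaled \<open>p\<close> and the classical gradient
  \<open>G\<close>. As \<open>\<alpha> = \<beta> * d\<close>, the condition
  \<open>\<beta> * d \<le> 2 * \<kappa>\<close> of \<open>self_similar_sobolev\<close> holds both
  for \<open>\<kappa> = \<alpha>\<close> and for
  \<open>\<kappa> = \<alpha> + 2 * s * \<beta>\<close>.\<close>

theorem self_similar_weak_solution: "is_weak_solution s v (self_similar \<alpha> \<beta> v)"
proof -
  let ?u = "self_similar \<alpha> \<beta> v" and ?p = "self_similar (\<alpha> + 2 * s * \<beta>) \<beta> p"
  have VF: "is_fourier_L2 (\<lambda>x. complex_of_real (v x)) V"
    using v_fourier by (simp add: V_def)
  have pF: "is_fourier_L2 (\<lambda>x. complex_of_real (p x)) (\<lambda>\<xi>. complex_of_real (norm \<xi> powr (2 * s)) * V \<xi>)"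
    using p_fourier by (simp add: V_def)
  have lap: "is_frac_laplacian s v p"
    using VF pF by (auto simp: is_frac_laplacian_def)
  have sob_u: "Linf_sobolev s ?u" "L2loc_sobolev (1 + s) ?u"
    using s \<beta> \<alpha>_eq by (auto intro!: self_similar_sobolev[OF VF] V_sobolev)
  have "L2loc_sobolev (1 - s) ?p"
    by (rule self_similar_sobolev(2)[OF pF _ _ p_sobolev])
      (use s \<beta> \<alpha>_eq in \<open>auto intro!: add_nonneg_nonneg\<close>)
  moreover have "AE t in lebesgue_on {0<..}. is_frac_laplacian s (\<lambda>x. ?u x t) (\<lambda>x. ?p x t)"
    by (intro AE_I2) (auto simp: space_restrict_space intro!: is_frac_laplacian_self_similar lap)
  moreover have "measurable_space_time G"
    unfolding G_def by (rule measurable_space_time_scaled) measurable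
  moreover have "AE t in lebesgue_on {0<..}. is_weak_gradient (\<lambda>x. ?u x t) (\<lambda>x. G x t)"
    by (intro AE_I2 is_weak_gradient_C1 self_similar_derivative G_cont)
  ultimately have "\<exists>p G. (AE t in lebesgue_on {0<..}. is_frac_laplacian s (\<lambda>x. ?u x t) (\<lambda>x. p x t)) \<and>
        L2loc_sobolev (1 - s) p \<and> measurable_space_time G \<and>
        (AE t in lebesgue_on {0<..}. is_weak_gradient (\<lambda>x. ?u x t) (\<lambda>x. G x t)) \<and>
        (\<forall>\<phi>. test_function \<phi> \<longrightarrow>
           - (LINT (x, t)|lebesgue_on space_time. ?u x t * time_deriv \<phi> (x, t))
           - (LINT (x, t)|lebesgue_on space_time. p x t * ?u x t * space_laplacian \<phi> (x, t))
           - (LINT (x, t)|lebesgue_on space_time. p x t * (G x t \<bullet> space_grad \<phi> (x, t)))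
           = (LINT x|lebesgue. v x * \<phi> (x, 0)))"
    using weak_formulation by (intro exI[of _ ?p] exI[of _ G]) auto
  then show ?thesis
    unfolding is_weak_solution_def
    using sob_u locally_integrable_continuous[OF v_cont] v_nonneg
    by (auto simp: self_similar_def intro!: AE_I2)
qed

end

end

section \<open>Uniqueness and scaling of the obstacle solution\<close>

text \<open>The set where \<open>f\<close> is negative is open and negligible, hence empty.\<close>

lemma AE_continuous_nonneg:
  fixes f :: "'a::euclidean_space \<Rightarrow> real"
  assumes f: "continuous_on UNIV f" and nonneg: "AE x in lebesgue. 0 \<le> f x"
  shows "0 \<le> f x"
proof (rule ccontr)
  assume "\<not> 0 \<le> f x"
  then have ne: "{x. f x < 0} \<noteq> {}" by (auto simp: not_le)
  have op: "open {x. f x < 0}" using f by (intro open_Collect_less) auto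
  have "{x \<in> space lebesgue. \<not> 0 \<le> f x} \<in> null_sets lebesgue"
    using nonneg op by (subst (asm) AE_iff_null) (auto simp: not_le)
  then have "negligible {x. f x < 0}"
    by (simp add: negligible_iff_null_sets not_le)
  then show False using open_not_negligible[OF op ne] by simp
qed

lemma AE_continuous_eq_0:
  fixes f :: "'a::euclidean_space \<Rightarrow> real"
  assumes f: "continuous_on UNIV f" and zero: "AE x in lebesgue. f x = 0"
  shows "f x = 0"
proof (rule antisym)
  show "0 \<le> f x" using zero by (intro AE_continuous_nonneg[OF f]) auto
  have "0 \<le> - f x" using zero f by (intro AE_continuous_nonneg continuous_intros) auto
  then show "f x \<le> 0" by simp
qed

text \<open>As \<open>v\<close> has bounded support, any transform witnessing
  \<open>is_frac_laplacian\<close> equals \<open>fourier_L1\<close> almost everywhere, and the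
  relation tolerates replacing \<open>p\<close> by \<open>q\<close> off a null set.\<close>

lemma frac_laplacian_fourier:
  fixes v p q :: "'a::euclidean_space \<Rightarrow> real"
  assumes lap: "is_frac_laplacian s v p"
    and v: "\<And>x. norm x > R \<Longrightarrow> v x = 0"
    and pq: "AE x in lebesgue. p x = q x" and qm: "q \<in> borel_measurable borel"
  shows "is_fourier_L2 (\<lambda>x. complex_of_real (v x)) (fourier_L1 (\<lambda>x. complex_of_real (v x)))"
    and "is_fourier_L2 (\<lambda>x. complex_of_real (q x))
      (\<lambda>\<xi>. complex_of_real (norm \<xi> powr (2 * s)) * fourier_L1 (\<lambda>x. complex_of_real (v x)) \<xi>)"
proof -
  obtain F where F: "is_fourier_L2 (\<lambda>x. complex_of_real (v x)) F"
    and P: "is_fourier_L2 (\<lambda>x. complex_of_real (p x)) (\<lambda>\<xi>. complex_of_real (norm \<xi> powr (2 * s)) * F \<xi>)"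
    using lap by (auto simp: is_frac_laplacian_def)
  note V = fourier_L2_eq_L1[OF F, of R]
  show V1: "is_fourier_L2 (\<lambda>x. complex_of_real (v x)) (fourier_L1 (\<lambda>x. complex_of_real (v x)))"
    by (rule V(1)) (simp add: v)
  have [measurable]: "fourier_L1 (\<lambda>x. complex_of_real (v x)) \<in> borel_measurable lebesgue"
    using V1 by (simp add: is_fourier_L2_def square_integrable_def)
  have [measurable]: "(\<lambda>\<xi>::'a. complex_of_real (norm \<xi> powr (2 * s))) \<in> borel_measurable lebesgue"
    by (rule measurable_borel_lebesgue) measurable
  have "AE \<xi> in lebesgue. F \<xi> = fourier_L1 (\<lambda>x. complex_of_real (v x)) \<xi>"
    by (rule V(2)) (simp add: v)
  then show "is_fourier_L2 (\<lambda>x. complex_of_real (q x))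
      (\<lambda>\<xi>. complex_of_real (norm \<xi> powr (2 * s)) * fourier_L1 (\<lambda>x. complex_of_real (v x)) \<xi>)"
    using pq qm by (intro is_fourier_L2_cong_AE[OF P]) (auto intro: measurable_borel_lebesgue)
qed

lemma continuous_on_holder:
  fixes g :: "'a::metric_space \<Rightarrow> 'b::real_normed_vector"
  assumes a: "a > 0" and K: "\<And>x y. norm (g x - g y) \<le> K * dist x y powr a"
  shows "continuous_on UNIV g"
proof -
  have "(g \<longlongrightarrow> g x) (at x)" for x
  proof (subst tendsto_dist_iff, rule Lim_null_comparison)
    have "((\<lambda>y. dist y x) \<longlongrightarrow> 0) (at x)"
      by (rule tendsto_dist_iff[THEN iffD1]) (rule tendsto_ident_at)
    then have "((\<lambda>y. K * dist y x powr a) \<longlongrightarrow> K * 0) (at x)"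
      using a by (intro tendsto_mult tendsto_const tendsto_zero_powrI[OF _ tendsto_const]) auto
    then show "((\<lambda>y. K * dist y x powr a) \<longlongrightarrow> 0) (at x)" by simp
    show "\<forall>\<^sub>F y in at x. norm (dist (g y) (g x)) \<le> K * dist y x powr a"
      using K by (intro always_eventually) (simp add: dist_norm)
  qed
  then show ?thesis by (simp add: continuous_on_def)
qed

text \<open>Turns the almost everywhere conditions of the definition into the pointwise ones of the
  locale. Positivity in the ball is exported beside the locale, for the use of
  \<open>mass_pos\<close>.\<close>

lemma obstacle_solution_data:
  fixes v :: "'a::euclidean_space \<Rightarrow> real"
  assumes sol: "is_obstacle_solution s \<beta> C v" and s: "0 < s" "s < 1" and \<beta>: "0 < \<beta>" and C: "0 < C"
  obtains p g where "obstacle s \<beta> C (obstacle_radius s \<beta> C TYPE('a)) v p g"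
    and "AE y in lebesgue. norm y < obstacle_radius s \<beta> C TYPE('a) \<longrightarrow> 0 < v y"
proof -
  define r where "r = obstacle_radius s \<beta> C TYPE('a)"
  have "gamma_sd s TYPE('a) > 0" using s by (simp add: gamma_sd_def add_pos_nonneg)
  then have r: "r > 0" using C \<beta> by (simp add: r_def obstacle_radius_def Let_def)
  \<comment> \<open>A sample exponent between 0 and \<open>s\<close>; it yields a continuous
    gradient.\<close>
  have "C1_holder (s / 2) v" using sol s by (auto simp: is_obstacle_solution_def)
  then obtain g K where g: "\<And>x. (v has_derivative (\<lambda>h. g x \<bullet> h)) (at x)"
    and K: "\<And>x y. norm (g x - g y) \<le> K * dist x y powr (s / 2)"
    unfolding C1_holder_def by blast
  have g_cont: "continuous_on UNIV g" by (rule continuous_on_holder[OF _ K]) (use s in simp)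
  have v_cont: "continuous_on UNIV v"
    using g by (meson continuous_at_imp_continuous_on has_derivative_continuous)
  obtain p where lap: "is_frac_laplacian s v p"
    and ge: "AE y in lebesgue. 0 \<le> v y \<and> p y \<ge> C - \<beta> / 2 * (norm y)\<^sup>2"
    and out: "\<And>y. y \<notin> ball 0 r \<Longrightarrow> v y = 0"
    and ins: "AE y in lebesgue. y \<in> ball 0 r \<longrightarrow> 0 < v y \<and> p y = C - \<beta> / 2 * (norm y)\<^sup>2"
    using sol unfolding is_obstacle_solution_def r_def by blast
  have "p \<in> borel_measurable lebesgue"
  proof -
    have "(\<lambda>x. complex_of_real (p x)) \<in> borel_measurable lebesgue"
      using lap by (auto simp: is_frac_laplacian_def is_fourier_L2_def square_integrable_def)
    then have "(\<lambda>x. Re (complex_of_real (p x))) \<in> borel_measurable lebesgue" by measurable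
    then show ?thesis by simp
  qed
  then obtain p1 where p1[measurable]: "p1 \<in> borel_measurable borel" and pp1: "AE x in lebesgue. p x = p1 x"
    using ex_borel_version by blast
  \<comment> \<open>This Borel version of \<open>p\<close> satisfies the equation at every point of the ball.\<close>
  define q where "q y = (if norm y < r then C - \<beta> / 2 * (norm y)\<^sup>2 else p1 y)" for y
  have qm: "q \<in> borel_measurable borel" unfolding q_def by measurable
  have pq: "AE y in lebesgue. p y = q y"
    using ins pp1 by eventually_elim (auto simp: q_def)
  have v0: "v y = 0" if "r \<le> norm y" for y using out[of y] that by simp
  then have v0': "\<And>y. norm y > r \<Longrightarrow> v y = 0" by simp
  have "obstacle s \<beta> C r v q g"
  proof
    show "0 \<le> v y" for y
      using ge by (intro AE_continuous_nonneg[OF v_cont]) auto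
    have "AE y in lebesgue. C - \<beta> / 2 * (norm y)\<^sup>2 \<le> q y"
      using ge pq by eventually_elim auto
    then show "AE y in lborel. C - \<beta> / 2 * (norm y)\<^sup>2 \<le> q y"
      by (simp add: AE_completion_iff)
    show "q y = C - \<beta> / 2 * (norm y)\<^sup>2" if "norm y < r" for y using that by (simp add: q_def)
  qed (use s \<beta> r g g_cont v0 qm frac_laplacian_fourier[OF lap v0' pq qm] in auto)
  moreover have "AE y in lebesgue. norm y < r \<longrightarrow> 0 < v y"
    using ins by eventually_elim auto
  ultimately show ?thesis using that[of q g] by (simp add: r_def)
qed

section \<open>Scaling, uniqueness, mass and the limit at \<open>t = -1\<close>\<close>

context obstacle
begin

lemma is_frac_laplacian: "is_frac_laplacian s v p"
  using v_fourier p_fourier by (auto simp: is_frac_laplacian_def)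

text \<open>Substitution \<open>x = (1 + t) powr \<sigma> *\<^sub>R y\<close>. The exponents are
  left free because the statement serves three purposes: conservation of mass, the limit to the
  Dirac mass, and the mass of a rescaled obstacle solution.\<close>

lemma self_similar_pairing:
  assumes t: "t > -1" and [measurable]: "\<psi> \<in> borel_measurable borel"
  shows "(LINT x|lborel. self_similar \<kappa> \<sigma> v x t * \<psi> x) =
    (1 + t) powr (\<sigma> * DIM('a) - \<kappa>) * (LINT y|lborel. v y * \<psi> ((1 + t) powr \<sigma> *\<^sub>R y))"
proof -
  let ?a = "(1 + t) powr \<sigma>"
  let ?h = "\<lambda>y. v y * \<psi> (?a *\<^sub>R y)"
  have "(LINT x|lborel. self_similar \<kappa> \<sigma> v x t * \<psi> x) =
      (LINT x|lborel. 1 / (1 + t) powr \<kappa> * ?h (0 + inverse ?a *\<^sub>R x))"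
    using t by (intro Bochner_Integration.integral_cong refl) (simp add: self_similar_def)
  also have "\<dots> = 1 / (1 + t) powr \<kappa> * (LINT x|lborel. ?h (0 + inverse ?a *\<^sub>R x))"
    by (rule integral_mult_right_zero)
  also have "(LINT x|lborel. ?h (0 + inverse ?a *\<^sub>R x)) = ?a ^ DIM('a) * (LINT y|lborel. ?h y)"
    using t by (subst lborel_integral_affine[where f = ?h]) (auto simp: power_inverse divide_inverse mult.commute)
  also have "1 / (1 + t) powr \<kappa> * (?a ^ DIM('a) * (LINT y|lborel. ?h y)) =
      (1 + t) powr (\<sigma> * DIM('a) - \<kappa>) * (LINT y|lborel. ?h y)"
    using t by (simp add: powr_power powr_diff mult.commute)
  finally show ?thesis .
qed

text \<open>The paraboloid with constant \<open>k * C\<close> is \<open>k\<close> times the original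
  one at \<open>x / sqrt k\<close>, so the fractional Laplacian must be multiplied by
  \<open>k\<close>. Dilation by \<open>sqrt k\<close> costs it a factor \<open>k powr (- s)\<close>,
  hence the amplitude \<open>k powr (1 + s)\<close> of \<open>v\<close>. Writing this as
  \<open>self_similar\<close> at time \<open>k - 1\<close>, with exponents \<open>- (1 + s)\<close>
  and \<open>1 / 2\<close>, makes the scaling lemmas applicable; the pressure exponent becomes
  \<open>- (1 + s) + s = - 1\<close>.\<close>

lemma rescale:
  assumes k: "k > 0"
  obtains q h where "obstacle s \<beta> (k * C) (k powr (1 / 2) * r)
    (\<lambda>x. self_similar (- (1 + s)) (1 / 2) v x (k - 1)) q h"
proof -
  let ?a = "k powr (1 / 2)"
  let ?v = "\<lambda>x. self_similar (- (1 + s)) (1 / 2) v x (k - 1)"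
  let ?p = "\<lambda>x. self_similar (- 1) (1 / 2) p x (k - 1)"
  let ?g = "\<lambda>x. (k powr (1 + s) / ?a) *\<^sub>R g (x /\<^sub>R ?a)"
  have a: "?a > 0" "?a\<^sup>2 = k" using k by (auto simp: powr_power)
  have inv: "1 / (1 + (k - 1)) powr (- q) = k powr q" for q
    by (subst powr_minus) (simp add: inverse_eq_divide)
  have v_eq: "?v x = k powr (1 + s) * v (x /\<^sub>R ?a)" for x
    unfolding self_similar_def inv by simp
  have p_eq': "?p x = k * p (x /\<^sub>R ?a)" for x
    unfolding self_similar_def inv using k by simp
  have le: "r \<le> norm (x /\<^sub>R ?a) \<longleftrightarrow> ?a * r \<le> norm x" for x :: 'a
    using a(1) by (simp add: field_simps inverse_eq_divide)
  have vz: "?v x = 0" if "?a * r \<le> norm x" for x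
    unfolding v_eq using v_zero[of "x /\<^sub>R ?a"] that le[of x] by simp
  then have vz': "\<And>x. norm x > ?a * r \<Longrightarrow> ?v x = 0" by simp
  have par: "C - \<beta> / 2 * (norm (x /\<^sub>R ?a))\<^sup>2 = (k * C - \<beta> / 2 * (norm x)\<^sup>2) / k" for x :: 'a
  proof -
    have "(norm (x /\<^sub>R ?a))\<^sup>2 = (norm x)\<^sup>2 / ?a\<^sup>2"
      by (simp add: power_mult_distrib power_divide inverse_eq_divide)
    then show ?thesis unfolding a(2) using k by (simp add: field_simps)
  qed
  have lap: "is_frac_laplacian s ?v ?p"
    using is_frac_laplacian_self_similar[OF is_frac_laplacian, of "k - 1" "- (1 + s)" "1 / 2"] k by simp
  have pm: "?p \<in> borel_measurable borel" unfolding p_eq' by measurable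
  have "obstacle s \<beta> (k * C) (?a * r) ?v ?p ?g"
  proof
    show "(?v has_derivative (\<lambda>h. ?g y \<bullet> h)) (at y)" for y
    proof -
      have "((\<lambda>x. v (x /\<^sub>R ?a)) has_derivative (\<lambda>h. g (y /\<^sub>R ?a) \<bullet> (h /\<^sub>R ?a))) (at y)"
        by (rule has_derivative_compose[OF _ deriv]) (auto intro!: derivative_eq_intros)
      then have "((\<lambda>x. k powr (1 + s) * v (x /\<^sub>R ?a)) has_derivative (\<lambda>h. k powr (1 + s) * (g (y /\<^sub>R ?a) \<bullet> (h /\<^sub>R ?a)))) (at y)"
        by (rule has_derivative_mult_right)
      then show ?thesis unfolding v_eq by (simp add: field_simps)
    qed
    show "continuous_on UNIV ?g"
      by (intro continuous_intros continuous_on_compose2[OF g_cont]) auto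
    show "?p y = k * C - \<beta> / 2 * (norm y)\<^sup>2" if "norm y < ?a * r" for y
      using p_eq[of "y /\<^sub>R ?a"] that le[of y] k unfolding par p_eq' by simp
    have "AE y in lebesgue. C - \<beta> / 2 * (norm y)\<^sup>2 \<le> p y"
      using p_ge by (simp add: AE_completion_iff)
    from AE_lebesgue_affine[OF _ this, of "inverse ?a" 0] a(1)
    have "AE y in lebesgue. C - \<beta> / 2 * (norm (y /\<^sub>R ?a))\<^sup>2 \<le> p (y /\<^sub>R ?a)" by simp
    then show "AE y in lborel. k * C - \<beta> / 2 * (norm y)\<^sup>2 \<le> ?p y"
      unfolding par p_eq' AE_completion_iff by eventually_elim (use k in \<open>simp add: field_simps\<close>)
    show "0 \<le> ?v y" for y unfolding v_eq by (simp add: v_nonneg)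
  qed (use s \<beta> a r pm vz frac_laplacian_fourier[OF lap vz' _ pm] in auto)
  then show ?thesis by (rule that)
qed

text \<open>The difference of two solutions is orthogonal to its fractional Laplacian, so its Fourier
  transform vanishes.\<close>

lemma unique:
  assumes other: "obstacle s \<beta> C r w q h"
  shows "w = v"
proof -
  interpret O: obstacle s \<beta> C r w q h by (fact other)
  define z where "z x = v x - w x" for x
  let ?z = "\<lambda>x. complex_of_real (z x)"
  have zc: "continuous_on UNIV z" unfolding z_def by (intro continuous_intros v_cont O.v_cont)
  have z0: "z x = 0" if "r \<le> norm x" for x using that by (simp add: z_def v_zero O.v_zero)
  have Z: "fourier_L1 ?z \<xi> = V \<xi> - O.V \<xi>" for \<xi>
  proof -
    have "fourier_L1 ?z \<xi> = (LINT x|lborel. cis (- (x \<bullet> \<xi>)) * v x - cis (- (x \<bullet> \<xi>)) * w x)"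
      by (subst fourier_L1_lborel) (auto simp: z_def algebra_simps)
    also have "\<dots> = (LINT x|lborel. cis (- (x \<bullet> \<xi>)) * v x) - (LINT x|lborel. cis (- (x \<bullet> \<xi>)) * w x)"
      using v_integrable O.v_integrable by (intro Bochner_Integration.integral_diff integrable_cis_mult) auto
    finally show ?thesis by (simp add: V_def O.V_def fourier_L1_lborel)
  qed
  have ZL2: "integrable lborel (\<lambda>\<xi>. (cmod (fourier_L1 ?z \<xi>))\<^sup>2)"
  proof (rule Bochner_Integration.integrable_bound)
    show "integrable lborel (\<lambda>\<xi>. 2 * (cmod (V \<xi>))\<^sup>2 + 2 * (cmod (O.V \<xi>))\<^sup>2)"
      using V_L2 O.V_L2 by simp
    show "AE \<xi> in lborel. norm ((cmod (fourier_L1 ?z \<xi>))\<^sup>2) \<le> norm (2 * (cmod (V \<xi>))\<^sup>2 + 2 * (cmod (O.V \<xi>))\<^sup>2)"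
    proof (rule AE_I2)
      fix \<xi>
      have "(cmod (V \<xi> - O.V \<xi>))\<^sup>2 \<le> (cmod (V \<xi>) + cmod (O.V \<xi>))\<^sup>2"
        by (intro power_mono norm_triangle_ineq4) auto
      then show "norm ((cmod (fourier_L1 ?z \<xi>))\<^sup>2) \<le> norm (2 * (cmod (V \<xi>))\<^sup>2 + 2 * (cmod (O.V \<xi>))\<^sup>2)"
        using sum_squares_bound[of "cmod (V \<xi>)" "cmod (O.V \<xi>)"] by (simp add: Z power2_sum)
    qed
  qed (simp add: Z)
  have zcc: "continuous_on UNIV ?z" using zc by (intro continuous_intros)
  have zcz: "?z x = 0" if "norm x > r" for x using z0[of x] that by simp
  note parseval = parseval_L2[OF _ _ _ zcc zcz ZL2]
  have VF: "is_fourier_L2 (\<lambda>x. complex_of_real (v x)) V" using v_fourier by (simp add: V_def)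
  have WF: "is_fourier_L2 (\<lambda>x. complex_of_real (w x)) O.V" using O.v_fourier by (simp add: O.V_def)
  have pF: "is_fourier_L2 (\<lambda>x. complex_of_real (p x)) (\<lambda>\<xi>. complex_of_real (norm \<xi> powr (2 * s)) * V \<xi>)"
    using p_fourier by (simp add: V_def)
  have qF: "is_fourier_L2 (\<lambda>x. complex_of_real (q x)) (\<lambda>\<xi>. complex_of_real (norm \<xi> powr (2 * s)) * O.V \<xi>)"
    using O.p_fourier by (simp add: O.V_def)
  have pm: "(\<lambda>x. complex_of_real (p x)) \<in> borel_measurable borel"
    and qm: "(\<lambda>x. complex_of_real (q x)) \<in> borel_measurable borel"
    and Pm: "(\<lambda>\<xi>. complex_of_real (norm \<xi> powr (2 * s)) * V \<xi>) \<in> borel_measurable borel"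
    and Qm: "(\<lambda>\<xi>. complex_of_real (norm \<xi> powr (2 * s)) * O.V \<xi>) \<in> borel_measurable borel"
    by measurable
  note P1 = parseval[OF pF] and P2 = parseval[OF qF] and P3 = parseval[OF VF] and P4 = parseval[OF WF]
  \<comment> \<open>In the ball \<open>p\<close> and \<open>q\<close> are the same paraboloid, and
    outside it \<open>z\<close> vanishes because the two solutions share the radius
    \<open>r\<close>.\<close>
  have pq: "p x * z x = q x * z x" for x
    by (cases "norm x < r") (auto simp: p_eq O.p_eq z0)
  have sq: "\<zeta> * cnj \<zeta> = complex_of_real ((cmod \<zeta>)\<^sup>2)" for \<zeta>
    by (rule complex_norm_square[symmetric])
  have E: "complex_of_real (norm \<xi> powr (2 * s)) * V \<xi> * cnj (fourier_L1 ?z \<xi>)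
      - complex_of_real (norm \<xi> powr (2 * s)) * O.V \<xi> * cnj (fourier_L1 ?z \<xi>)
      = complex_of_real (norm \<xi> powr (2 * s) * (cmod (fourier_L1 ?z \<xi>))\<^sup>2)" for \<xi>
    unfolding of_real_mult sq[symmetric] unfolding Z by (simp add: algebra_simps)
  have Ei: "integrable lborel (\<lambda>\<xi>. complex_of_real (norm \<xi> powr (2 * s) * (cmod (fourier_L1 ?z \<xi>))\<^sup>2))"
    unfolding E[symmetric] by (intro Bochner_Integration.integrable_diff P1(1) P2(1)) measurable
  have "(LINT \<xi>|lborel. complex_of_real (norm \<xi> powr (2 * s) * (cmod (fourier_L1 ?z \<xi>))\<^sup>2)) =
      (LINT \<xi>|lborel. complex_of_real (norm \<xi> powr (2 * s)) * V \<xi> * cnj (fourier_L1 ?z \<xi>))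
      - (LINT \<xi>|lborel. complex_of_real (norm \<xi> powr (2 * s)) * O.V \<xi> * cnj (fourier_L1 ?z \<xi>))"
    unfolding E[symmetric] by (intro Bochner_Integration.integral_diff P1(1) P2(1)) measurable
  also have "\<dots> = (2 * pi) ^ DIM('a) * (LINT x|lborel. complex_of_real (p x) * cnj (?z x))
      - (2 * pi) ^ DIM('a) * (LINT x|lborel. complex_of_real (q x) * cnj (?z x))"
    by (simp only: P1(2)[OF pm Pm] P2(2)[OF qm Qm])
  also have "\<dots> = 0"
    by (simp add: pq flip: of_real_mult)
  finally have "complex_of_real (LINT \<xi>|lborel. norm \<xi> powr (2 * s) * (cmod (fourier_L1 ?z \<xi>))\<^sup>2) = complex_of_real 0"
    unfolding integral_complex_of_real by simp
  then have "(LINT \<xi>|lborel. norm \<xi> powr (2 * s) * (cmod (fourier_L1 ?z \<xi>))\<^sup>2) = 0"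
    by (simp only: of_real_eq_iff)
  then have "AE \<xi> in lborel. norm \<xi> powr (2 * s) * (cmod (fourier_L1 ?z \<xi>))\<^sup>2 = 0"
    using Ei[unfolded complex_of_real_integrable_eq] by (subst (asm) integral_nonneg_eq_0_iff_AE) auto
  \<comment> \<open>The multiplier vanishes only at the origin, a null set.\<close>
  then have Z0: "AE \<xi> in lborel. fourier_L1 ?z \<xi> = 0"
    using AE_lborel_singleton[of 0] by eventually_elim auto
  \<comment> \<open>From the vanishing transform back to \<open>z\<close>:
    \<open>is_fourier_L2\<close> is at hand for \<open>v\<close> and \<open>w\<close> separately, so
    Parseval is applied to each of them against \<open>z\<close>, and the two results are subtracted
    to give the integral of \<open>z\<^sup>2\<close>.\<close>
  have "(2 * pi) ^ DIM('a) * complex_of_real (LINT x|lborel. v x * z x) = (LINT \<xi>|lborel. V \<xi> * cnj (fourier_L1 ?z \<xi>))"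
    by (subst P3(2)) (auto simp flip: of_real_mult)
  also have "\<dots> = (LINT \<xi>::'a|lborel. 0)"
    by (rule integral_cong_AE) (use Z0 in \<open>auto simp: Z\<close>)
  finally have vz: "(LINT x|lborel. v x * z x) = 0" by simp
  have "(2 * pi) ^ DIM('a) * complex_of_real (LINT x|lborel. w x * z x) = (LINT \<xi>|lborel. O.V \<xi> * cnj (fourier_L1 ?z \<xi>))"
    by (subst P4(2)) (auto simp flip: of_real_mult)
  also have "\<dots> = (LINT \<xi>::'a|lborel. 0)"
    by (rule integral_cong_AE) (use Z0 in \<open>auto simp: Z\<close>)
  finally have wz: "(LINT x|lborel. w x * z x) = 0" by simp
  have i: "integrable lborel (\<lambda>x. v x * z x)" "integrable lborel (\<lambda>x. w x * z x)" "integrable lborel (\<lambda>x. (z x)\<^sup>2)"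
    by (rule integrable_continuous_compact[where R = r];
        auto intro!: continuous_intros v_cont O.v_cont zc simp: z0)+
  have "(LINT x|lborel. (z x)\<^sup>2) = (LINT x|lborel. v x * z x - w x * z x)"
    by (simp add: z_def power2_eq_square algebra_simps)
  also have "\<dots> = 0" using i vz wz by simp
  finally have "AE x in lborel. (z x)\<^sup>2 = 0"
    using i(3) by (subst (asm) integral_nonneg_eq_0_iff_AE) auto
  then have "AE x in lebesgue. z x = 0" by (simp add: AE_completion_iff)
  then have "z x = 0" for x by (rule AE_continuous_eq_0[OF zc])
  then show ?thesis by (auto simp: z_def fun_eq_iff)
qed

text \<open>A nonnegative function with zero integral vanishes almost everywhere, which would make
  the ball of positivity a null set.\<close>

lemma mass_pos:
  assumes "AE y in lebesgue. norm y < r \<longrightarrow> 0 < v y"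
  shows "0 < (LINT y|lborel. v y)"
proof (rule ccontr)
  assume "\<not> 0 < (LINT y|lborel. v y)"
  moreover have "0 \<le> (LINT y|lborel. v y)" by (rule integral_nonneg_AE) (simp add: v_nonneg)
  ultimately have "(LINT y|lborel. v y) = 0" by simp
  then have "AE y in lborel. v y = 0"
    using v_integrable v_nonneg by (subst (asm) integral_nonneg_eq_0_iff_AE) auto
  then have "AE y in lebesgue. v y = 0" by (simp add: AE_completion_iff)
  \<comment> \<open>The continuous function \<open>norm y - r\<close> would be nonnegative almost
    everywhere, hence also at the origin, contradicting \<open>0 < r\<close>.\<close>
  with assms have "AE y in lebesgue. 0 \<le> norm (y :: 'a) - r" by eventually_elim auto
  then have "0 \<le> norm (0::'a) - r" by (rule AE_continuous_nonneg[rotated]) (intro continuous_intros)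
  then show False using r by simp
qed

text \<open>The exponent in \<open>self_similar_pairing\<close> is
  \<open>\<beta> * d - \<alpha> = 0\<close>.\<close>

lemma self_similar_mass:
  assumes t: "t > -1" and \<alpha>: "\<alpha> = \<beta> * real DIM('a)"
  shows "has_bochner_integral lebesgue (\<lambda>x. self_similar \<alpha> \<beta> v x t) (LINT y|lborel. v y)"
proof -
  have m: "(\<lambda>x. self_similar \<alpha> \<beta> v x t) \<in> borel_measurable lborel"
    using borel_measurable_continuous_onI[OF self_similar_cont] by simp
  have "(LINT x|lborel. self_similar \<alpha> \<beta> v x t) = (LINT y|lborel. v y)"
    using self_similar_pairing[OF t, of "\<lambda>_. 1" \<alpha> \<beta>] t by (simp add: \<alpha>)
  moreover have "integrable lborel (\<lambda>x. self_similar \<alpha> \<beta> v x t)"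
    unfolding self_similar_def
    using lborel_integrable_affine[OF _ v_integrable, of "inverse ((1 + t) powr \<beta>)" 0] t by simp
  ultimately show ?thesis
    using m by (simp add: has_bochner_integral_iff integrable_completion integral_completion)
qed

text \<open>After the substitution the profile stays fixed and the test function is evaluated at
  \<open>(1 + t) powr \<beta> *\<^sub>R y\<close>, which tends to 0 because \<open>\<beta>\<close>
  is positive. A bound of \<open>\<psi>\<close> times \<open>v\<close> dominates.\<close>

lemma self_similar_tendsto_delta:
  assumes \<alpha>: "\<alpha> = \<beta> * real DIM('a)" and \<psi>: "test_function \<psi>"
  shows "((\<lambda>t. LINT x|lebesgue. self_similar \<alpha> \<beta> v x t * \<psi> x) \<longlongrightarrow> (LINT y|lborel. v y) * \<psi> 0) (at_right (-1))"
  unfolding tendsto_at_iff_sequentially o_def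
proof safe
  fix X :: "nat \<Rightarrow> real" assume X: "\<forall>i. X i \<in> {-1<..} - {-1}" "X \<longlonglongrightarrow> -1"
  have \<psi>c: "continuous_on UNIV \<psi>" using test_function_continuous[OF \<psi>, of UNIV "[]"] by simp
  have \<psi>m[measurable]: "\<psi> \<in> borel_measurable borel" using \<psi>c by (rule borel_measurable_continuous_onI)
  obtain R where R: "\<And>hs z. norm z > R \<Longrightarrow> iter_dir_deriv hs \<psi> z = 0"
    using test_function_support[OF \<psi>] by blast
  obtain B where B: "B \<ge> 0" "\<And>x. norm (\<psi> x) \<le> B"
    using bounded_continuous_compact[OF \<psi>c, of R] R[of _ "[]"] by auto
  have eq: "(LINT x|lebesgue. self_similar \<alpha> \<beta> v x (X n) * \<psi> x) = (LINT y|lborel. v y * \<psi> ((1 + X n) powr \<beta> *\<^sub>R y))" for n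
  proof -
    have "(LINT x|lebesgue. self_similar \<alpha> \<beta> v x (X n) * \<psi> x) = (LINT x|lborel. self_similar \<alpha> \<beta> v x (X n) * \<psi> x)"
      using borel_measurable_continuous_onI[OF self_similar_cont]
      by (intro integral_completion borel_measurable_times) auto
    then show ?thesis
      using self_similar_pairing[of "X n" \<psi> \<alpha> \<beta>] X(1)[rule_format, of n] by (simp add: \<alpha>)
  qed
  have "(\<lambda>n. (1 + X n) powr \<beta>) \<longlonglongrightarrow> 0"
  proof (rule tendsto_zero_powrI[OF _ tendsto_const _ \<beta>])
    show "(\<lambda>n. 1 + X n) \<longlonglongrightarrow> 0" using tendsto_add[OF tendsto_const X(2), of 1] by simp
    have "0 \<le> 1 + X n" for n using X(1)[rule_format, of n] by simp
    then show "\<forall>\<^sub>F n in sequentially. 0 \<le> 1 + X n" by simp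
  qed
  then have lim: "(\<lambda>n. v y * \<psi> ((1 + X n) powr \<beta> *\<^sub>R y)) \<longlonglongrightarrow> v y * \<psi> 0" for y
  proof -
    assume 0: "(\<lambda>n. (1 + X n) powr \<beta>) \<longlonglongrightarrow> 0"
    have "(\<lambda>n. (1 + X n) powr \<beta> *\<^sub>R y) \<longlonglongrightarrow> 0 *\<^sub>R y" by (intro tendsto_intros 0)
    moreover have "isCont \<psi> 0" using \<psi>c by (simp add: continuous_on_eq_continuous_at)
    ultimately show ?thesis by (intro tendsto_intros isCont_tendsto_compose[where g = \<psi>]) auto
  qed
  have "(\<lambda>n. LINT y|lborel. v y * \<psi> ((1 + X n) powr \<beta> *\<^sub>R y)) \<longlonglongrightarrow> (LINT y|lborel. v y * \<psi> 0)"
  proof (rule integral_dominated_convergence[where w = "\<lambda>y. v y * B"])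
    show "integrable lborel (\<lambda>y. v y * B)" using v_integrable by simp
    show "AE y in lborel. (\<lambda>n. v y * \<psi> ((1 + X n) powr \<beta> *\<^sub>R y)) \<longlonglongrightarrow> v y * \<psi> 0"
      using lim by simp
    show "AE y in lborel. norm (v y * \<psi> ((1 + X n) powr \<beta> *\<^sub>R y)) \<le> v y * B" for n
      using B(2) v_nonneg by (auto simp: abs_mult intro!: mult_left_mono)
  qed measurable
  then show "(\<lambda>n. LINT x|lebesgue. self_similar \<alpha> \<beta> v x (X n) * \<psi> x) \<longlonglongrightarrow> (LINT y|lborel. v y) * \<psi> 0"
    unfolding eq by simp
qed

end

section \<open>The self-similar solution\<close>

lemma powr_mass_law:
  fixes M M1 k :: real
  assumes "0 < M" "0 < M1" "0 < k"
  shows "\<exists>!C. 0 < C \<and> M = M1 * C powr k"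
proof (rule ex1I[of _ "(M / M1) powr (1 / k)"])
  show "0 < (M / M1) powr (1 / k) \<and> M = M1 * ((M / M1) powr (1 / k)) powr k"
    using assms by (simp add: powr_powr)
  fix C assume "0 < C \<and> M = M1 * C powr k"
  then show "C = (M / M1) powr (1 / k)"
    using assms by (simp add: powr_powr)
qed

theorem theorem4p6:
  fixes s \<alpha> \<beta> M :: real
    and v :: "real \<Rightarrow> real ^ 'n \<Rightarrow> real"
  assumes "0 < s" "s < 1"
    and "\<alpha> = real CARD('n) / (real CARD('n) + 2 * (1 + s))"
    and "\<beta> = 1 / (real CARD('n) + 2 * (1 + s))"
    and "0 < M"
    and "\<forall>C>0. is_obstacle_solution s \<beta> C (v C)"
  shows
    "(\<exists>!C. 0 < C \<and> M = (LINT y|lebesgue. v 1 y) * C powr (1 + real CARD('n) / 2 + s)) \<and>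
     (\<forall>C>0. M = (LINT y|lebesgue. v 1 y) * C powr (1 + real CARD('n) / 2 + s) \<longrightarrow>
        is_weak_solution s (v C) (self_similar \<alpha> \<beta> (v C)) \<and>
        (\<forall>x. self_similar \<alpha> \<beta> (v C) x 0 = v C x) \<and>
        (\<forall>t>-1. has_bochner_integral lebesgue (\<lambda>x. self_similar \<alpha> \<beta> (v C) x t) M) \<and>
        (\<forall>\<psi> :: real ^ 'n \<Rightarrow> real. test_function \<psi> \<longrightarrow>
           ((\<lambda>t. LINT x|lebesgue. self_similar \<alpha> \<beta> (v C) x t * \<psi> x) \<longlongrightarrow> M * \<psi> 0)
             (at_right (-1))))"
proof -
  let ?r = "\<lambda>C. obstacle_radius s \<beta> C TYPE(real ^ 'n)"
  let ?k = "1 + real CARD('n) / 2 + s"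
  have \<beta>: "0 < \<beta>" using assms(1,4) by (simp add: add_pos_pos)
  have \<alpha>: "\<alpha> = \<beta> * real DIM(real ^ 'n)" using assms(3,4) by simp
  have \<beta>': "\<beta> = 1 / (real DIM(real ^ 'n) + 2 * (1 + s))" using assms(4) by simp
  obtain p1 g1 where O1: "obstacle s \<beta> 1 (?r 1) (v 1) p1 g1"
    and pos: "AE y in lebesgue. norm y < ?r 1 \<longrightarrow> 0 < v 1 y"
    using obstacle_solution_data[OF assms(6)[rule_format, of 1] assms(1,2) \<beta>] by auto
  interpret O1: obstacle s \<beta> 1 "?r 1" "v 1" p1 g1 by (fact O1)
  have M1: "(LINT y|lebesgue. v 1 y) = (LINT y|lborel. v 1 y)"
    by (rule integral_completion) simp
  have ex1: "\<exists>!C. 0 < C \<and> M = (LINT y|lebesgue. v 1 y) * C powr ?k"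
    unfolding M1 using assms(1,5) O1.mass_pos[OF pos] by (intro powr_mass_law) auto
  moreover have "is_weak_solution s (v C) (self_similar \<alpha> \<beta> (v C)) \<and>
        (\<forall>x. self_similar \<alpha> \<beta> (v C) x 0 = v C x) \<and>
        (\<forall>t>-1. has_bochner_integral lebesgue (\<lambda>x. self_similar \<alpha> \<beta> (v C) x t) M) \<and>
        (\<forall>\<psi> :: real ^ 'n \<Rightarrow> real. test_function \<psi> \<longrightarrow>
           ((\<lambda>t. LINT x|lebesgue. self_similar \<alpha> \<beta> (v C) x t * \<psi> x) \<longlongrightarrow> M * \<psi> 0)
             (at_right (-1)))"
    if C: "C > 0" and M: "M = (LINT y|lebesgue. v 1 y) * C powr ?k" for C
  proof -
    obtain p g where O: "obstacle s \<beta> C (?r C) (v C) p g"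
      using obstacle_solution_data[OF assms(6)[rule_format, OF C] assms(1,2) \<beta> C] by blast
    interpret O: obstacle s \<beta> C "?r C" "v C" p g by (fact O)
    \<comment> \<open>\<open>v 1\<close> rescaled by the factor \<open>C\<close>. It solves the same
      obstacle problem as \<open>v C\<close>, radius included, so uniqueness identifies the
      two.\<close>
    let ?w = "\<lambda>x. self_similar (- (1 + s)) (1 / 2) (v 1) x (C - 1)"
    obtain q h where "obstacle s \<beta> (C * 1) (C powr (1 / 2) * ?r 1) ?w q h"
      using O1.rescale[OF C] .
    moreover have "C powr (1 / 2) * ?r 1 = ?r C"
      by (simp add: obstacle_radius_def Let_def)
    ultimately have "?w = v C" by (intro O.unique) simp
    then have "(LINT y|lborel. v C y) = (LINT x|lborel. ?w x * 1)" by simp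
    \<comment> \<open>The exponent \<open>d / 2 + (1 + s)\<close> produced here is the one of the
      mass law.\<close>
    also have "\<dots> = (1 + (C - 1)) powr (1 / 2 * DIM(real ^ 'n) - (- (1 + s))) * (LINT y|lborel. v 1 y * 1)"
      by (rule O1.self_similar_pairing) (use C in auto)
    also have "\<dots> = M" unfolding M M1 by (simp add: algebra_simps)
    finally have mass: "(LINT y|lborel. v C y) = M" .
    show ?thesis
      using O.self_similar_weak_solution[OF \<beta>' \<alpha>] O.self_similar_mass[OF _ \<alpha>]
        O.self_similar_tendsto_delta[OF \<alpha>]
      unfolding mass by (auto simp: self_similar_def)
  qed
  ultimately show ?thesis by blast
qed

end
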